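(* Assume that the spectrum $(\lambda_j)_{j\geq1}$ satisfies the following uniform gap property: there exists $\gamma>0$ such that, for all $j,k$, if $\lambda_j\neq\lambda_k$ then $|\lambda_j-\lambda_k|\geq\gamma$. Then, for every measurable subset $\omega$ of $\Omega$, $$\lim_{T\to+\infty}\frac{C_T(\omega)}{T}=\frac12 g_1(\omega).$$
   Context: $(\Omega,g)$ is a compact connected Riemannian manifold of dimension $n$ without boundary, $v_g$ is its Riemannian volume measure (measurability is with respect to $v_g$), $\triangle_g$ is the Laplace-Beltrami operator. All functions are complex valued. Constants are removed: $(\phi_j)_{j\geq1}$ is a Hilbert basis of the space $L^2_0(\Omega)$ of zero-mean $L^2$ functions, consisting of eigenfunctions, $-\triangle_g\phi_j=\lambda_j^2\phi_j$, with $0<\lambda_1\leq\lambda_2\leq\cdots\to+\infty$ (counted with multiplicity). Set $\Lambda=\sqrt{-\triangle_g}$ and let $\mathcal{X}$ be the set of pairs $(y^0,y^1)$ with $y^0=\sum_j y^0_j\phi_j\in L^2_0(\Omega)$ and $y^1=\sum_j y^1_j\phi_j$ in the dual $H^{-1}$ of the space of zero-mean $H^1$ functions, normed by $$\Vert(y^0,y^1)\Vert_{L^2\times H^{-1}}^2=\Vert y^0\Vert_{L^2}^2+\Vert\Lambda^{-1}y^1\Vert_{L^2}^2=\sum_j\left(|y^0_j|^2+\lambda_j^{-2}|y^1_j|^2\right)<+\infty .$$ For $(y^0,y^1)\in\mathcal{X}$, $y$ denotes the solution of the wave equation $\partial_{tt}y-\triangle_g y=0$ with $y(0,\cdot)=y^0$,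 $\partial_ty(0,\cdot)=y^1$, i.e. $y(t)=\sum_j\left(y^0_j\cos(\lambda_jt)+y^1_j\frac{\sin(\lambda_jt)}{\lambda_j}\right)\phi_j$. For $T>0$ and measurable $\omega\subset\Omega$: $J_T^\omega(y^0,y^1)=\dfrac{\int_0^T\int_\omega|y(t,x)|^2\,dv_g\,dt}{\Vert(y^0,y^1)\Vert^2_{L^2\times H^{-1}}}$; the observability constant is $C_T(\omega)=\inf\{J_T^\omega(y^0,y^1): (y^0,y^1)\in\mathcal{X}\setminus\{(0,0)\}\}$. The spectral quantity is $g_1(\omega)=\inf_{\phi}\frac{\int_\omega|\phi|^2dv_g}{\int_\Omega|\phi|^2dv_g}$, the infimum running over all nonconstant eigenfunctions $\phi$ of $-\triangle_g$. *)

theory Defs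
  imports "HOL-Analysis.Analysis"
begin

section \<open>Smooth functions on open subsets of normed spaces\<close>

text \<open>\<open>Ck_on k f S\<close> is meant for open \<open>S\<close>: all iterated directional derivatives of order at
  most \<open>k\<close> exist as Frechet derivatives and are continuous.\<close>

primrec Ck_on :: "nat \<Rightarrow> ('a::real_normed_vector \<Rightarrow> 'b::real_normed_vector) \<Rightarrow> 'a set \<Rightarrow> bool" where
  "Ck_on 0 f S \<longleftrightarrow> continuous_on S f"
| "Ck_on (Suc k) f S \<longleftrightarrow>
     (\<forall>x\<in>S. f differentiable (at x)) \<and> (\<forall>v. Ck_on k (\<lambda>x. frechet_derivative f (at x) v) S)"

definition smooth_on :: "('a::real_normed_vector \<Rightarrow> 'b::real_normed_vector) \<Rightarrow> 'a set \<Rightarrow> bool" where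
  "smooth_on f S \<longleftrightarrow> (\<forall>k. Ck_on k f S)"

definition partial :: "'n::finite \<Rightarrow> (real^'n \<Rightarrow> 'b::real_normed_vector) \<Rightarrow> real^'n \<Rightarrow> 'b" where
  "partial i f x = frechet_derivative f (at x) (axis i 1)"


section \<open>Riemannian manifolds\<close>

text \<open>The manifold is the whole type \<open>'m\<close>; its dimension is \<open>CARD('n)\<close>. A chart is a pair of its
  domain and its coordinate map. The values of the coordinate map outside the domain are irrelevant.
  Charts map onto open subsets of \<open>real^'n\<close>, so there is no boundary.\<close>

type_synonym ('m, 'n) chart = "'m set \<times> ('m \<Rightarrow> real^'n)"

definition chart_image :: "('m, 'n::finite) chart \<Rightarrow> (real^'n) set" where
  "chart_image C = snd C ` fst C"

definition chart_inv :: "('m, 'n::finite) chart \<Rightarrow> real^'n \<Rightarrow> 'm" where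
  "chart_inv C = inv_into (fst C) (snd C)"

definition transition :: "('m, 'n::finite) chart \<Rightarrow> ('m, 'n) chart \<Rightarrow> real^'n \<Rightarrow> real^'n" where
  "transition C D = snd D \<circ> chart_inv C"

definition smooth_atlas :: "('m::t2_space, 'n::finite) chart set \<Rightarrow> bool" where
  "smooth_atlas A \<longleftrightarrow>
     (\<Union>C\<in>A. fst C) = UNIV \<and>
     (\<forall>C\<in>A. open (fst C) \<and> open (chart_image C) \<and>
        homeomorphism (fst C) (chart_image C) (snd C) (chart_inv C)) \<and>
     (\<forall>C\<in>A. \<forall>D\<in>A. smooth_on (transition C D) (snd C ` (fst C \<inter> fst D)))"

text \<open>A Riemannian metric is given by its coordinate matrices: \<open>g C x\<close> is the matrix
  \<open>(g\<^sub>i\<^sub>j)\<close> in the chart \<open>C\<close> at the point with coordinates \<open>x\<close>. The last condition is the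
  transformation law of covariant 2-tensors.\<close>

type_synonym ('m, 'n) metric_field = "('m, 'n) chart \<Rightarrow> real^'n \<Rightarrow> real^'n^'n"

definition riemannian_metric ::
    "('m::t2_space, 'n::finite) chart set \<Rightarrow> ('m, 'n) metric_field \<Rightarrow> bool" where
  "riemannian_metric A g \<longleftrightarrow>
     (\<forall>C\<in>A. smooth_on (g C) (chart_image C) \<and>
        (\<forall>x\<in>chart_image C. transpose (g C x) = g C x \<and> (\<forall>v. v \<noteq> 0 \<longrightarrow> v \<bullet> (g C x *v v) > 0))) \<and>
     (\<forall>C\<in>A. \<forall>D\<in>A. \<forall>x \<in> snd C ` (fst C \<inter> fst D).
        let J = matrix (frechet_derivative (transition C D) (at x))
        in g C x = transpose J ** g D (transition C D x) ** J)"

definition compact_connected_riemannian_manifold ::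
    "('m::t2_space, 'n::finite) chart set \<Rightarrow> ('m, 'n) metric_field \<Rightarrow> bool" where
  "compact_connected_riemannian_manifold A g \<longleftrightarrow>
     compact (UNIV :: 'm set) \<and> connected (UNIV :: 'm set) \<and> smooth_atlas A \<and> riemannian_metric A g"

text \<open>The Riemannian volume is the unique Borel measure with density \<open>sqrt (det (g\<^sub>i\<^sub>j))\<close> in every
  chart. Sets and functions that are measurable with respect to the Riemannian volume are those
  measurable for \<open>completion v\<close>.\<close>

definition riemannian_volume ::
    "('m::t2_space, 'n::finite) chart set \<Rightarrow> ('m, 'n) metric_field \<Rightarrow> 'm measure \<Rightarrow> bool" where
  "riemannian_volume A g v \<longleftrightarrow>
     sets v = sets borel \<and>
     (\<forall>C\<in>A. \<forall>B\<in>sets borel. B \<subseteq> fst C \<longrightarrow>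
        emeasure v B = (\<integral>\<^sup>+x\<in>snd C ` B. ennreal (sqrt (det (g C x))) \<partial>lborel))"

definition smooth_function ::
    "('m::t2_space, 'n::finite) chart set \<Rightarrow> ('m \<Rightarrow> complex) \<Rightarrow> bool" where
  "smooth_function A u \<longleftrightarrow> (\<forall>C\<in>A. smooth_on (u \<circ> chart_inv C) (chart_image C))"

text \<open>Laplace-Beltrami operator in local coordinates, for \<open>w\<close> the coordinate expression of the
  function and \<open>g\<close> the coordinate matrix of the metric:
  \<open>|g|\<^sup>-\<^sup>1\<^sup>/\<^sup>2 \<Sum>\<^sub>i \<partial>\<^sub>i (\<Sum>\<^sub>j |g|\<^sup>1\<^sup>/\<^sup>2 g\<^sup>i\<^sup>j \<partial>\<^sub>j w)\<close>.\<close>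

definition local_laplacian ::
    "(real^'n \<Rightarrow> real^'n^'n) \<Rightarrow> (real^'n \<Rightarrow> complex) \<Rightarrow> real^'n::finite \<Rightarrow> complex" where
  "local_laplacian g w x =
     (1 / sqrt (det (g x))) *\<^sub>R
       (\<Sum>i\<in>UNIV. partial i
          (\<lambda>z. \<Sum>j\<in>UNIV. (sqrt (det (g z)) * matrix_inv (g z) $ i $ j) *\<^sub>R partial j w z) x)"

text \<open>\<open>has_laplacian A g u f\<close> states that \<open>u\<close> is smooth and its image under the
  Laplace-Beltrami operator is \<open>f\<close>. The local expression does not depend on the chart around the
  point, so quantifying over all charts is no restriction.\<close>

definition has_laplacian ::
    "('m::t2_space, 'n::finite) chart set \<Rightarrow> ('m, 'n) metric_field \<Rightarrow>
     ('m \<Rightarrow> complex) \<Rightarrow> ('m \<Rightarrow> complex) \<Rightarrow> bool" where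
  "has_laplacian A g u f \<longleftrightarrow>
     smooth_function A u \<and>
     (\<forall>C\<in>A. \<forall>p\<in>fst C. local_laplacian (g C) (u \<circ> chart_inv C) (snd C p) = f p)"

text \<open>Eigenfunctions of minus the Laplace-Beltrami operator, for the eigenvalue \<open>\<mu>\<close>.\<close>

definition eigenfunction ::
    "('m::t2_space, 'n::finite) chart set \<Rightarrow> ('m, 'n) metric_field \<Rightarrow>
     complex \<Rightarrow> ('m \<Rightarrow> complex) \<Rightarrow> bool" where
  "eigenfunction A g \<mu> u \<longleftrightarrow> (\<exists>p. u p \<noteq> 0) \<and> has_laplacian A g u (\<lambda>p. - (\<mu> * u p))"


section \<open>Square-integrable functions and Hilbert bases\<close>

definition L2 :: "'m measure \<Rightarrow> ('m \<Rightarrow> complex) \<Rightarrow> bool" where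
  "L2 M f \<longleftrightarrow> f \<in> borel_measurable M \<and> integrable M (\<lambda>x. (cmod (f x))\<^sup>2)"

definition L2_0 :: "'m measure \<Rightarrow> ('m \<Rightarrow> complex) \<Rightarrow> bool" where
  "L2_0 M f \<longleftrightarrow> L2 M f \<and> (\<integral>x. f x \<partial>M) = 0"

definition L2_inner :: "'m measure \<Rightarrow> ('m \<Rightarrow> complex) \<Rightarrow> ('m \<Rightarrow> complex) \<Rightarrow> complex" where
  "L2_inner M f h = (\<integral>x. f x * cnj (h x) \<partial>M)"

definition L2_normsq :: "'m measure \<Rightarrow> ('m \<Rightarrow> complex) \<Rightarrow> real" where
  "L2_normsq M f = (\<integral>x. (cmod (f x))\<^sup>2 \<partial>M)"

text \<open>An orthonormal sequence of zero-mean functions whose linear span is dense in the space of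
  zero-mean square-integrable functions. Sequences are indexed from \<open>0\<close>.\<close>

definition hilbert_basis_L2_0 :: "'m measure \<Rightarrow> (nat \<Rightarrow> 'm \<Rightarrow> complex) \<Rightarrow> bool" where
  "hilbert_basis_L2_0 M \<phi> \<longleftrightarrow>
     (\<forall>j. L2_0 M (\<phi> j)) \<and>
     (\<forall>j k. L2_inner M (\<phi> j) (\<phi> k) = (if j = k then 1 else 0)) \<and>
     (\<forall>f. L2_0 M f \<longrightarrow>
        (\<forall>e>0. \<exists>N c. L2_normsq M (\<lambda>x. f x - (\<Sum>j<N. c j * \<phi> j x)) < e))"

definition spectral_basis ::
    "('m::t2_space, 'n::finite) chart set \<Rightarrow> ('m, 'n) metric_field \<Rightarrow> 'm measure \<Rightarrow>
     (nat \<Rightarrow> real) \<Rightarrow> (nat \<Rightarrow> 'm \<Rightarrow> complex) \<Rightarrow> bool" where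
  "spectral_basis A g M lam \<phi> \<longleftrightarrow>
     hilbert_basis_L2_0 M \<phi> \<and>
     (\<forall>j. eigenfunction A g (of_real ((lam j)\<^sup>2)) (\<phi> j)) \<and>
     (\<forall>j. 0 < lam j) \<and> mono lam \<and> filterlim lam at_top sequentially"


section \<open>The wave equation and the observability constant\<close>

text \<open>An element \<open>y1 = \<Sum>\<^sub>j b\<^sub>j \<phi>\<^sub>j\<close> of the dual \<open>H\<^sup>-\<^sup>1\<close> of zero-mean \<open>H\<^sup>1\<close> is represented by
  its sequence \<open>b\<close> of coefficients; \<open>y0\<close> is a zero-mean square-integrable function.\<close>

definition initial_data ::
    "'m measure \<Rightarrow> (nat \<Rightarrow> real) \<Rightarrow> ('m \<Rightarrow> complex) \<Rightarrow> (nat \<Rightarrow> complex) \<Rightarrow> bool" where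
  "initial_data M lam y0 b \<longleftrightarrow> L2_0 M y0 \<and> summable (\<lambda>j. (cmod (b j))\<^sup>2 / (lam j)\<^sup>2)"

definition data_normsq ::
    "'m measure \<Rightarrow> (nat \<Rightarrow> real) \<Rightarrow> ('m \<Rightarrow> complex) \<Rightarrow> (nat \<Rightarrow> complex) \<Rightarrow> real" where
  "data_normsq M lam y0 b = L2_normsq M y0 + (\<Sum>j. (cmod (b j))\<^sup>2 / (lam j)\<^sup>2)"

definition zero_data :: "'m measure \<Rightarrow> ('m \<Rightarrow> complex) \<Rightarrow> (nat \<Rightarrow> complex) \<Rightarrow> bool" where
  "zero_data M y0 b \<longleftrightarrow> (AE x in M. y0 x = 0) \<and> (\<forall>j. b j = 0)"

text \<open>For every \<open>t\<close>, \<open>y t\<close> is a representative of the sum in \<open>L\<^sup>2\<close> of the series defining the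
  solution at time \<open>t\<close>. It is determined up to a null set depending on \<open>t\<close>.\<close>

definition wave_solution ::
    "'m measure \<Rightarrow> (nat \<Rightarrow> real) \<Rightarrow> (nat \<Rightarrow> 'm \<Rightarrow> complex) \<Rightarrow>
     ('m \<Rightarrow> complex) \<Rightarrow> (nat \<Rightarrow> complex) \<Rightarrow> (real \<Rightarrow> 'm \<Rightarrow> complex) \<Rightarrow> bool" where
  "wave_solution M lam \<phi> y0 b y \<longleftrightarrow>
     (\<forall>t. L2 M (y t) \<and>
        (\<lambda>N. L2_normsq M (\<lambda>x. y t x -
           (\<Sum>j<N. (L2_inner M y0 (\<phi> j) * of_real (cos (lam j * t)) +
                    b j * of_real (sin (lam j * t) / lam j)) * \<phi> j x))) \<longlonglongrightarrow> 0)"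

text \<open>The inner integral depends only on the class of \<open>y t\<close> in \<open>L\<^sup>2\<close>, and is continuous in \<open>t\<close>.\<close>

definition J_functional ::
    "'m measure \<Rightarrow> (nat \<Rightarrow> real) \<Rightarrow> real \<Rightarrow> 'm set \<Rightarrow>
     ('m \<Rightarrow> complex) \<Rightarrow> (nat \<Rightarrow> complex) \<Rightarrow> (real \<Rightarrow> 'm \<Rightarrow> complex) \<Rightarrow> real" where
  "J_functional M lam T \<omega> y0 b y =
     (LINT t:{0..T}|lborel. (LINT x:\<omega>|M. (cmod (y t x))\<^sup>2)) / data_normsq M lam y0 b"

definition observability_constant ::
    "'m measure \<Rightarrow> (nat \<Rightarrow> real) \<Rightarrow> (nat \<Rightarrow> 'm \<Rightarrow> complex) \<Rightarrow> real \<Rightarrow> 'm set \<Rightarrow> real" where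
  "observability_constant M lam \<phi> T \<omega> =
     Inf {J_functional M lam T \<omega> y0 b y | y0 b y.
            initial_data M lam y0 b \<and> \<not> zero_data M y0 b \<and> wave_solution M lam \<phi> y0 b y}"

definition g1 ::
    "('m::t2_space, 'n::finite) chart set \<Rightarrow> ('m, 'n) metric_field \<Rightarrow> 'm measure \<Rightarrow> 'm set \<Rightarrow> real" where
  "g1 A g M \<omega> =
     Inf {(LINT x:\<omega>|M. (cmod (u x))\<^sup>2) / (LINT x|M. (cmod (u x))\<^sup>2) | u.
            (\<exists>\<mu>. eigenfunction A g \<mu> u) \<and> \<not> u constant_on UNIV}"

end

theory Submission
  imports Defs
begin

text \<open>
  \<^bold>\<open>Upper bound.\<close> For a nonconstant eigenfunction \<open>f\<close> of frequency \<open>l\<close>, the standing wave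
  \<open>cos (l t) f\<close> has observed energy \<open>(T / 2 + sin (2 l T) / (4 l)) * \<integral>\<^sub>\<omega> |f|\<^sup>2\<close>, so the
  upper limit of \<open>C\<^sub>T(\<omega>) / T\<close> is at most half of every quotient in the definition of
  \<open>g\<^sub>1(\<omega>)\<close>.

  \<^bold>\<open>Lower bound.\<close> A solution is \<open>y(t) = \<Sum>\<^sub>\<mu> cis (\<mu> t) f\<^sub>\<mu>\<close>, where \<open>\<mu>\<close> runs
  over the distinct numbers \<open>\<plusminus> lam j\<close> and \<open>f\<^sub>\<mu>\<close> lies in the eigenspace of frequency
  \<open>|\<mu>|\<close>; the parallelogram law gives \<open>\<Sum>\<^sub>\<mu> \<parallel>f\<^sub>\<mu>\<parallel>\<^sup>2 = \<parallel>(y\<^sup>0, y\<^sup>1)\<parallel>\<^sup>2 / 2\<close>. The gap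
  condition makes these frequencies uniformly separated, and an inequality of Ingham type with the
  sharp constant \<open>T - O(1)\<close> (\<open>integral_trigonometric_gram_ge\<close>) yields
  \<open>\<integral>\<^sub>0\<^sup>T \<integral>\<^sub>\<omega> |y|\<^sup>2 \<ge> (T - O(1)) \<Sum>\<^sub>\<mu> \<integral>\<^sub>\<omega> |f\<^sub>\<mu>|\<^sup>2 \<ge> (T - O(1)) g\<^sub>1(\<omega>) \<parallel>(y\<^sup>0, y\<^sup>1)\<parallel>\<^sup>2 / 2\<close>.
  The inequality is applied to the matrix of inner products of the \<open>f\<^sub>\<mu>\<close> over \<open>\<omega>\<close>, for
  partial sums of the solution, and then passes to the limit. The two bounds together are
  \<open>observability_constant_asymptotics\<close>, which only involves an orthonormal basis, the sequence
  \<open>lam\<close> and a number \<open>g\<close> that is the infimum of the quotients over finite sums of basis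
  elements of equal frequency.

  \<^bold>\<open>Eigenfunctions.\<close> It remains to identify \<open>g\<close> with \<open>g\<^sub>1(\<omega>)\<close>: every nonconstant
  eigenfunction is almost everywhere a finite combination of basis elements of one frequency
  (\<open>nonconstant_eigenfunction_in_span\<close>). This rests on the symmetry of the Laplace-Beltrami
  operator (\<open>integral_laplacian_symmetric\<close>), which is Green's formula. In a chart it says that the
  integral of a derivative of a compactly supported function vanishes; it becomes global with a
  partition of unity, because the inner product of gradients does not depend on the chart.
\<close>

section \<open>Mean values of trigonometric sums with separated frequencies\<close>

lemma sum_inverse_squares_le_2: "(\<Sum>k=1..n. 1 / (real k)\<^sup>2) \<le> 2"
proof -
  have "(\<Sum>k=1..Suc m. 1 / (real k)\<^sup>2) \<le> 2 - 1 / real (Suc m)" for m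
  proof (induction m)
    case 0
    then show ?case by simp
  next
    case (Suc m)
    have *: "1 / (real (Suc (Suc m)))\<^sup>2 \<le> 1 / real (Suc m) - 1 / real (Suc (Suc m))"
    proof -
      have "1 / real (Suc m) - 1 / real (Suc (Suc m)) = 1 / (real (Suc m) * real (Suc (Suc m)))"
        by (simp add: field_simps)
      moreover have "1 / (real (Suc (Suc m)))\<^sup>2 \<le> 1 / (real (Suc m) * real (Suc (Suc m)))"
        unfolding power2_eq_square by (intro divide_left_mono mult_right_mono) auto
      ultimately show ?thesis by simp
    qed
    have "(\<Sum>k=1..Suc (Suc m). 1 / (real k)\<^sup>2)
        = (\<Sum>k=1..Suc m. 1 / (real k)\<^sup>2) + 1 / (real (Suc (Suc m)))\<^sup>2"
      by (subst sum.nat_ivl_Suc') auto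
    then show ?case using Suc.IH * by linarith
  qed
  moreover have "2 - 1 / real (Suc m) \<le> 2" for m by simp
  ultimately have "(\<Sum>k=1..Suc m. 1 / (real k)\<^sup>2) \<le> 2" for m
    by (meson order_trans)
  then show ?thesis by (cases n) auto
qed

text \<open>Distinct elements of the set are at distance at least \<open>\<gamma>\<close>.\<close>

definition separated :: "real \<Rightarrow> real set \<Rightarrow> bool" where
  "separated \<gamma> S \<longleftrightarrow> (\<forall>x\<in>S. \<forall>y\<in>S. x \<noteq> y \<longrightarrow> \<gamma> \<le> \<bar>x - y\<bar>)"

lemma sum_inverse_squares_separated_pos:
  assumes "finite S" "\<gamma> > 0" "separated \<gamma> S" "\<And>x. x \<in> S \<Longrightarrow> \<gamma> \<le> x"
  shows "(\<Sum>x\<in>S. 1 / x\<^sup>2) \<le> 2 / \<gamma>\<^sup>2"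
proof -
  define k where "k = (\<lambda>x. nat \<lfloor>x / \<gamma>\<rfloor>)"
  have k: "real (k x) \<le> x / \<gamma>" "x / \<gamma> < real (k x) + 1" "1 \<le> k x" if "x \<in> S" for x
  proof -
    have "1 \<le> x / \<gamma>" using assms that by simp
    then have "1 \<le> \<lfloor>x / \<gamma>\<rfloor>" by simp
    then show "real (k x) \<le> x / \<gamma>" "x / \<gamma> < real (k x) + 1" "1 \<le> k x"
      unfolding k_def by (auto simp: le_nat_iff) 
  qed
  \<comment> \<open>Separated points lie in different intervals \<open>[k \<gamma>, (k + 1) \<gamma>)\<close>, so the sum is dominated by
    \<open>\<Sum> 1 / (\<gamma> k)\<^sup>2\<close>.\<close>
  have inj: "inj_on k S"
  proof (rule inj_onI, rule ccontr)
    fix x y assume xy: "x \<in> S" "y \<in> S" "k x = k y" "x \<noteq> y"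
    then have "\<bar>x / \<gamma> - y / \<gamma>\<bar> < 1" using k[of x] k[of y] by linarith
    then have "\<bar>x - y\<bar> / \<gamma> < 1" using assms by (simp add: diff_divide_distrib [symmetric])
    then have "\<bar>x - y\<bar> < \<gamma>" using assms by simp
    moreover have "\<gamma> \<le> \<bar>x - y\<bar>" using assms(3) xy unfolding separated_def by blast
    ultimately show False by simp
  qed
  have "(\<Sum>x\<in>S. 1 / x\<^sup>2) \<le> (\<Sum>x\<in>S. 1 / \<gamma>\<^sup>2 * (1 / (real (k x))\<^sup>2))"
  proof (rule sum_mono)
    fix x assume x: "x \<in> S"
    have "\<gamma> * real (k x) \<le> x" using k(1)[OF x] assms by (simp add: field_simps)
    then have "(\<gamma> * real (k x))\<^sup>2 \<le> x\<^sup>2" using assms by (intro power_mono) auto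
    moreover have "0 < (\<gamma> * real (k x))\<^sup>2" using assms k(3)[OF x] by simp
    ultimately have "1 / x\<^sup>2 \<le> 1 / (\<gamma> * real (k x))\<^sup>2" by (intro frac_le) auto
    then show "1 / x\<^sup>2 \<le> 1 / \<gamma>\<^sup>2 * (1 / (real (k x))\<^sup>2)" by (simp add: power_mult_distrib)
  qed
  also have "\<dots> = 1 / \<gamma>\<^sup>2 * (\<Sum>j\<in>k ` S. 1 / (real j)\<^sup>2)"
    by (simp add: sum_distrib_left sum.reindex[OF inj])
  also have "(\<Sum>j\<in>k ` S. 1 / (real j)\<^sup>2) \<le> (\<Sum>j=1..Max (insert 0 (k ` S)). 1 / (real j)\<^sup>2)"
    using assms(1) k(3) by (intro sum_mono2) auto
  also have "\<dots> \<le> 2" by (rule sum_inverse_squares_le_2)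
  finally show ?thesis using assms by (simp add: mult_left_mono divide_right_mono)
qed

lemma sum_inverse_squares_separated:
  assumes "finite S" "\<gamma> > 0" "separated \<gamma> S" "a \<in> S"
  shows "(\<Sum>x\<in>S - {a}. 1 / (x - a)\<^sup>2) \<le> 4 / \<gamma>\<^sup>2"
proof -
  let ?P = "{x \<in> S. a < x}" and ?N = "{x \<in> S. x < a}"
  have gap: "\<gamma> \<le> \<bar>x - y\<bar>" if "x \<in> S" "y \<in> S" "x \<noteq> y" for x y
    using assms that by (auto simp: separated_def)
  have pos: "(\<Sum>x\<in>(\<lambda>x. x - a) ` ?P. 1 / x\<^sup>2) \<le> 2 / \<gamma>\<^sup>2"
  proof (rule sum_inverse_squares_separated_pos)
    show "separated \<gamma> ((\<lambda>x. x - a) ` ?P)" using gap by (force simp: separated_def)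
    show "\<gamma> \<le> x" if "x \<in> (\<lambda>x. x - a) ` ?P" for x using gap[of _ a] assms(4) that by force
  qed (use assms in auto)
  have neg: "(\<Sum>x\<in>(\<lambda>x. a - x) ` ?N. 1 / x\<^sup>2) \<le> 2 / \<gamma>\<^sup>2"
  proof (rule sum_inverse_squares_separated_pos)
    show "separated \<gamma> ((\<lambda>x. a - x) ` ?N)" using gap by (force simp: separated_def)
    show "\<gamma> \<le> x" if "x \<in> (\<lambda>x. a - x) ` ?N" for x using gap[of _ a] assms(4) that by force
  qed (use assms in auto)
  have "S - {a} = ?P \<union> ?N" by auto
  then have "(\<Sum>x\<in>S - {a}. 1 / (x - a)\<^sup>2) = (\<Sum>x\<in>?P. 1 / (x - a)\<^sup>2) + (\<Sum>x\<in>?N. 1 / (x - a)\<^sup>2)"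
    using assms(1) by (simp add: sum.union_disjoint disjoint_iff)
  also have "(\<Sum>x\<in>?P. 1 / (x - a)\<^sup>2) = (\<Sum>x\<in>(\<lambda>x. x - a) ` ?P. 1 / x\<^sup>2)"
    by (subst sum.reindex) (auto simp: inj_on_def)
  also have "(\<Sum>x\<in>?N. 1 / (x - a)\<^sup>2) = (\<Sum>x\<in>(\<lambda>x. a - x) ` ?N. 1 / x\<^sup>2)"
    by (subst sum.reindex) (auto simp: inj_on_def power2_commute)
  finally show ?thesis using pos neg by simp
qed

text \<open>The integral of \<open>cis (\<delta> t)\<close> over \<open>{0..L}\<close>.\<close>

definition cis_mean :: "real \<Rightarrow> real \<Rightarrow> complex" where
  "cis_mean \<delta> L = (if \<delta> = 0 then of_real L else (cis (\<delta> * L) - 1) / (\<i> * of_real \<delta>))"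

lemma has_integral_cis:
  assumes "0 \<le> L"
  shows "((\<lambda>t. cis (\<delta> * t)) has_integral cis_mean \<delta> L) {0..L}"
proof (cases "\<delta> = 0")
  case True
  then show ?thesis using has_integral_const_real[of "1::complex" 0 L] assms
    by (simp add: cis_mean_def scaleR_conv_of_real)
next
  case False
  have "((\<lambda>t. cis (\<delta> * t)) has_integral
      (cis (\<delta> * L) / (\<i> * of_real \<delta>) - cis (\<delta> * 0) / (\<i> * of_real \<delta>))) {0..L}"
  proof (rule fundamental_theorem_of_calculus[OF assms])
    fix x
    show "((\<lambda>t. cis (\<delta> * t) / (\<i> * of_real \<delta>)) has_vector_derivative cis (\<delta> * x))
        (at x within {0..L})"
      using False unfolding has_vector_derivative_def
      by (auto intro!: derivative_eq_intros simp: fun_eq_iff scaleR_conv_of_real mult.left_commute[of _ \<i>])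
  qed
  then show ?thesis using False by (simp add: cis_mean_def diff_divide_distrib)
qed

lemma norm_cis_mean_le: "\<delta> \<noteq> 0 \<Longrightarrow> cmod (cis_mean \<delta> L) \<le> 2 / \<bar>\<delta>\<bar>"
  using norm_triangle_ineq4[of "cis (\<delta> * L)" 1]
  by (simp add: cis_mean_def norm_divide norm_mult divide_right_mono)

text \<open>Ingham's inequality with the sharp leading constant \<open>T\<close>, for vector-valued coefficients
  \<open>f\<^sub>\<mu>\<close>, of which only the Gram matrix \<open>G \<mu> \<nu> = \<langle>f\<^sub>\<mu>, f\<^sub>\<nu>\<rangle>\<close> appears: \<open>P t\<close> is the squared
  norm of \<open>\<Sum>\<^sub>\<mu> cis (\<mu> t) f\<^sub>\<mu>\<close>. As \<open>P \<ge> 0\<close>, its integral over \<open>{0..T}\<close> bounds the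
  integral over every window \<open>{s..s + T - 1}\<close> with \<open>s \<in> {0..1}\<close>, hence also the average of
  these over \<open>s\<close>. In the average the off-diagonal terms decay quadratically in the difference of
  the frequencies, so they are summable and contribute a bounded multiple of the diagonal.\<close>

lemma integral_trigonometric_gram_ge:
  fixes G :: "real \<Rightarrow> real \<Rightarrow> complex" and d :: "real \<Rightarrow> real"
    and S :: "real set"
  defines "P \<equiv> \<lambda>t. \<Sum>\<mu>\<in>S. \<Sum>\<nu>\<in>S. Re (G \<mu> \<nu> * cis ((\<mu> - \<nu>) * t))"
  assumes S: "finite S" "separated \<gamma> S" and "\<gamma> > 0"
    and diag: "\<And>\<mu>. \<mu> \<in> S \<Longrightarrow> G \<mu> \<mu> = of_real (d \<mu>)"
    and offdiag: "\<And>\<mu> \<nu>. \<mu> \<in> S \<Longrightarrow> \<nu> \<in> S \<Longrightarrow> cmod (G \<mu> \<nu>) \<le> (d \<mu> + d \<nu>) / 2"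
    and P0: "\<And>t. 0 \<le> P t" and T: "1 \<le> T"
  shows "(T - (1 + 16 / \<gamma>\<^sup>2)) * (\<Sum>\<mu>\<in>S. d \<mu>) \<le> integral {0..T} P"
proof -
  define L where "L = T - 1"
  have L: "0 \<le> L" using T by (simp add: L_def)
  have contP: "continuous_on X P" for X
    unfolding P_def by (intro continuous_intros)
  have d0: "0 \<le> d \<mu>" if "\<mu> \<in> S" for \<mu>
    using order_trans[OF norm_ge_zero offdiag[OF that that]] by simp
  define Q where "Q = (\<lambda>s. \<Sum>\<mu>\<in>S. \<Sum>\<nu>\<in>S.
      Re (G \<mu> \<nu> * cis_mean (\<mu> - \<nu>) L * cis ((\<mu> - \<nu>) * s)))"
  have shift: "Q s \<le> integral {0..T} P" if s: "s \<in> {0..1}" for s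
  proof -
    have "((\<lambda>t. P (t + s)) has_integral Q s) {0..L}"
    proof -
      have "((\<lambda>t. Re ((G \<mu> \<nu> * cis ((\<mu> - \<nu>) * s)) * cis ((\<mu> - \<nu>) * t))) has_integral
          Re ((G \<mu> \<nu> * cis ((\<mu> - \<nu>) * s)) * cis_mean (\<mu> - \<nu>) L)) {0..L}" for \<mu> \<nu>
        by (intro has_integral_Re has_integral_mult_right has_integral_cis L)
      then have "((\<lambda>t. Re (G \<mu> \<nu> * cis ((\<mu> - \<nu>) * (t + s)))) has_integral
          Re (G \<mu> \<nu> * cis_mean (\<mu> - \<nu>) L * cis ((\<mu> - \<nu>) * s))) {0..L}" for \<mu> \<nu>
        by (simp add: distrib_left mult_ac flip: cis_mult)
      then show ?thesis unfolding P_def Q_def by (intro has_integral_sum[OF S(1)])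
    qed
    then have "Q s = integral {0..L} (P \<circ> (\<lambda>t. t + s))" by (simp add: integral_unique comp_def)
    also have "\<dots> = integral {s..L + s} P"
      using integral_shift[of 0 s L P] contP by (simp add: add.commute)
    also have "\<dots> \<le> integral {0..T} P"
      using s L_def P0 contP by (intro integral_subset_le integrable_continuous_real) auto
    finally show ?thesis .
  qed
  define R where "R = (\<Sum>\<mu>\<in>S. \<Sum>\<nu>\<in>S.
      Re (G \<mu> \<nu> * cis_mean (\<mu> - \<nu>) L * cis_mean (\<mu> - \<nu>) 1))"
  have "(Q has_integral R) {0..1}"
    unfolding Q_def R_def
    by (intro has_integral_sum[OF S(1)] has_integral_Re has_integral_mult_right has_integral_cis) auto
  moreover have "((\<lambda>s. integral {0..T} P) has_integral integral {0..T} P) {0..(1::real)}"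
    using has_integral_const_real[of "integral {0..T} P" 0 1] by simp
  ultimately have RP: "R \<le> integral {0..T} P" using shift by (rule has_integral_le) 
  have off: "- ((d \<mu> + d \<nu>) / 2 * (4 / (\<nu> - \<mu>)\<^sup>2))
        \<le> Re (G \<mu> \<nu> * cis_mean (\<mu> - \<nu>) L * cis_mean (\<mu> - \<nu>) 1)"
    if "\<mu> \<in> S" "\<nu> \<in> S" "\<nu> \<noteq> \<mu>" for \<mu> \<nu>
  proof -
    have "cmod (G \<mu> \<nu> * cis_mean (\<mu> - \<nu>) L * cis_mean (\<mu> - \<nu>) 1)
        \<le> (d \<mu> + d \<nu>) / 2 * (2 / \<bar>\<mu> - \<nu>\<bar>) * (2 / \<bar>\<mu> - \<nu>\<bar>)"
      unfolding norm_mult using that d0 by (intro mult_mono offdiag norm_cis_mean_le) auto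
    also have "\<dots> = (d \<mu> + d \<nu>) / 2 * (4 / (\<nu> - \<mu>)\<^sup>2)"
    proof -
      have "\<bar>\<mu> - \<nu>\<bar> * \<bar>\<mu> - \<nu>\<bar> = (\<nu> - \<mu>)\<^sup>2" by (simp add: power2_eq_square algebra_simps)
      then have "2 / \<bar>\<mu> - \<nu>\<bar> * (2 / \<bar>\<mu> - \<nu>\<bar>) = 4 / (\<nu> - \<mu>)\<^sup>2" by simp
      then show ?thesis by (simp only: mult.assoc)
    qed
    finally show ?thesis
      using abs_Re_le_cmod[of "G \<mu> \<nu> * cis_mean (\<mu> - \<nu>) L * cis_mean (\<mu> - \<nu>) 1"] by linarith
  qed
  have row: "(\<Sum>\<nu>\<in>S - {\<mu>}. 4 / (\<nu> - \<mu>)\<^sup>2) \<le> 16 / \<gamma>\<^sup>2" if "\<mu> \<in> S" for \<mu>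
  proof -
    have "(\<Sum>\<nu>\<in>S - {\<mu>}. 4 / (\<nu> - \<mu>)\<^sup>2) = 4 * (\<Sum>\<nu>\<in>S - {\<mu>}. 1 / (\<nu> - \<mu>)\<^sup>2)"
      by (simp add: sum_distrib_left)
    then show ?thesis using sum_inverse_squares_separated[OF S(1) \<open>\<gamma> > 0\<close> S(2) that] by simp
  qed
  define e where "e = (\<lambda>\<mu> \<nu>. 4 / (\<nu> - \<mu>)\<^sup>2 :: real)"
  have esym: "e \<mu> \<nu> = e \<nu> \<mu>" for \<mu> \<nu> by (simp add: e_def power2_commute)
  have ediag: "e \<mu> \<mu> = 0" for \<mu> by (simp add: e_def)
  have erow: "(\<Sum>\<nu>\<in>S. e \<mu> \<nu>) \<le> 16 / \<gamma>\<^sup>2" if "\<mu> \<in> S" for \<mu>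
    using row[OF that] S that by (simp add: sum.remove[of S \<mu>] e_def)
  have "(\<Sum>\<mu>\<in>S. \<Sum>\<nu>\<in>S. (d \<mu> + d \<nu>) / 2 * e \<mu> \<nu>)
      = (\<Sum>\<mu>\<in>S. \<Sum>\<nu>\<in>S. d \<mu> / 2 * e \<mu> \<nu>) + (\<Sum>\<mu>\<in>S. \<Sum>\<nu>\<in>S. d \<nu> / 2 * e \<mu> \<nu>)"
    by (simp add: add_divide_distrib distrib_right sum.distrib)
  also have "(\<Sum>\<mu>\<in>S. \<Sum>\<nu>\<in>S. d \<nu> / 2 * e \<mu> \<nu>) = (\<Sum>\<mu>\<in>S. \<Sum>\<nu>\<in>S. d \<mu> / 2 * e \<mu> \<nu>)"
    by (subst sum.swap) (simp add: esym)
  also have "(\<Sum>\<mu>\<in>S. \<Sum>\<nu>\<in>S. d \<mu> / 2 * e \<mu> \<nu>) + (\<Sum>\<mu>\<in>S. \<Sum>\<nu>\<in>S. d \<mu> / 2 * e \<mu> \<nu>)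
      = (\<Sum>\<mu>\<in>S. d \<mu> * (\<Sum>\<nu>\<in>S. e \<mu> \<nu>))"
    by (simp add: sum_distrib_left flip: sum.distrib)
  also have "\<dots> \<le> (\<Sum>\<mu>\<in>S. d \<mu> * (16 / \<gamma>\<^sup>2))"
    using erow d0 by (intro sum_mono mult_left_mono) auto
  also have "\<dots> = 16 / \<gamma>\<^sup>2 * (\<Sum>\<mu>\<in>S. d \<mu>)"
    by (subst sum_distrib_right [symmetric]) (rule mult.commute)
  finally have E: "(\<Sum>\<mu>\<in>S. \<Sum>\<nu>\<in>S. (d \<mu> + d \<nu>) / 2 * e \<mu> \<nu>) \<le> 16 / \<gamma>\<^sup>2 * (\<Sum>\<mu>\<in>S. d \<mu>)" .
  have "L * (\<Sum>\<mu>\<in>S. d \<mu>) - (\<Sum>\<mu>\<in>S. \<Sum>\<nu>\<in>S. (d \<mu> + d \<nu>) / 2 * e \<mu> \<nu>)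
      = (\<Sum>\<mu>\<in>S. \<Sum>\<nu>\<in>S. (if \<nu> = \<mu> then L * d \<mu> else 0) - (d \<mu> + d \<nu>) / 2 * e \<mu> \<nu>)"
    using S by (simp add: sum_subtractf sum_distrib_left)
  also have "\<dots> \<le> R"
    unfolding R_def
  proof (intro sum_mono)
    fix \<mu> \<nu> assume *: "\<mu> \<in> S" "\<nu> \<in> S"
    show "(if \<nu> = \<mu> then L * d \<mu> else 0) - (d \<mu> + d \<nu>) / 2 * e \<mu> \<nu>
        \<le> Re (G \<mu> \<nu> * cis_mean (\<mu> - \<nu>) L * cis_mean (\<mu> - \<nu>) 1)"
    proof (cases "\<nu> = \<mu>")
      case True
      then show ?thesis by (simp add: diag * e_def cis_mean_def)
    next
      case False
      then show ?thesis using off[OF * False] by (simp add: e_def del: times_complex.sel)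
    qed
  qed
  finally have "(L - 16 / \<gamma>\<^sup>2) * (\<Sum>\<mu>\<in>S. d \<mu>) \<le> R" using E by (simp add: left_diff_distrib)
  then show ?thesis using RP by (simp add: L_def algebra_simps)
qed


section \<open>Square-integrable functions and orthonormal expansions\<close>

lemma norm_integral_le_integral:
  fixes f :: "'a \<Rightarrow> 'b::{banach, second_countable_topology}"
  assumes "integrable M f" "integrable M g" "\<And>x. x \<in> space M \<Longrightarrow> norm (f x) \<le> g x"
  shows "norm (\<integral>x. f x \<partial>M) \<le> (\<integral>x. g x \<partial>M)"
proof -
  have "(\<integral>x. norm (f x) \<partial>M) \<le> (\<integral>x. g x \<partial>M)"
    using assms by (intro integral_mono) auto
  then show ?thesis using integral_norm_bound[of M f] by linarith
qed

lemma L2_zero: "L2 M (\<lambda>x. 0)"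
  by (simp add: L2_def)

lemma L2_cmult:
  assumes "L2 M f" shows "L2 M (\<lambda>x. c * f x)"
proof -
  have "integrable M (\<lambda>x. (cmod c)\<^sup>2 * (cmod (f x))\<^sup>2)"
    using assms by (auto simp: L2_def)
  then show ?thesis using assms by (auto simp: L2_def norm_mult power_mult_distrib)
qed

lemma L2_add:
  assumes "L2 M f" "L2 M h" shows "L2 M (\<lambda>x. f x + h x)"
proof -
  have "(cmod (a + b))\<^sup>2 \<le> 2 * (cmod a)\<^sup>2 + 2 * (cmod b)\<^sup>2" for a b
  proof -
    have "(cmod (a + b))\<^sup>2 \<le> (cmod a + cmod b)\<^sup>2" by (intro power_mono norm_triangle_ineq) auto
    also have "\<dots> \<le> 2 * (cmod a)\<^sup>2 + 2 * (cmod b)\<^sup>2"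
      using zero_le_power2[of "cmod a - cmod b"] by (simp add: power2_sum power2_diff)
    finally show ?thesis .
  qed
  then have *: "norm ((cmod (f x + h x))\<^sup>2) \<le> norm (2 * (cmod (f x))\<^sup>2 + 2 * (cmod (h x))\<^sup>2)" for x
    by simp
  have [measurable]: "f \<in> borel_measurable M" "h \<in> borel_measurable M"
    using assms by (auto simp: L2_def)
  have "integrable M (\<lambda>x. (cmod (f x + h x))\<^sup>2)"
    by (rule Bochner_Integration.integrable_bound
        [where f = "\<lambda>x. 2 * (cmod (f x))\<^sup>2 + 2 * (cmod (h x))\<^sup>2"])
       (use assms * in \<open>auto simp: L2_def\<close>)
  then show ?thesis by (simp add: L2_def)
qed

lemma L2_sum: "finite I \<Longrightarrow> (\<And>i. i \<in> I \<Longrightarrow> L2 M (f i)) \<Longrightarrow> L2 M (\<lambda>x. \<Sum>i\<in>I. f i x)"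
  by (induction I rule: finite_induct) (auto intro: L2_zero L2_add)

lemma L2_lincomb: "finite I \<Longrightarrow> (\<And>i. i \<in> I \<Longrightarrow> L2 M (f i)) \<Longrightarrow> L2 M (\<lambda>x. \<Sum>i\<in>I. c i * f i x)"
  by (intro L2_sum L2_cmult)

lemma L2_diff: "L2 M f \<Longrightarrow> L2 M h \<Longrightarrow> L2 M (\<lambda>x. f x - h x)"
  using L2_add[of M f "\<lambda>x. -1 * h x"] L2_cmult[of M h "-1"] by simp

lemma L2_indicator:
  assumes "L2 M f" "\<omega> \<in> sets M" shows "L2 M (\<lambda>x. indicator \<omega> x * f x)"
proof -
  have [measurable]: "f \<in> borel_measurable M" using assms by (simp add: L2_def)
  have "integrable M (\<lambda>x. (cmod (indicator \<omega> x * f x))\<^sup>2)"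
    by (rule Bochner_Integration.integrable_bound[where f = "\<lambda>x. (cmod (f x))\<^sup>2"])
       (use assms in \<open>auto simp: L2_def indicator_def\<close>)
  then show ?thesis using assms by (simp add: L2_def)
qed

text \<open>Observations on \<open>\<omega>\<close> are treated as norms of functions multiplied by the indicator of
  \<open>\<omega>\<close>.\<close>

lemma set_integral_eq_L2_normsq_indicator:
  "(LINT x:\<omega>|M. (cmod (f x))\<^sup>2) = L2_normsq M (\<lambda>x. indicator \<omega> x * f x)"
  unfolding L2_normsq_def set_lebesgue_integral_def
  by (intro Bochner_Integration.integral_cong) (auto simp: indicator_def)

lemma cmod_mult_cnj_le: "cmod (a * cnj b) \<le> ((cmod a)\<^sup>2 + (cmod b)\<^sup>2) / 2"
  using zero_le_power2[of "cmod a - cmod b"] by (simp add: norm_mult power2_diff)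

lemma borel_measurable_cnj [measurable]: "cnj \<in> borel_measurable borel"
  by (intro borel_measurable_continuous_onI continuous_intros)

lemma L2_integrable_mult_cnj:
  assumes "L2 M f" "L2 M h" shows "integrable M (\<lambda>x. f x * cnj (h x))"
proof (rule Bochner_Integration.integrable_bound
    [where f = "\<lambda>x. ((cmod (f x))\<^sup>2 + (cmod (h x))\<^sup>2) / 2"])
  have [measurable]: "f \<in> borel_measurable M" "h \<in> borel_measurable M"
    using assms by (auto simp: L2_def)
  show "(\<lambda>x. f x * cnj (h x)) \<in> borel_measurable M" by measurable
  show "AE x in M. norm (f x * cnj (h x)) \<le> norm (((cmod (f x))\<^sup>2 + (cmod (h x))\<^sup>2) / 2)"
    using cmod_mult_cnj_le by (auto intro!: AE_I2 simp del: complex_mod_cnj norm_mult)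
qed (use assms in \<open>auto simp: L2_def\<close>)

lemma L2_inner_commute: "L2_inner M h f = cnj (L2_inner M f h)"
  by (simp add: L2_inner_def mult.commute flip: Bochner_Integration.integral_cnj)

lemma L2_inner_self: "L2_inner M f f = of_real (L2_normsq M f)"
  unfolding L2_inner_def L2_normsq_def complex_norm_square [symmetric]
  by (rule Bochner_Integration.integral_complex_of_real)

lemma L2_normsq_nonneg: "0 \<le> L2_normsq M f"
  by (simp add: L2_normsq_def)

lemma cmod_L2_inner_le:
  assumes "L2 M f" "L2 M h"
  shows "cmod (L2_inner M f h) \<le> (L2_normsq M f + L2_normsq M h) / 2"
proof -
  have "cmod (L2_inner M f h) \<le> (\<integral>x. ((cmod (f x))\<^sup>2 + (cmod (h x))\<^sup>2) / 2 \<partial>M)"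
    unfolding L2_inner_def
    by (intro norm_integral_le_integral L2_integrable_mult_cnj cmod_mult_cnj_le assms)
       (use assms in \<open>auto simp: L2_def simp del: norm_mult complex_mod_mult_cnj\<close>)
  also have "\<dots> = (L2_normsq M f + L2_normsq M h) / 2"
    using assms by (simp add: L2_normsq_def L2_def)
  finally show ?thesis .
qed

lemma L2_inner_lincomb_left:
  assumes "finite I" "\<And>i. i \<in> I \<Longrightarrow> L2 M (f i)" "L2 M h"
  shows "L2_inner M (\<lambda>x. \<Sum>i\<in>I. c i * f i x) h = (\<Sum>i\<in>I. c i * L2_inner M (f i) h)"
  unfolding L2_inner_def sum_distrib_right mult.assoc
  by (subst Bochner_Integration.integral_sum)
     (auto intro!: integrable_mult_right L2_integrable_mult_cnj assms)

lemma L2_inner_diff_left: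
  assumes "L2 M f" "L2 M k" "L2 M h"
  shows "L2_inner M (\<lambda>x. f x - k x) h = L2_inner M f h - L2_inner M k h"
  unfolding L2_inner_def left_diff_distrib
  by (intro Bochner_Integration.integral_diff L2_integrable_mult_cnj assms)

lemma L2_inner_lincomb_right:
  assumes "finite I" "\<And>i. i \<in> I \<Longrightarrow> L2 M (f i)" "L2 M h"
  shows "L2_inner M h (\<lambda>x. \<Sum>i\<in>I. c i * f i x) = (\<Sum>i\<in>I. cnj (c i) * L2_inner M h (f i))"
proof -
  have "L2_inner M h (\<lambda>x. \<Sum>i\<in>I. c i * f i x) = cnj (\<Sum>i\<in>I. c i * L2_inner M (f i) h)"
    by (subst L2_inner_commute) (simp add: L2_inner_lincomb_left[OF assms])
  also have "\<dots> = (\<Sum>i\<in>I. cnj (c i) * L2_inner M h (f i))"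
    unfolding cnj_sum complex_cnj_mult L2_inner_commute [symmetric] ..
  finally show ?thesis .
qed

lemma L2_normsq_lincomb:
  assumes "finite I" "\<And>i. i \<in> I \<Longrightarrow> L2 M (f i)"
  shows "L2_normsq M (\<lambda>x. \<Sum>i\<in>I. c i * f i x)
    = (\<Sum>i\<in>I. \<Sum>j\<in>I. Re (c i * cnj (c j) * L2_inner M (f i) (f j)))"
proof -
  have "complex_of_real (L2_normsq M (\<lambda>x. \<Sum>i\<in>I. c i * f i x))
      = (\<Sum>i\<in>I. \<Sum>j\<in>I. c i * cnj (c j) * L2_inner M (f i) (f j))"
    using assms
    by (simp add: L2_inner_self [symmetric] L2_inner_lincomb_left L2_inner_lincomb_right L2_lincomb
        sum_distrib_left mult.assoc)
  from arg_cong[OF this, of Re] show ?thesis by simp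
qed

lemma L2_normsq_diff:
  assumes "L2 M f" "L2 M h"
  shows "L2_normsq M (\<lambda>x. f x - h x) = L2_normsq M f + L2_normsq M h - 2 * Re (L2_inner M f h)"
proof -
  have "(cmod (f x - h x))\<^sup>2 = (cmod (f x))\<^sup>2 + (cmod (h x))\<^sup>2 - 2 * Re (f x * cnj (h x))" for x
    unfolding cmod_power2 by (simp add: power2_eq_square algebra_simps)
  moreover have "Re (L2_inner M f h) = (\<integral>x. Re (f x * cnj (h x)) \<partial>M)"
    unfolding L2_inner_def by (intro integral_Re [symmetric] L2_integrable_mult_cnj assms)
  moreover have "integrable M (\<lambda>x. Re (f x * cnj (h x)))"
    by (intro integrable_Re L2_integrable_mult_cnj assms)
  ultimately show ?thesis
    using assms by (simp add: L2_normsq_def L2_def del: times_complex.sel)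
qed

text \<open>Continuity of the squared norm, without the triangle inequality for the norm: for every
  \<open>e > 0\<close> the difference of the squared norms is at most
  \<open>(1 + 1 / e) \<parallel>f - h\<^sub>n\<parallel>\<^sup>2 + e \<parallel>f\<parallel>\<^sup>2\<close>, by a pointwise estimate.\<close>

lemma L2_normsq_tendsto:
  assumes "L2 M f" "\<And>n. L2 M (h n)" "(\<lambda>n. L2_normsq M (\<lambda>x. f x - h n x)) \<longlonglongrightarrow> 0"
  shows "(\<lambda>n. L2_normsq M (h n)) \<longlonglongrightarrow> L2_normsq M f"
proof -
  have bound: "\<bar>L2_normsq M (h n) - L2_normsq M f\<bar>
      \<le> (1 + 1 / e) * L2_normsq M (\<lambda>x. f x - h n x) + e * L2_normsq M f" if "e > 0" for e n
  proof -
    have pt: "norm ((cmod b)\<^sup>2 - (cmod a)\<^sup>2) \<le> (1 + 1 / e) * (cmod (a - b))\<^sup>2 + e * (cmod a)\<^sup>2"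
      for a b
    proof -
      let ?d = "cmod (a - b)" and ?a = "cmod a"
      have 1: "\<bar>cmod b - ?a\<bar> \<le> ?d" using norm_triangle_ineq3[of a b] by (simp add: abs_minus_commute)
      have "\<bar>(cmod b)\<^sup>2 - ?a\<^sup>2\<bar> = \<bar>cmod b - ?a\<bar> * (cmod b + ?a)"
        by (simp add: power2_eq_square square_diff_square_factored abs_mult)
      also have "\<dots> \<le> ?d * (2 * ?a + ?d)" using 1 by (intro mult_mono) auto
      also have "\<dots> = ?d\<^sup>2 + 2 * (?d * ?a)" by (simp add: power2_eq_square algebra_simps)
      also have "2 * (?d * ?a) \<le> ?d\<^sup>2 / e + e * ?a\<^sup>2"
      proof -
        have "0 \<le> (?d - e * ?a)\<^sup>2 / e" using that by simp
        also have "\<dots> = ?d\<^sup>2 / e + e * ?a\<^sup>2 - 2 * (?d * ?a)"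
          using that by (simp add: power2_eq_square field_simps)
        finally show ?thesis by simp
      qed
      finally show ?thesis by (simp add: algebra_simps)
    qed
    have int: "integrable M (\<lambda>x. (cmod (f x))\<^sup>2)" "integrable M (\<lambda>x. (cmod (h n x))\<^sup>2)"
      "integrable M (\<lambda>x. (cmod (f x - h n x))\<^sup>2)"
      using assms L2_diff[of M f "h n"] by (auto simp: L2_def)
    have "L2_normsq M (h n) - L2_normsq M f = (\<integral>x. (cmod (h n x))\<^sup>2 - (cmod (f x))\<^sup>2 \<partial>M)"
      using int by (simp add: L2_normsq_def)
    also have "norm \<dots> \<le> (\<integral>x. (1 + 1 / e) * (cmod (f x - h n x))\<^sup>2 + e * (cmod (f x))\<^sup>2 \<partial>M)"
      using int pt by (intro norm_integral_le_integral) auto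
    also have "\<dots> = (1 + 1 / e) * L2_normsq M (\<lambda>x. f x - h n x) + e * L2_normsq M f"
      using int by (simp add: L2_normsq_def)
    finally show ?thesis by simp
  qed
  show ?thesis
  proof (rule LIMSEQ_I)
    fix r :: real assume r: "r > 0"
    define e where "e = r / (2 * (L2_normsq M f + 1))"
    have pos: "L2_normsq M f + 1 > 0" using L2_normsq_nonneg[of M f] by simp
    have e: "e > 0" "e * L2_normsq M f < r / 2"
      using r pos L2_normsq_nonneg[of M f] by (auto simp: e_def field_simps)
    have "(\<lambda>n. (1 + 1 / e) * L2_normsq M (\<lambda>x. f x - h n x) + e * L2_normsq M f)
        \<longlonglongrightarrow> (1 + 1 / e) * 0 + e * L2_normsq M f"
      by (intro tendsto_intros assms)
    then have "\<forall>\<^sub>F n in sequentially.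
        (1 + 1 / e) * L2_normsq M (\<lambda>x. f x - h n x) + e * L2_normsq M f < r"
      by (rule order_tendstoD) (use e r in auto)
    then show "\<exists>no. \<forall>n\<ge>no. norm (L2_normsq M (h n) - L2_normsq M f) < r"
      using bound[OF e(1)] by (auto simp: eventually_sequentially intro: le_less_trans)
  qed
qed

lemma L2_normsq_eq_0_iff:
  assumes "L2 M f" shows "L2_normsq M f = 0 \<longleftrightarrow> (AE x in M. f x = 0)"
  using assms unfolding L2_normsq_def L2_def
  by (subst integral_nonneg_eq_0_iff_AE) auto

lemma hilbert_basis_L2: "hilbert_basis_L2_0 M \<phi> \<Longrightarrow> L2 M (\<phi> j)"
  by (simp add: hilbert_basis_L2_0_def L2_0_def)

lemma hilbert_basis_inner:
  "hilbert_basis_L2_0 M \<phi> \<Longrightarrow> L2_inner M (\<phi> j) (\<phi> k) = (if j = k then 1 else 0)"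
  by (simp add: hilbert_basis_L2_0_def)

lemma L2_normsq_basis_sum:
  assumes "hilbert_basis_L2_0 M \<phi>" "finite I"
  shows "L2_normsq M (\<lambda>x. \<Sum>j\<in>I. c j * \<phi> j x) = (\<Sum>j\<in>I. (cmod (c j))\<^sup>2)"
proof -
  have diag: "(\<Sum>j\<in>I. Re (c i * cnj (c j) * (if i = j then 1 else 0))) = (cmod (c i))\<^sup>2" if "i \<in> I" for i
  proof -
    have "(\<Sum>j\<in>I. Re (c i * cnj (c j) * (if i = j then 1 else 0)))
        = (\<Sum>j\<in>I. if i = j then Re (c i * cnj (c j)) else 0)"
      by (intro sum.cong) auto
    also have "\<dots> = Re (c i * cnj (c i))" using that assms by simp
    also have "\<dots> = (cmod (c i))\<^sup>2" by (simp flip: complex_norm_square)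
    finally show ?thesis .
  qed
  show ?thesis
    unfolding L2_normsq_lincomb[OF assms(2) hilbert_basis_L2[OF assms(1)]]
      hilbert_basis_inner[OF assms(1)]
    using diag by (rule sum.cong[OF refl])
qed

lemma L2_inner_basis_sum:
  assumes "hilbert_basis_L2_0 M \<phi>" "finite I"
  shows "L2_inner M (\<lambda>x. \<Sum>j\<in>I. c j * \<phi> j x) (\<phi> k) = (if k \<in> I then c k else 0)"
proof -
  have "L2_inner M (\<lambda>x. \<Sum>j\<in>I. c j * \<phi> j x) (\<phi> k) = (\<Sum>j\<in>I. c j * (if j = k then 1 else 0))"
    using assms by (simp add: L2_inner_lincomb_left hilbert_basis_L2 hilbert_basis_inner)
  also have "\<dots> = (\<Sum>j\<in>I. if k = j then c j else 0)" by (intro sum.cong) auto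
  finally show ?thesis using assms by simp
qed

lemma L2_0_basis_sum:
  assumes "finite_measure M" "hilbert_basis_L2_0 M \<phi>" "finite I"
  shows "L2_0 M (\<lambda>x. \<Sum>j\<in>I. c j * \<phi> j x)"
proof -
  have one: "L2 M (\<lambda>x. 1)"
    using assms(1) by (simp add: L2_def finite_measure.integrable_const)
  have "integrable M (\<phi> j)" for j
    using L2_integrable_mult_cnj[OF hilbert_basis_L2[OF assms(2)] one] by simp
  then have "(\<integral>x. (\<Sum>j\<in>I. c j * \<phi> j x) \<partial>M) = (\<Sum>j\<in>I. c j * (\<integral>x. \<phi> j x \<partial>M))"
    by (subst Bochner_Integration.integral_sum) auto
  also have "\<dots> = 0" using assms(2) by (simp add: hilbert_basis_L2_0_def L2_0_def)
  finally show ?thesis using assms by (simp add: L2_0_def L2_lincomb hilbert_basis_L2)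
qed

lemma parseval:
  assumes "hilbert_basis_L2_0 M \<phi>" "L2_0 M f"
  shows "(\<lambda>j. (cmod (L2_inner M f (\<phi> j)))\<^sup>2) sums L2_normsq M f"
proof -
  let ?a = "\<lambda>j. L2_inner M f (\<phi> j)"
  have f: "L2 M f" using assms by (simp add: L2_0_def)
  \<comment> \<open>Among the combinations of the first \<open>N\<close> basis elements, the one with the coefficients of
    \<open>f\<close> is closest to \<open>f\<close>.\<close>
  have dist: "L2_normsq M (\<lambda>x. f x - (\<Sum>j<N. c j * \<phi> j x))
      = L2_normsq M f - (\<Sum>j<N. (cmod (?a j))\<^sup>2) + (\<Sum>j<N. (cmod (c j - ?a j))\<^sup>2)" for N c
  proof -
    have "L2_normsq M (\<lambda>x. f x - (\<Sum>j<N. c j * \<phi> j x))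
        = L2_normsq M f + (\<Sum>j<N. (cmod (c j))\<^sup>2) - 2 * (\<Sum>j<N. Re (cnj (c j) * ?a j))"
      using f assms by (simp add: L2_normsq_diff L2_lincomb hilbert_basis_L2 L2_normsq_basis_sum
          L2_inner_lincomb_right del: times_complex.sel)
    moreover have "(cmod (c j - ?a j))\<^sup>2 - (cmod (?a j))\<^sup>2 = (cmod (c j))\<^sup>2 - 2 * Re (cnj (c j) * ?a j)"
      for j unfolding cmod_power2 by (simp add: power2_eq_square algebra_simps)
    then have "(\<Sum>j<N. (cmod (c j - ?a j))\<^sup>2) - (\<Sum>j<N. (cmod (?a j))\<^sup>2)
        = (\<Sum>j<N. (cmod (c j))\<^sup>2) - 2 * (\<Sum>j<N. Re (cnj (c j) * ?a j))"
      by (simp add: sum_distrib_left flip: sum_subtractf)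
    ultimately show ?thesis by simp
  qed
  have bessel: "(\<Sum>j<N. (cmod (?a j))\<^sup>2) \<le> L2_normsq M f" for N
    using dist[of ?a N] L2_normsq_nonneg[of M "\<lambda>x. f x - (\<Sum>j<N. ?a j * \<phi> j x)"] by simp
  show ?thesis
    unfolding sums_def
  proof (rule LIMSEQ_I)
    fix r :: real assume "r > 0"
    then obtain N c where N: "L2_normsq M (\<lambda>x. f x - (\<Sum>j<N. c j * \<phi> j x)) < r"
      using assms unfolding hilbert_basis_L2_0_def by blast
    have "0 \<le> (\<Sum>j<N. (cmod (c j - ?a j))\<^sup>2)" by (simp add: sum_nonneg)
    then have "L2_normsq M f - r < (\<Sum>j<N. (cmod (?a j))\<^sup>2)" using N dist[of c N] by simp
    moreover have "(\<Sum>j<N. (cmod (?a j))\<^sup>2) \<le> (\<Sum>j<n. (cmod (?a j))\<^sup>2)" if "N \<le> n" for n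
      using that by (intro sum_mono2) auto
    ultimately show "\<exists>no. \<forall>n\<ge>no. norm ((\<Sum>j<n. (cmod (?a j))\<^sup>2) - L2_normsq M f) < r"
      using bessel by (intro exI[of _ N]) (force simp: abs_less_iff)
  qed
qed

lemma orthogonal_to_basis_AE_0:
  assumes "hilbert_basis_L2_0 M \<phi>" "L2_0 M f" "\<And>j. L2_inner M f (\<phi> j) = 0"
  shows "AE x in M. f x = 0"
proof -
  have "(\<lambda>j. 0) sums L2_normsq M f" using parseval[OF assms(1,2)] assms(3) by simp
  then have "L2_normsq M f = 0" using sums_unique2 sums_zero by blast
  then show ?thesis using assms(2) L2_normsq_eq_0_iff by (auto simp: L2_0_def)
qed


section \<open>Large-time asymptotics of the observability constant\<close>

text \<open>The \<open>N\<close>-th partial sum of the solution with coefficients \<open>a\<close> of the initial position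
  and \<open>b\<close> of the initial velocity.\<close>

definition wave_sum ::
    "(nat \<Rightarrow> real) \<Rightarrow> (nat \<Rightarrow> 'm \<Rightarrow> complex) \<Rightarrow> (nat \<Rightarrow> complex) \<Rightarrow> (nat \<Rightarrow> complex) \<Rightarrow>
      nat \<Rightarrow> real \<Rightarrow> 'm \<Rightarrow> complex" where
  "wave_sum lam \<phi> a b N t x =
     (\<Sum>j<N. (a j * of_real (cos (lam j * t)) + b j * of_real (sin (lam j * t) / lam j)) * \<phi> j x)"

text \<open>Regrouping of a sum over \<open>\<plusminus> lam j\<close>, \<open>j < N\<close>, by the distinct values of the frequency.\<close>

lemma sum_signed_frequencies:
  fixes F :: "real \<Rightarrow> nat \<Rightarrow> 'a::comm_monoid_add"
  assumes "\<And>j. 0 < lam j"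
  shows "(\<Sum>\<mu>\<in>lam ` {..<N} \<union> uminus ` lam ` {..<N}. \<Sum>j | j < N \<and> lam j = \<bar>\<mu>\<bar>. F \<mu> j)
    = (\<Sum>j<N. F (lam j) j + F (- lam j) j)"
proof -
  have pos: "(\<Sum>\<mu>\<in>lam ` {..<N}. \<Sum>j | j < N \<and> lam j = \<bar>\<mu>\<bar>. F \<mu> j) = (\<Sum>j<N. F (lam j) j)"
  proof -
    have "(\<Sum>j<N. F (lam j) j) = (\<Sum>\<mu>\<in>lam ` {..<N}. \<Sum>j | j \<in> {..<N} \<and> lam j = \<mu>. F (lam j) j)"
      by (rule sum.image_gen) simp
    also have "\<dots> = (\<Sum>\<mu>\<in>lam ` {..<N}. \<Sum>j | j < N \<and> lam j = \<bar>\<mu>\<bar>. F \<mu> j)"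
      using assms by (intro sum.cong) (auto simp: less_imp_le)
    finally show ?thesis ..
  qed
  have neg: "(\<Sum>\<mu>\<in>uminus ` lam ` {..<N}. \<Sum>j | j < N \<and> lam j = \<bar>\<mu>\<bar>. F \<mu> j)
      = (\<Sum>j<N. F (- lam j) j)"
  proof -
    have "(\<Sum>j<N. F (- lam j) j)
        = (\<Sum>\<mu>\<in>lam ` {..<N}. \<Sum>j | j \<in> {..<N} \<and> lam j = \<mu>. F (- lam j) j)"
      by (rule sum.image_gen) simp
    also have "\<dots> = (\<Sum>\<mu>\<in>lam ` {..<N}. \<Sum>j | j < N \<and> lam j = \<bar>- \<mu>\<bar>. F (- \<mu>) j)"
      using assms by (intro sum.cong) (auto simp: less_imp_le)
    also have "\<dots> = (\<Sum>\<mu>\<in>uminus ` lam ` {..<N}. \<Sum>j | j < N \<and> lam j = \<bar>\<mu>\<bar>. F \<mu> j)"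
      by (subst sum.reindex) auto
    finally show ?thesis ..
  qed
  have "\<mu> < 0" if "\<mu> \<in> uminus ` lam ` {..<N}" for \<mu> using assms that by auto
  moreover have "\<mu> > 0" if "\<mu> \<in> lam ` {..<N}" for \<mu> using assms that by auto
  ultimately have "lam ` {..<N} \<inter> uminus ` lam ` {..<N} = {}" by fastforce
  then show ?thesis using pos neg by (simp add: sum.union_disjoint sum.distrib)
qed

lemma separated_signed_frequencies:
  assumes "\<And>j k. lam j \<noteq> lam k \<Longrightarrow> \<gamma> \<le> \<bar>lam j - lam k\<bar>" "\<And>j. \<gamma> \<le> 2 * lam j" "\<And>j. 0 < lam j"
  shows "separated \<gamma> (lam ` {..<N} \<union> uminus ` lam ` {..<N})"
proof -
  have *: "\<gamma> \<le> \<bar>lam j + lam k\<bar>" for j k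
    using assms(2)[of j] assms(2)[of k] assms(3)[of j] assms(3)[of k] by linarith
  have *: "\<gamma> \<le> \<bar>- lam j - lam k\<bar>" "\<gamma> \<le> \<bar>lam j + lam k\<bar>" for j k
    using *[of j k] by auto
  have **: "\<gamma> \<le> \<bar>lam j - lam k\<bar>" "\<gamma> \<le> \<bar>lam k - lam j\<bar>" if "lam j \<noteq> lam k" for j k
    using assms(1)[OF that] by auto
  show ?thesis unfolding separated_def using * ** by auto
qed

text \<open>The lower bound for partial sums. The hypothesis \<open>lower\<close> says that \<open>g\<close> bounds the
  quotients of finite combinations of basis elements of equal frequency from below.\<close>

lemma integral_wave_sum_ge:
  fixes M :: "'m measure" and lam :: "nat \<Rightarrow> real"
  assumes basis: "hilbert_basis_L2_0 M \<phi>" and lam: "\<And>j. 0 < lam j" "\<And>j. \<gamma> \<le> 2 * lam j"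
    and gap: "0 < \<gamma>" "\<And>j k. lam j \<noteq> lam k \<Longrightarrow> \<gamma> \<le> \<bar>lam j - lam k\<bar>"
    and \<omega>: "\<omega> \<in> sets M"
    and lower: "\<And>I l c. finite I \<Longrightarrow> (\<And>j. j \<in> I \<Longrightarrow> lam j = l) \<Longrightarrow>
      g * L2_normsq M (\<lambda>x. \<Sum>j\<in>I. c j * \<phi> j x) \<le> (LINT x:\<omega>|M. (cmod (\<Sum>j\<in>I. c j * \<phi> j x))\<^sup>2)"
    and T: "1 + 16 / \<gamma>\<^sup>2 \<le> T"
  shows "(T - (1 + 16 / \<gamma>\<^sup>2)) * (g / 2 * (\<Sum>j<N. (cmod (a j))\<^sup>2 + (cmod (b j))\<^sup>2 / (lam j)\<^sup>2))
    \<le> integral {0..T} (\<lambda>t. LINT x:\<omega>|M. (cmod (wave_sum lam \<phi> a b N t x))\<^sup>2)"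
proof -
  define S where "S = lam ` {..<N} \<union> uminus ` lam ` {..<N}"
  define I where "I = (\<lambda>\<mu>. {j. j < N \<and> lam j = \<bar>\<mu>\<bar>})"
  \<comment> \<open>Euler's formulas split each mode into the frequencies \<open>lam j\<close> and \<open>- lam j\<close> with these
    amplitudes; \<open>f \<mu>\<close> collects the modes of frequency \<open>\<mu>\<close>, restricted to \<open>\<omega>\<close>.\<close>
  define h where "h = (\<lambda>\<mu> j. (a j - \<i> * of_real (sgn \<mu>) * (b j / of_real (lam j))) / 2)"
  define f where "f = (\<lambda>\<mu> x. indicator \<omega> x * (\<Sum>j\<in>I \<mu>. h \<mu> j * \<phi> j x))"
  have finS: "finite S" by (simp add: S_def)
  have finI: "finite (I \<mu>)" for \<mu> by (simp add: I_def)
  have L2f: "L2 M (f \<mu>)" for \<mu>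
    unfolding f_def by (intro L2_indicator L2_lincomb finI hilbert_basis_L2[OF basis] \<omega>)
  have expand: "indicator \<omega> x * wave_sum lam \<phi> a b N t x = (\<Sum>\<mu>\<in>S. cis (\<mu> * t) * f \<mu> x)" for t x
  proof -
    have euler: "(p * of_real (cos \<theta>) + q * of_real (sin \<theta> / r))
        = cis \<theta> * ((p - \<i> * (q / of_real r)) / 2) + cis (- \<theta>) * ((p + \<i> * (q / of_real r)) / 2)"
      for p q \<theta> and r :: real
    proof -
      have *: "cis \<theta> = of_real (cos \<theta>) + \<i> * of_real (sin \<theta>)"
        "cis (-\<theta>) = of_real (cos \<theta>) - \<i> * of_real (sin \<theta>)"
        by (auto simp: complex_eq_iff)
      show ?thesis unfolding * by (simp add: field_simps)
    qed
    have "wave_sum lam \<phi> a b N t x = (\<Sum>j<N. cis (lam j * t) * (h (lam j) j * \<phi> j x)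
        + cis (- lam j * t) * (h (- lam j) j * \<phi> j x))"
      unfolding wave_sum_def euler h_def using lam by (simp add: distrib_right mult.assoc)
    also have "\<dots> = (\<Sum>\<mu>\<in>S. \<Sum>j\<in>I \<mu>. cis (\<mu> * t) * (h \<mu> j * \<phi> j x))"
      unfolding S_def I_def by (rule sum_signed_frequencies [symmetric]) (rule lam)
    finally show ?thesis by (simp add: f_def sum_distrib_left mult_ac)
  qed
  have gram: "(LINT x:\<omega>|M. (cmod (wave_sum lam \<phi> a b N t x))\<^sup>2)
      = (\<Sum>\<mu>\<in>S. \<Sum>\<nu>\<in>S. Re (L2_inner M (f \<mu>) (f \<nu>) * cis ((\<mu> - \<nu>) * t)))" for t
  proof -
    have "cis (\<mu> * t) * cnj (cis (\<nu> * t)) = cis ((\<mu> - \<nu>) * t)" for \<mu> \<nu>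
      by (simp add: cis_cnj cis_mult left_diff_distrib)
    then show ?thesis
      unfolding set_integral_eq_L2_normsq_indicator expand
      by (subst L2_normsq_lincomb[OF finS L2f])
         (simp add: mult.commute[of "L2_inner _ _ _"] del: times_complex.sel)
  qed
  have "g * (\<Sum>j<N. (cmod (a j))\<^sup>2 + (cmod (b j))\<^sup>2 / (lam j)\<^sup>2) / 2
      = g * (\<Sum>\<mu>\<in>S. \<Sum>j\<in>I \<mu>. (cmod (h \<mu> j))\<^sup>2)"
  proof -
    \<comment> \<open>parallelogram law\<close>
    have par: "((cmod p)\<^sup>2 + (cmod q)\<^sup>2) / 2
        = (cmod ((p - \<i> * q) / 2))\<^sup>2 + (cmod ((p + \<i> * q) / 2))\<^sup>2" for p q
      unfolding cmod_power2 by (simp add: power2_eq_square field_simps)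
    have "(cmod (a j))\<^sup>2 + (cmod (b j))\<^sup>2 / (lam j)\<^sup>2
        = 2 * ((cmod (h (lam j) j))\<^sup>2 + (cmod (h (- lam j) j))\<^sup>2)" for j
      using par[of "a j" "b j / of_real (lam j)"] lam[of j]
      by (simp add: h_def norm_divide power_divide)
    then show ?thesis
      unfolding S_def I_def sum_signed_frequencies[OF lam(1)]
      by (simp add: sum_distrib_left sum_distrib_right algebra_simps)
  qed
  also have "\<dots> = (\<Sum>\<mu>\<in>S. g * L2_normsq M (\<lambda>x. \<Sum>j\<in>I \<mu>. h \<mu> j * \<phi> j x))"
    by (simp add: L2_normsq_basis_sum[OF basis finI] sum_distrib_left)
  also have "\<dots> \<le> (\<Sum>\<mu>\<in>S. L2_normsq M (f \<mu>))"
    unfolding f_def set_integral_eq_L2_normsq_indicator [symmetric]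
    by (intro sum_mono lower finI) (simp add: I_def)
  finally have d: "g / 2 * (\<Sum>j<N. (cmod (a j))\<^sup>2 + (cmod (b j))\<^sup>2 / (lam j)\<^sup>2)
      \<le> (\<Sum>\<mu>\<in>S. L2_normsq M (f \<mu>))" by simp
  have "(T - (1 + 16 / \<gamma>\<^sup>2)) * (\<Sum>\<mu>\<in>S. L2_normsq M (f \<mu>))
      \<le> integral {0..T} (\<lambda>t. \<Sum>\<mu>\<in>S. \<Sum>\<nu>\<in>S. Re (L2_inner M (f \<mu>) (f \<nu>) * cis ((\<mu> - \<nu>) * t)))"
  proof (rule integral_trigonometric_gram_ge)
    show "separated \<gamma> S" unfolding S_def using gap lam by (intro separated_signed_frequencies) auto
    show "0 \<le> (\<Sum>\<mu>\<in>S. \<Sum>\<nu>\<in>S. Re (L2_inner M (f \<mu>) (f \<nu>) * cis ((\<mu> - \<nu>) * t)))" for t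
      unfolding gram [symmetric] set_integral_eq_L2_normsq_indicator by (rule L2_normsq_nonneg)
    have "0 \<le> 16 / \<gamma>\<^sup>2" by simp
    then show "1 \<le> T" using T by linarith
    show "cmod (L2_inner M (f \<mu>) (f \<nu>)) \<le> (L2_normsq M (f \<mu>) + L2_normsq M (f \<nu>)) / 2" for \<mu> \<nu>
      by (intro cmod_L2_inner_le L2f)
  qed (use finS gap in \<open>auto simp: L2_inner_self\<close>)
  moreover have "(T - (1 + 16 / \<gamma>\<^sup>2)) * (g / 2 * (\<Sum>j<N. (cmod (a j))\<^sup>2 + (cmod (b j))\<^sup>2 / (lam j)\<^sup>2))
      \<le> (T - (1 + 16 / \<gamma>\<^sup>2)) * (\<Sum>\<mu>\<in>S. L2_normsq M (f \<mu>))"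
    using T d by (intro mult_left_mono) auto
  ultimately show ?thesis by (simp add: gram)
qed

lemma cmod_cos_sin_combination_le:
  "(cmod (p * of_real (cos \<theta>) + q * of_real (sin \<theta> / r)))\<^sup>2 \<le> (cmod p)\<^sup>2 + (cmod q)\<^sup>2 / r\<^sup>2"
proof -
  let ?P = "cmod p" and ?Q = "cmod q / \<bar>r\<bar>"
  have "cmod (p * of_real (cos \<theta>) + q * of_real (sin \<theta> / r)) \<le> ?P * \<bar>cos \<theta>\<bar> + ?Q * \<bar>sin \<theta>\<bar>"
    using norm_triangle_ineq[of "p * of_real (cos \<theta>)" "q * of_real (sin \<theta> / r)"]
    by (simp add: norm_mult norm_divide)
  then have "(cmod (p * of_real (cos \<theta>) + q * of_real (sin \<theta> / r)))\<^sup>2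
      \<le> (?P * \<bar>cos \<theta>\<bar> + ?Q * \<bar>sin \<theta>\<bar>)\<^sup>2"
    by (intro power_mono) auto
  also have "\<dots> \<le> (?P\<^sup>2 + ?Q\<^sup>2) * (\<bar>cos \<theta>\<bar>\<^sup>2 + \<bar>sin \<theta>\<bar>\<^sup>2)"
    using zero_le_power2[of "?P * \<bar>sin \<theta>\<bar> - ?Q * \<bar>cos \<theta>\<bar>"]
    unfolding power2_eq_square by (simp only: algebra_simps)
  finally show ?thesis by (simp add: power_divide)
qed

lemma L2_normsq_indicator_le:
  assumes "L2 M f" "\<omega> \<in> sets M"
  shows "L2_normsq M (\<lambda>x. indicator \<omega> x * f x) \<le> L2_normsq M f"
  unfolding L2_normsq_def
proof (rule integral_mono)
  show "integrable M (\<lambda>x. (cmod (indicator \<omega> x * f x))\<^sup>2)" "integrable M (\<lambda>x. (cmod (f x))\<^sup>2)"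
    using L2_indicator[OF assms] assms(1) by (auto simp: L2_def)
qed (auto simp: indicator_def)

text \<open>The lower bound for arbitrary data, by dominated convergence in \<open>t\<close>. The representatives
  \<open>y t\<close> need not be jointly measurable, but the observed energy at time \<open>t\<close> is a pointwise limit
  of continuous functions of \<open>t\<close>.\<close>

lemma observed_energy_ge:
  fixes M :: "'m measure" and lam :: "nat \<Rightarrow> real"
  assumes basis: "hilbert_basis_L2_0 M \<phi>" and lam: "\<And>j. 0 < lam j" "\<And>j. \<gamma> \<le> 2 * lam j"
    and gap: "0 < \<gamma>" "\<And>j k. lam j \<noteq> lam k \<Longrightarrow> \<gamma> \<le> \<bar>lam j - lam k\<bar>"
    and \<omega>: "\<omega> \<in> sets M"
    and lower: "\<And>I l c. finite I \<Longrightarrow> (\<And>j. j \<in> I \<Longrightarrow> lam j = l) \<Longrightarrow>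
      g * L2_normsq M (\<lambda>x. \<Sum>j\<in>I. c j * \<phi> j x) \<le> (LINT x:\<omega>|M. (cmod (\<Sum>j\<in>I. c j * \<phi> j x))\<^sup>2)"
    and T: "1 + 16 / \<gamma>\<^sup>2 \<le> T"
    and data: "initial_data M lam y0 b" and sol: "wave_solution M lam \<phi> y0 b y"
  shows "(T - (1 + 16 / \<gamma>\<^sup>2)) * (g / 2 * data_normsq M lam y0 b)
    \<le> (LINT t:{0..T}|lborel. (LINT x:\<omega>|M. (cmod (y t x))\<^sup>2))"
proof -
  define a where "a = (\<lambda>j. L2_inner M y0 (\<phi> j))"
  define w where "w = wave_sum lam \<phi> a b"
  define E where "E = (\<lambda>N t. LINT x:\<omega>|M. (cmod (w N t x))\<^sup>2)"
  define D where "D = data_normsq M lam y0 b"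
  have L2y: "L2 M (y t)" for t using sol by (simp add: wave_solution_def)
  have L2w: "L2 M (w N t)" for N t
    unfolding w_def wave_sum_def by (intro L2_lincomb hilbert_basis_L2[OF basis]) auto
  have sums_D: "(\<lambda>j. (cmod (a j))\<^sup>2 + (cmod (b j))\<^sup>2 / (lam j)\<^sup>2) sums D"
    unfolding D_def data_normsq_def a_def using data
    by (intro sums_add parseval[OF basis] summable_sums) (auto simp: initial_data_def)
  have lim: "(\<lambda>N. E N t) \<longlonglongrightarrow> (LINT x:\<omega>|M. (cmod (y t x))\<^sup>2)" for t
    unfolding E_def set_integral_eq_L2_normsq_indicator
  proof (rule L2_normsq_tendsto)
    have 0: "(\<lambda>N. L2_normsq M (\<lambda>x. y t x - w N t x)) \<longlonglongrightarrow> 0"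
      using sol by (simp add: wave_solution_def w_def a_def wave_sum_def)
    show "(\<lambda>N. L2_normsq M (\<lambda>x. indicator \<omega> x * y t x - indicator \<omega> x * w N t x)) \<longlonglongrightarrow> 0"
      unfolding right_diff_distrib [symmetric]
      by (rule tendsto_sandwich[OF _ _ tendsto_const 0])
         (auto intro!: always_eventually L2_normsq_nonneg L2_normsq_indicator_le L2_diff L2y L2w \<omega>)
  qed (intro L2_indicator L2y L2w \<omega>)+
  have E0: "0 \<le> E N t" for N t
    unfolding E_def set_integral_eq_L2_normsq_indicator by (rule L2_normsq_nonneg)
  have bound: "E N t \<le> D" for N t
  proof -
    have "E N t \<le> L2_normsq M (w N t)"
      unfolding E_def set_integral_eq_L2_normsq_indicator
      by (intro L2_normsq_indicator_le L2w \<omega>)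
    also have "\<dots> = (\<Sum>j<N. (cmod (a j * of_real (cos (lam j * t)) +
        b j * of_real (sin (lam j * t) / lam j)))\<^sup>2)"
      unfolding w_def wave_sum_def by (intro L2_normsq_basis_sum basis) auto
    also have "\<dots> \<le> (\<Sum>j<N. (cmod (a j))\<^sup>2 + (cmod (b j))\<^sup>2 / (lam j)\<^sup>2)"
      by (intro sum_mono cmod_cos_sin_combination_le)
    also have "\<dots> \<le> D"
      using sums_D by (intro sum_le_suminf[THEN order_trans]) (auto simp: sums_iff)
    finally show ?thesis .
  qed
  have contE: "continuous_on X (E N)" for X N
  proof -
    have "E N = (\<lambda>t. \<Sum>i<N. \<Sum>j<N. Re ((a i * of_real (cos (lam i * t)) +
        b i * of_real (sin (lam i * t) / lam i)) * cnj (a j * of_real (cos (lam j * t)) +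
        b j * of_real (sin (lam j * t) / lam j)) *
        L2_inner M (\<lambda>x. indicator \<omega> x * \<phi> i x) (\<lambda>x. indicator \<omega> x * \<phi> j x)))"
    proof
      fix t
      have "E N t = L2_normsq M (\<lambda>x. \<Sum>j<N. (a j * of_real (cos (lam j * t)) +
          b j * of_real (sin (lam j * t) / lam j)) * (indicator \<omega> x * \<phi> j x))"
        unfolding E_def set_integral_eq_L2_normsq_indicator w_def wave_sum_def
        by (simp add: sum_distrib_left mult_ac)
      then show "E N t = (\<Sum>i<N. \<Sum>j<N. Re ((a i * of_real (cos (lam i * t)) +
        b i * of_real (sin (lam i * t) / lam i)) * cnj (a j * of_real (cos (lam j * t)) +
        b j * of_real (sin (lam j * t) / lam j)) *
        L2_inner M (\<lambda>x. indicator \<omega> x * \<phi> i x) (\<lambda>x. indicator \<omega> x * \<phi> j x)))"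
        by (subst (asm) L2_normsq_lincomb) (auto intro: L2_indicator hilbert_basis_L2[OF basis] \<omega>)
    qed
    moreover have "lam i \<noteq> 0" for i using lam(1)[of i] by simp
    ultimately show ?thesis by (simp only:) (intro continuous_intros ballI; simp)
  qed
  have "(\<lambda>N. LINT t:{0..T}|lborel. E N t) \<longlonglongrightarrow> (LINT t:{0..T}|lborel. (LINT x:\<omega>|M. (cmod (y t x))\<^sup>2))"
    unfolding set_lebesgue_integral_def[of lborel]
  proof (rule integral_dominated_convergence[where w = "\<lambda>t. indicator {0..T} t * D"])
    have [measurable]: "E N \<in> borel_measurable borel" for N
      by (intro borel_measurable_continuous_onI contE)
    have meas: "(\<lambda>t. LINT x:\<omega>|M. (cmod (y t x))\<^sup>2) \<in> borel_measurable borel"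
      by (rule borel_measurable_LIMSEQ_real[where u = E]) (auto intro: lim)
    show "(\<lambda>t. indicat_real {0..T} t *\<^sub>R (LINT x:\<omega>|M. (cmod (y t x))\<^sup>2)) \<in> borel_measurable lborel"
      using meas by measurable
    show "(\<lambda>t. indicat_real {0..T} t *\<^sub>R E N t) \<in> borel_measurable lborel" for N
      by measurable
    show "integrable lborel (\<lambda>t. indicator {0..T} t * D)"
      by (intro integrable_mult_left integrable_real_indicator)
         (auto simp: emeasure_lborel_Icc_eq)
    show "AE t in lborel. norm (indicat_real {0..T} t *\<^sub>R E N t) \<le> indicator {0..T} t * D" for N
      using bound E0 by (intro AE_I2) (auto simp: indicator_def)
  qed (auto intro!: AE_I2 tendsto_intros lim)
  moreover have "(LINT t:{0..T}|lborel. E N t) = integral {0..T} (E N)" for N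
    by (intro set_borel_integral_eq_integral borel_integrable_atLeastAtMost' contE)
  ultimately have upper: "(\<lambda>N. integral {0..T} (E N))
      \<longlonglongrightarrow> (LINT t:{0..T}|lborel. (LINT x:\<omega>|M. (cmod (y t x))\<^sup>2))" by simp
  have "(\<lambda>N. (T - (1 + 16 / \<gamma>\<^sup>2)) * (g / 2 * (\<Sum>j<N. (cmod (a j))\<^sup>2 + (cmod (b j))\<^sup>2 / (lam j)\<^sup>2)))
      \<longlonglongrightarrow> (T - (1 + 16 / \<gamma>\<^sup>2)) * (g / 2 * D)"
    using sums_D unfolding sums_def by (intro tendsto_intros)
  moreover have "(T - (1 + 16 / \<gamma>\<^sup>2)) * (g / 2 * (\<Sum>j<N. (cmod (a j))\<^sup>2 + (cmod (b j))\<^sup>2 / (lam j)\<^sup>2))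
      \<le> integral {0..T} (E N)" for N
    unfolding E_def w_def 
    by (rule integral_wave_sum_ge) (fact basis lam gap \<omega> lower T)+
  ultimately show ?thesis
    unfolding D_def by (intro LIMSEQ_le[OF _ upper]) auto
qed

lemma data_normsq_pos:
  assumes "initial_data M lam y0 b" "\<not> zero_data M y0 b" "\<And>j. 0 < lam j"
  shows "0 < data_normsq M lam y0 b"
proof -
  let ?s = "\<Sum>j. (cmod (b j))\<^sup>2 / (lam j)\<^sup>2"
  have sm: "summable (\<lambda>j. (cmod (b j))\<^sup>2 / (lam j)\<^sup>2)" and L2: "L2 M y0"
    using assms by (auto simp: initial_data_def L2_0_def)
  have nn: "0 \<le> ?s" "0 \<le> L2_normsq M y0" by (auto intro: suminf_nonneg[OF sm] L2_normsq_nonneg)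
  show ?thesis
  proof (rule ccontr)
    assume "\<not> 0 < data_normsq M lam y0 b"
    then have "?s = 0" "L2_normsq M y0 = 0" using nn by (auto simp: data_normsq_def)
    then have "\<forall>j. (cmod (b j))\<^sup>2 / (lam j)\<^sup>2 = 0" "AE x in M. y0 x = 0"
      using suminf_eq_zero_iff[OF sm] L2_normsq_eq_0_iff[OF L2] by auto
    then show False using assms(2,3) by (force simp: zero_data_def dest: less_imp_neq)
  qed
qed

lemma integral_cos_squared:
  assumes "0 \<le> T" "0 < (l::real)"
  shows "(LINT t:{0..T}|lborel. (cos (l * t))\<^sup>2) = T / 2 + sin (2 * l * T) / (4 * l)"
proof -
  have "((\<lambda>t. (cos (l * t))\<^sup>2) has_integral
      (T / 2 + sin (2 * l * T) / (4 * l) - (0 / 2 + sin (2 * l * 0) / (4 * l)))) {0..T}"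
  proof (rule fundamental_theorem_of_calculus[OF assms(1)])
    fix t
    have sq: "(cos (l * t))\<^sup>2 = (1 + cos (2 * l * t)) / 2"
      using cos_double_cos[of "l * t"] by (simp add: mult.assoc)
    show "((\<lambda>t. t / 2 + sin (2 * l * t) / (4 * l)) has_vector_derivative (cos (l * t))\<^sup>2)
        (at t within {0..T})"
      unfolding has_real_derivative_iff_has_vector_derivative [symmetric] sq using assms(2)
      by (auto intro!: derivative_eq_intros simp: field_simps)
  qed
  moreover have "(LINT t:{0..T}|lborel. (cos (l * t))\<^sup>2) = integral {0..T} (\<lambda>t. (cos (l * t))\<^sup>2)"
    by (intro set_borel_integral_eq_integral borel_integrable_atLeastAtMost' continuous_intros)
  ultimately show ?thesis by (simp add: integral_unique)
qed

lemma standing_wave_solution: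
  fixes c :: "nat \<Rightarrow> complex"
  assumes basis: "hilbert_basis_L2_0 M \<phi>" and I: "finite I" "\<And>j. j \<in> I \<Longrightarrow> lam j = l"
  defines "f \<equiv> \<lambda>x. \<Sum>j\<in>I. c j * \<phi> j x"
  shows "wave_solution M lam \<phi> f (\<lambda>j. 0) (\<lambda>t x. of_real (cos (l * t)) * f x)"
  unfolding wave_solution_def
proof (intro allI conjI)
  fix t
  show "L2 M (\<lambda>x. of_real (cos (l * t)) * f x)"
    unfolding f_def by (intro L2_cmult L2_lincomb I hilbert_basis_L2[OF basis])
  obtain N0 where N0: "I \<subseteq> {..<N0}" using I finite_nat_bounded by blast
  have "L2_normsq M (\<lambda>x. of_real (cos (l * t)) * f x - (\<Sum>j<N. (L2_inner M f (\<phi> j) *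
      of_real (cos (lam j * t)) + 0 * of_real (sin (lam j * t) / lam j)) * \<phi> j x)) = 0"
    if "N0 \<le> N" for N
  proof -
    have "(\<Sum>j<N. (L2_inner M f (\<phi> j) * of_real (cos (lam j * t)) +
        0 * of_real (sin (lam j * t) / lam j)) * \<phi> j x) = of_real (cos (l * t)) * f x" for x
    proof -
      have "(\<Sum>j<N. (L2_inner M f (\<phi> j) * of_real (cos (lam j * t)) +
          0 * of_real (sin (lam j * t) / lam j)) * \<phi> j x)
          = (\<Sum>j\<in>I. (L2_inner M f (\<phi> j) * of_real (cos (lam j * t)) +
          0 * of_real (sin (lam j * t) / lam j)) * \<phi> j x)"
        using N0 that I unfolding f_def
        by (intro sum.mono_neutral_right) (auto simp: L2_inner_basis_sum[OF basis])
      also have "\<dots> = (\<Sum>j\<in>I. of_real (cos (l * t)) * (c j * \<phi> j x))"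
        using I unfolding f_def
        by (intro sum.cong) (auto simp: L2_inner_basis_sum[OF basis])
      finally show ?thesis by (simp add: f_def sum_distrib_left)
    qed
    then show ?thesis by (simp add: L2_normsq_def)
  qed
  then show "(\<lambda>N. L2_normsq M (\<lambda>x. of_real (cos (l * t)) * f x - (\<Sum>j<N. (L2_inner M f (\<phi> j) *
      of_real (cos (lam j * t)) + 0 * of_real (sin (lam j * t) / lam j)) * \<phi> j x))) \<longlonglongrightarrow> 0"
    by (intro tendsto_eventually) (auto simp: eventually_sequentially)
qed

text \<open>The quotient of a standing wave belongs to the set whose infimum is the observability
  constant.\<close>

lemma J_functional_standing_wave:
  fixes c :: "nat \<Rightarrow> complex"
  assumes "finite_measure M" and basis: "hilbert_basis_L2_0 M \<phi>"
    and I: "finite I" "\<And>j. j \<in> I \<Longrightarrow> lam j = l" and "0 \<le> T" "0 < l"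
  defines "f \<equiv> \<lambda>x. \<Sum>j\<in>I. c j * \<phi> j x"
  assumes "0 < L2_normsq M f"
  shows "(LINT x:\<omega>|M. (cmod (f x))\<^sup>2) / L2_normsq M f * (T / 2 + sin (2 * l * T) / (4 * l))
    \<in> {J_functional M lam T \<omega> y0 b y | y0 b y.
         initial_data M lam y0 b \<and> \<not> zero_data M y0 b \<and> wave_solution M lam \<phi> y0 b y}"
proof -
  have L2_0: "L2_0 M f" unfolding f_def by (intro L2_0_basis_sum assms)
  have "initial_data M lam f (\<lambda>j. 0)" using L2_0 by (simp add: initial_data_def)
  moreover have "\<not> zero_data M f (\<lambda>j. 0)"
    using assms L2_0 L2_normsq_eq_0_iff[of M f] by (auto simp: zero_data_def L2_0_def)
  moreover have "wave_solution M lam \<phi> f (\<lambda>j. 0) (\<lambda>t x. of_real (cos (l * t)) * f x)"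
    unfolding f_def by (rule standing_wave_solution[OF basis I])
  moreover have "J_functional M lam T \<omega> f (\<lambda>j. 0) (\<lambda>t x. of_real (cos (l * t)) * f x)
      = (LINT x:\<omega>|M. (cmod (f x))\<^sup>2) / L2_normsq M f * (T / 2 + sin (2 * l * T) / (4 * l))"
  proof -
    have "(LINT x:\<omega>|M. (cmod (of_real (cos (l * t)) * f x))\<^sup>2)
        = (cos (l * t))\<^sup>2 * (LINT x:\<omega>|M. (cmod (f x))\<^sup>2)" for t
      by (simp add: norm_mult power_mult_distrib)
    then show ?thesis
      using integral_cos_squared[OF \<open>0 \<le> T\<close> \<open>0 < l\<close>]
      by (simp add: J_functional_def data_normsq_def mult.commute)
  qed
  ultimately show ?thesis by (intro CollectI exI conjI) (rule sym)
qed

text \<open>The limit in abstract form: \<open>g\<close> is a lower bound, approached arbitrarily well, of the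
  quotients of finite combinations of basis elements of equal frequency.\<close>

lemma observability_constant_asymptotics:
  fixes M :: "'m measure" and lam :: "nat \<Rightarrow> real"
  assumes fin: "finite_measure M" and basis: "hilbert_basis_L2_0 M \<phi>"
    and lam: "\<And>j. 0 < lam j" "\<And>j. \<gamma> \<le> 2 * lam j"
    and gap: "0 < \<gamma>" "\<And>j k. lam j \<noteq> lam k \<Longrightarrow> \<gamma> \<le> \<bar>lam j - lam k\<bar>"
    and \<omega>: "\<omega> \<in> sets M"
    and g: "0 \<le> g"
    and lower: "\<And>I l c. finite I \<Longrightarrow> (\<And>j. j \<in> I \<Longrightarrow> lam j = l) \<Longrightarrow>
      g * L2_normsq M (\<lambda>x. \<Sum>j\<in>I. c j * \<phi> j x) \<le> (LINT x:\<omega>|M. (cmod (\<Sum>j\<in>I. c j * \<phi> j x))\<^sup>2)"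
    and upper: "\<And>e. 0 < e \<Longrightarrow> \<exists>I l c. finite I \<and> (\<forall>j\<in>I. lam j = l) \<and>
      0 < L2_normsq M (\<lambda>x. \<Sum>j\<in>I. c j * \<phi> j x) \<and>
      (LINT x:\<omega>|M. (cmod (\<Sum>j\<in>I. c j * \<phi> j x))\<^sup>2) \<le> (g + e) * L2_normsq M (\<lambda>x. \<Sum>j\<in>I. c j * \<phi> j x)"
  shows "((\<lambda>T. observability_constant M lam \<phi> T \<omega> / T) \<longlongrightarrow> g / 2) at_top"
proof -
  define C where "C = 1 + 16 / \<gamma>\<^sup>2"
  define Js where "Js = (\<lambda>T. {J_functional M lam T \<omega> y0 b y | y0 b y.
         initial_data M lam y0 b \<and> \<not> zero_data M y0 b \<and> wave_solution M lam \<phi> y0 b y})"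
  have "0 < C" using gap by (simp add: C_def add_pos_nonneg)
  \<comment> \<open>The lower bound is uniform over all data.\<close>
  have Js_ge: "(T - C) * (g / 2) \<le> J" if CT: "C \<le> T" and J_in: "J \<in> Js T" for T J
  proof -
    obtain y0 b y where J: "J = J_functional M lam T \<omega> y0 b y" "initial_data M lam y0 b"
      "\<not> zero_data M y0 b" "wave_solution M lam \<phi> y0 b y"
      using J_in unfolding Js_def by blast
    have "0 < data_normsq M lam y0 b" using data_normsq_pos J lam by blast
    moreover have "(T - C) * (g / 2 * data_normsq M lam y0 b)
        \<le> (LINT t:{0..T}|lborel. (LINT x:\<omega>|M. (cmod (y t x))\<^sup>2))"
      unfolding C_def
      by (rule observed_energy_ge) (fact basis lam gap \<omega> lower CT[unfolded C_def] J(2) J(4))+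
    ultimately show ?thesis by (simp add: J(1) J_functional_def pos_le_divide_eq mult.assoc)
  qed
  have bdd: "bdd_below (Js T)" if "C \<le> T" for T
    using Js_ge[OF that] by (rule bdd_belowI)
  \<comment> \<open>Standing waves almost realise \<open>g\<close>; the quotient \<open>q\<close> and the frequency \<open>l\<close> do not depend
    on \<open>T\<close>.\<close>
  have member: "\<exists>l q. 0 < l \<and> 0 \<le> q \<and> q \<le> g + e \<and>
      (\<forall>T\<ge>0. q * (T / 2 + sin (2 * l * T) / (4 * l)) \<in> Js T)" if e: "0 < e" for e
  proof -
    obtain I l c where I: "finite I" "\<forall>j\<in>I. lam j = l"
      "0 < L2_normsq M (\<lambda>x. \<Sum>j\<in>I. c j * \<phi> j x)"
      "(LINT x:\<omega>|M. (cmod (\<Sum>j\<in>I. c j * \<phi> j x))\<^sup>2) \<le> (g + e) * L2_normsq M (\<lambda>x. \<Sum>j\<in>I. c j * \<phi> j x)"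
      using upper[OF e] by blast
    have "I \<noteq> {}" using I(3) by (auto simp: L2_normsq_def)
    then have "0 < l" using I(2) lam(1) by auto
    let ?q = "(LINT x:\<omega>|M. (cmod (\<Sum>j\<in>I. c j * \<phi> j x))\<^sup>2) / L2_normsq M (\<lambda>x. \<Sum>j\<in>I. c j * \<phi> j x)"
    have "0 \<le> ?q" by (simp add: set_integral_eq_L2_normsq_indicator L2_normsq_nonneg)
    moreover have "?q \<le> g + e" using I(3,4) by (simp add: pos_divide_le_eq)
    moreover have "?q * (T / 2 + sin (2 * l * T) / (4 * l)) \<in> Js T" if "0 \<le> T" for T
      unfolding Js_def using I(2) J_functional_standing_wave[OF fin basis I(1) _ that \<open>0 < l\<close> I(3)]
      by blast
    ultimately show ?thesis using \<open>0 < l\<close> by blast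
  qed
  have obs: "observability_constant M lam \<phi> T \<omega> = Inf (Js T)" for T
    by (simp add: observability_constant_def Js_def)
  show ?thesis
  proof (rule order_tendstoI)
    fix r assume r: "r < g / 2"
    have "((\<lambda>T. g / 2 - C * (g / 2) / T) \<longlongrightarrow> g / 2 - 0) at_top"
      by (intro tendsto_diff tendsto_const tendsto_divide_0[OF tendsto_const])
         (simp add: filterlim_at_top_imp_at_infinity filterlim_ident)
    then have "\<forall>\<^sub>F T in at_top. r < g / 2 - C * (g / 2) / T" by (rule order_tendstoD) (use r in simp)
    then show "\<forall>\<^sub>F T in at_top. r < observability_constant M lam \<phi> T \<omega> / T"
      using eventually_ge_at_top[of C]
    proof eventually_elim
      case (elim T)
      have "0 < T" using elim(2) \<open>0 < C\<close> by simp
      have "Js T \<noteq> {}" using member[OF zero_less_one] \<open>0 < T\<close> by (metis empty_iff less_imp_le)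
      then have "(T - C) * (g / 2) \<le> Inf (Js T)" by (rule cInf_greatest) (rule Js_ge[OF elim(2)])
      then have "(T - C) * (g / 2) / T \<le> Inf (Js T) / T" using \<open>0 < T\<close> by (intro divide_right_mono) auto
      moreover have "(T - C) * (g / 2) / T = g / 2 - C * (g / 2) / T"
        using \<open>0 < T\<close> by (simp add: field_simps)
      ultimately show ?case using elim(1) obs by simp
    qed
  next
    fix r assume r: "g / 2 < r"
    then have "0 < r - g / 2" by simp
    from member[OF this] obtain l q where lq: "0 < l" "0 \<le> q" "q \<le> g + (r - g / 2)"
      "\<forall>T\<ge>0. q * (T / 2 + sin (2 * l * T) / (4 * l)) \<in> Js T"
      by blast
    have "((\<lambda>T. q / 2 + q * (1 / (4 * l)) / T) \<longlongrightarrow> q / 2 + 0) at_top"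
      by (intro tendsto_add tendsto_const tendsto_divide_0[OF tendsto_const])
         (simp add: filterlim_at_top_imp_at_infinity filterlim_ident)
    then have "\<forall>\<^sub>F T in at_top. q / 2 + q * (1 / (4 * l)) / T < r"
      by (rule order_tendstoD) (use r lq(3) in \<open>simp add: field_simps\<close>)
    then show "\<forall>\<^sub>F T in at_top. observability_constant M lam \<phi> T \<omega> / T < r"
      using eventually_ge_at_top[of C]
    proof eventually_elim
      case (elim T)
      have "0 < T" using elim(2) \<open>0 < C\<close> by simp
      have "Inf (Js T) \<le> q * (T / 2 + sin (2 * l * T) / (4 * l))"
        using lq(4) \<open>0 < T\<close> by (intro cInf_lower bdd elim) auto
      also have "\<dots> \<le> q * (T / 2 + 1 / (4 * l))"
        using lq(1,2) by (intro mult_left_mono add_left_mono divide_right_mono) auto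
      finally have "Inf (Js T) / T \<le> q * (T / 2 + 1 / (4 * l)) / T"
        using \<open>0 < T\<close> by (intro divide_right_mono) auto
      also have "\<dots> = q / 2 + q * (1 / (4 * l)) / T" using \<open>0 < T\<close> by (simp add: field_simps)
      finally show ?case using elim(1) obs by simp
    qed
  qed
qed


section \<open>Calculus of functions of class \<open>C\<^sup>k\<close>\<close>

lemma Ck_on_cong:
  assumes "open S" "\<And>x. x \<in> S \<Longrightarrow> f x = h x" "Ck_on k f S"
  shows "Ck_on k h S"
  using assms(2,3)
proof (induction k arbitrary: f h)
  case 0
  then show ?case using continuous_on_cong[of S S f h] by simp
next
  case (Suc k)
  have diff: "h differentiable (at x)" "frechet_derivative h (at x) = frechet_derivative f (at x)"
    if "x \<in> S" for x
  proof -
    have f: "(f has_derivative frechet_derivative f (at x)) (at x)"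
      using Suc.prems that by (simp add: frechet_derivative_works)
    have "(h has_derivative frechet_derivative f (at x)) (at x)"
      by (rule has_derivative_transform_within_open[OF f assms(1) that]) (rule Suc.prems)
    then show "h differentiable (at x)" "frechet_derivative h (at x) = frechet_derivative f (at x)"
      using frechet_derivative_at[of h "frechet_derivative f (at x)" x]
      by (auto simp: differentiable_def)
  qed
  have "Ck_on k (\<lambda>x. frechet_derivative h (at x) v) S" for v
    by (rule Suc.IH[of "\<lambda>x. frechet_derivative f (at x) v"]) (use diff Suc.prems in auto)
  then show ?case using diff by simp
qed

lemma Ck_on_SucI:
  assumes "open S" "\<And>x. x \<in> S \<Longrightarrow> (f has_derivative f' x) (at x)" "\<And>v. Ck_on k (\<lambda>x. f' x v) S"
  shows "Ck_on (Suc k) f S"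
proof -
  have "frechet_derivative f (at x) = f' x" if "x \<in> S" for x
    using frechet_derivative_at[OF assms(2)[OF that]] by simp
  then have "Ck_on k (\<lambda>x. frechet_derivative f (at x) v) S" for v
    by (intro Ck_on_cong[OF assms(1) _ assms(3)]) auto
  then show ?thesis using assms(2) by (auto simp: differentiable_def)
qed

lemma Ck_on_SucD:
  assumes "Ck_on (Suc k) f S"
  shows "x \<in> S \<Longrightarrow> (f has_derivative frechet_derivative f (at x)) (at x)"
    and "Ck_on k (\<lambda>x. frechet_derivative f (at x) v) S"
  using assms by (auto simp: frechet_derivative_works [symmetric])

lemma Ck_on_Suc_imp: "Ck_on (Suc k) f S \<Longrightarrow> Ck_on k f S"
proof (induction k arbitrary: f)
  case 0
  then show ?case
    by (auto intro!: continuous_at_imp_continuous_on differentiable_imp_continuous_within)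
qed (simp only: Ck_on.simps(2), blast)

lemma Ck_on_subset: "Ck_on k f S \<Longrightarrow> T \<subseteq> S \<Longrightarrow> Ck_on k f T"
  by (induction k arbitrary: f) (auto intro: continuous_on_subset)

text \<open>The property \<open>Ck_on k\<close> is local.\<close>

lemma Ck_on_locally:
  assumes "\<And>x. x \<in> S \<Longrightarrow> \<exists>T. open T \<and> x \<in> T \<and> Ck_on k f T"
  shows "Ck_on k f S"
  using assms
proof (induction k arbitrary: f)
  case 0
  have "isCont f x" if "x \<in> S" for x
    using 0[OF that] by (auto simp: continuous_on_eq_continuous_at)
  then show ?case by (simp add: continuous_at_imp_continuous_on)
next
  case (Suc k)
  have "f differentiable (at x)" if "x \<in> S" for x using Suc.prems[OF that] by auto
  moreover have "Ck_on k (\<lambda>x. frechet_derivative f (at x) v) S" for v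
  proof (rule Suc.IH)
    fix x assume "x \<in> S"
    then obtain T where "open T" "x \<in> T" "Ck_on (Suc k) f T" using Suc.prems by blast
    then show "\<exists>T. open T \<and> x \<in> T \<and> Ck_on k (\<lambda>x. frechet_derivative f (at x) v) T" by auto
  qed
  ultimately show ?case by simp
qed

lemma Ck_on_const: "Ck_on k (\<lambda>x. c) S"
  by (induction k arbitrary: c) auto

lemma Ck_on_add:
  assumes "open S" "Ck_on k f S" "Ck_on k h S"
  shows "Ck_on k (\<lambda>x. f x + h x) S"
  using assms(2,3)
proof (induction k arbitrary: f h)
  case (Suc k)
  show ?case
    by (rule Ck_on_SucI[OF assms(1)],
        rule has_derivative_add[OF Ck_on_SucD(1)[OF Suc.prems(1)] Ck_on_SucD(1)[OF Suc.prems(2)]])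
       (auto intro: Suc.IH[OF Ck_on_SucD(2) Ck_on_SucD(2)] Suc.prems)
qed (auto intro: continuous_intros)

lemma Ck_on_sum:
  assumes "open S" "\<And>i. i \<in> I \<Longrightarrow> Ck_on k (f i) S"
  shows "Ck_on k (\<lambda>x. \<Sum>i\<in>I. f i x) S"
  using assms(2)
  by (induction I rule: infinite_finite_induct) (auto intro: Ck_on_const Ck_on_add[OF assms(1)])

lemma Ck_on_bounded_linear:
  assumes "bounded_linear L" "open S" "Ck_on k f S"
  shows "Ck_on k (\<lambda>x. L (f x)) S"
  using assms(3)
proof (induction k arbitrary: f)
  case 0
  then show ?case using assms(1) by (auto intro: bounded_linear.continuous_on)
next
  case (Suc k)
  show ?case
    by (rule Ck_on_SucI[OF assms(2)],
        rule bounded_linear.has_derivative[OF assms(1) Ck_on_SucD(1)[OF Suc.prems]])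
       (auto intro: Suc.IH[OF Ck_on_SucD(2)] Suc.prems)
qed

lemma Ck_on_bounded_bilinear:
  assumes "bounded_bilinear B" "open S" "Ck_on k f S" "Ck_on k h S"
  shows "Ck_on k (\<lambda>x. B (f x) (h x)) S"
  using assms(3,4)
proof (induction k arbitrary: f h)
  case 0
  then show ?case using assms(1) by (auto intro: bounded_bilinear.continuous_on)
next
  case (Suc k)
  show ?case
  proof (rule Ck_on_SucI[OF assms(2)])
    show "((\<lambda>x. B (f x) (h x)) has_derivative (\<lambda>v. B (f x) (frechet_derivative h (at x) v) +
        B (frechet_derivative f (at x) v) (h x))) (at x)" if "x \<in> S" for x
      by (rule bounded_bilinear.FDERIV[OF assms(1) Ck_on_SucD(1)[OF Suc.prems(1) that]
            Ck_on_SucD(1)[OF Suc.prems(2) that]])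
    show "Ck_on k (\<lambda>x. B (f x) (frechet_derivative h (at x) v) +
        B (frechet_derivative f (at x) v) (h x)) S" for v
      by (intro Ck_on_add[OF assms(2)] Suc.IH Ck_on_SucD(2) Suc.prems Ck_on_Suc_imp)
  qed
qed

lemmas Ck_on_mult = Ck_on_bounded_bilinear[OF bounded_bilinear_mult]
lemmas Ck_on_scaleR = Ck_on_bounded_bilinear[OF bounded_bilinear_scaleR]

lemma Ck_on_prod:
  fixes f :: "'i \<Rightarrow> 'a::real_normed_vector \<Rightarrow> real"
  assumes "open S" "\<And>i. i \<in> I \<Longrightarrow> Ck_on k (f i) S"
  shows "Ck_on k (\<lambda>x. \<Prod>i\<in>I. f i x) S"
  using assms(2)
  by (induction I rule: infinite_finite_induct) (auto intro: Ck_on_const Ck_on_mult[OF assms(1)])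

text \<open>Real powers cover both square roots and reciprocals of positive functions, and the derivative
  of a power again involves a power, which the induction on \<open>k\<close> needs.\<close>

lemma Ck_on_powr:
  fixes f :: "'a::real_normed_vector \<Rightarrow> real"
  assumes "open S" "Ck_on k f S" "\<And>x. x \<in> S \<Longrightarrow> 0 < f x"
  shows "Ck_on k (\<lambda>x. f x powr a) S"
  using assms(2)
proof (induction k arbitrary: a)
  case 0
  then show ?case using assms(3) by (auto intro!: continuous_intros simp: less_imp_neq[THEN not_sym])
next
  case (Suc k)
  show ?case
  proof (rule Ck_on_SucI[OF assms(1)])
    fix x assume x: "x \<in> S"
    have "((\<lambda>x. f x powr a) has_derivative (\<lambda>v. f x powr a *
        (0 * ln (f x) + frechet_derivative f (at x) v * a / f x))) (at x)"
      by (rule has_derivative_powr[OF Ck_on_SucD(1)[OF Suc.prems x] has_derivative_const])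
         (use assms(3)[OF x] in auto)
    moreover have "f x powr a * (0 * ln (f x) + y * a / f x) = a * (f x powr (a - 1) * y)" for y
      using assms(3)[OF x] by (simp add: powr_diff)
    ultimately show "((\<lambda>x. f x powr a) has_derivative (\<lambda>v. a * (f x powr (a - 1) *
        frechet_derivative f (at x) v))) (at x)" by simp
  next
    show "Ck_on k (\<lambda>x. a * (f x powr (a - 1) * frechet_derivative f (at x) v)) S" for v
      by (intro Ck_on_mult[OF assms(1)] Ck_on_const Suc.IH Ck_on_Suc_imp[OF Suc.prems]
          Ck_on_SucD(2)[OF Suc.prems])
  qed
qed

text \<open>First order is all that is needed for changes of coordinates.\<close>

lemma C1_on_compose:
  fixes \<tau> :: "'a::real_normed_vector \<Rightarrow> 'b::euclidean_space"
  assumes "open S" "open T" "Ck_on 1 \<tau> S" "Ck_on 1 f T" "\<tau> ` S \<subseteq> T"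
  shows "Ck_on 1 (f \<circ> \<tau>) S"
  unfolding One_nat_def
proof (rule Ck_on_SucI[OF assms(1)])
  note \<tau> = Ck_on_SucD[OF assms(3)[unfolded One_nat_def]] and f = Ck_on_SucD[OF assms(4)[unfolded One_nat_def]]
  show "((f \<circ> \<tau>) has_derivative
      (frechet_derivative f (at (\<tau> x)) \<circ> frechet_derivative \<tau> (at x))) (at x)" if "x \<in> S" for x
    using that assms(5) by (intro diff_chain_at \<tau> f) auto
  show "Ck_on 0 (\<lambda>x. (frechet_derivative f (at (\<tau> x)) \<circ> frechet_derivative \<tau> (at x)) v) S" for v
  proof -
    \<comment> \<open>Expanding in a basis reduces continuity to derivatives of \<open>f\<close> in fixed directions.\<close>
    have eq: "(\<Sum>b\<in>Basis. (frechet_derivative \<tau> (at x) v \<bullet> b) *\<^sub>R frechet_derivative f (at (\<tau> x)) b)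
        = (frechet_derivative f (at (\<tau> x)) \<circ> frechet_derivative \<tau> (at x)) v" if "x \<in> S" for x
    proof -
      have lin: "linear (frechet_derivative f (at (\<tau> x)))"
        using f(1)[of "\<tau> x"] assms(5) that has_derivative_linear by blast
      have "frechet_derivative f (at (\<tau> x)) (frechet_derivative \<tau> (at x) v)
          = frechet_derivative f (at (\<tau> x)) (\<Sum>b\<in>Basis. (frechet_derivative \<tau> (at x) v \<bullet> b) *\<^sub>R b)"
        by (simp add: euclidean_representation)
      also have "\<dots> = (\<Sum>b\<in>Basis. (frechet_derivative \<tau> (at x) v \<bullet> b) *\<^sub>R frechet_derivative f (at (\<tau> x)) b)"
        by (simp add: linear_sum[OF lin] linear_scale[OF lin])
      finally show ?thesis by simp
    qed
    have \<tau>c: "continuous_on S \<tau>" using Ck_on_Suc_imp[of 0 \<tau> S] assms(3) by simp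
    have "continuous_on T (\<lambda>y. frechet_derivative f (at y) b)" for b using f(2)[of b] by simp
    then have "continuous_on S (\<lambda>x. frechet_derivative f (at (\<tau> x)) b)" for b
      using \<tau>c assms(5) by (rule continuous_on_compose2)
    moreover have "continuous_on S (\<lambda>x. frechet_derivative \<tau> (at x) v)" using \<tau>(2)[of v] by simp
    ultimately have C0: "Ck_on 0 (\<lambda>x. \<Sum>b\<in>Basis. (frechet_derivative \<tau> (at x) v \<bullet> b) *\<^sub>R
        frechet_derivative f (at (\<tau> x)) b) S"
      by (auto intro!: continuous_intros)
    show ?thesis by (rule Ck_on_cong[OF assms(1) _ C0]) (rule eq)
  qed
qed

lemma Ck_on_det:
  fixes G :: "'a::real_normed_vector \<Rightarrow> real^'n^'n"
  assumes "open S" "\<And>i j. Ck_on k (\<lambda>x. G x $ i $ j) S"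
  shows "Ck_on k (\<lambda>x. det (G x)) S"
  unfolding det_def
  by (intro Ck_on_sum Ck_on_mult Ck_on_prod Ck_on_const assms)

lemma matrix_inv_inverse:
  assumes "invertible A" shows "A ** matrix_inv A = mat 1" "matrix_inv A ** A = mat 1"
  using someI_ex[OF assms[unfolded invertible_def]] by (auto simp: matrix_inv_def)

text \<open>Cramer's rule shows that the entries of the inverse matrix are as smooth as those of the
  matrix.\<close>

lemma matrix_inv_eq_det:
  fixes A :: "real^'n^'n"
  assumes "det A \<noteq> 0"
  shows "matrix_inv A $ i $ j = det (\<chi> r c. if c = i then axis j 1 $ r else A $ r $ c) / det A"
proof -
  have "A *v (matrix_inv A *v axis j 1) = axis j 1"
    using assms by (simp add: matrix_vector_mul_assoc matrix_inv_inverse invertible_det_nz)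
  then have "matrix_inv A *v axis j 1
      = (\<chi> k. det (\<chi> r c. if c = k then axis j 1 $ r else A $ r $ c) / det A)"
    using cramer[OF assms] by blast
  moreover have "matrix_inv A $ i $ j = (matrix_inv A *v axis j 1) $ i"
    by (simp add: matrix_vector_mul_component inner_axis)
  ultimately show ?thesis by simp
qed

lemma Ck_on_matrix_inv:
  fixes G :: "'a::real_normed_vector \<Rightarrow> real^'n^'n"
  assumes "open S" "\<And>i j. Ck_on k (\<lambda>x. G x $ i $ j) S" "\<And>x. x \<in> S \<Longrightarrow> 0 < det (G x)"
  shows "Ck_on k (\<lambda>x. matrix_inv (G x) $ i $ j) S"
proof (rule Ck_on_cong[OF assms(1)])
  show "det (\<chi> r c. if c = i then axis j 1 $ r else G x $ r $ c) * det (G x) powr (-1)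
      = matrix_inv (G x) $ i $ j" if "x \<in> S" for x
    using assms(3)[OF that] by (simp add: matrix_inv_eq_det powr_minus_divide)
  have "Ck_on k (\<lambda>x. (\<chi> r c. if c = i then axis j 1 $ r else G x $ r $ c) $ a $ b) S" for a b
    using assms(2) by (cases "b = i") (auto intro: Ck_on_const)
  then show "Ck_on k (\<lambda>x. det (\<chi> r c. if c = i then axis j 1 $ r else G x $ r $ c) *
      det (G x) powr (-1)) S"
    by (intro Ck_on_mult Ck_on_powr Ck_on_det assms)
qed

text \<open>On the segment from the identity to \<open>G\<close> all matrices are positive definite, so the
  determinant has no zero there and keeps the sign of \<open>det (mat 1) = 1\<close>.\<close>

lemma posdef_det_pos:
  fixes G :: "real^'n^'n"
  assumes "\<And>v. v \<noteq> 0 \<Longrightarrow> v \<bullet> (G *v v) > 0"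
  shows "0 < det G"
proof -
  define H where "H = (\<lambda>t::real. (1 - t) *\<^sub>R mat 1 + t *\<^sub>R G)"
  have nz: "det (H t) \<noteq> 0" if "t \<in> {0..1}" for t
  proof -
    have "v = 0" if v: "H t *v v = 0" for v
    proof (rule ccontr)
      assume "v \<noteq> 0"
      have "v \<bullet> (H t *v v) = (1 - t) * (v \<bullet> v) + t * (v \<bullet> (G *v v))"
        by (simp add: H_def matrix_vector_mult_add_rdistrib scaleR_matrix_vector_assoc [symmetric]
            inner_add_right)
      moreover have "0 < v \<bullet> v" "0 < v \<bullet> (G *v v)" using \<open>v \<noteq> 0\<close> assms by auto
      moreover have "0 < (1 - t) * p + t * q" if "0 < p" "0 < q" for p q :: real
        using that \<open>t \<in> {0..1}\<close> by (cases "t = 0") (auto intro: add_nonneg_pos)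
      ultimately show False using v by fastforce
    qed
    then have "inj ((*v) (H t))"
      by (simp add: linear_injective_0)
    then show ?thesis
      by (simp flip: invertible_det_nz add: invertible_left_inverse matrix_left_invertible_injective)
  qed
  have cont: "continuous_on {0..1} (\<lambda>t. det (H t))"
    unfolding H_def det_def by (intro continuous_intros)
  show ?thesis
  proof (rule ccontr)
    assume "\<not> 0 < det G"
    then have "det (H 1) \<le> 0" "0 \<le> det (H 0)" by (auto simp: H_def)
    then obtain t where "0 \<le> t" "t \<le> 1" "det (H t) = 0"
      using IVT2'[of "\<lambda>t. det (H t)" 1 0 0] cont by auto
    then show False using nz by auto
  qed
qed

text \<open>The integral of a directional derivative of a compactly supported function vanishes: the
  integrals of the difference quotients vanish by translation invariance.\<close>

lemma integral_directional_derivative_eq_0: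
  fixes f :: "'a::euclidean_space \<Rightarrow> 'b::euclidean_space"
  assumes C1: "Ck_on 1 f UNIV" and K: "compact K" and supp: "\<And>x. x \<notin> K \<Longrightarrow> f x = 0"
  shows "(\<integral>x. frechet_derivative f (at x) e \<partial>lborel) = 0"
    and "integrable lborel (\<lambda>x. frechet_derivative f (at x) e)"
proof -
  define F where "F = (\<lambda>x. frechet_derivative f (at x) e)"
  have deriv: "(f has_derivative frechet_derivative f (at x)) (at x)" for x
    using Ck_on_SucD(1)[of 0 f UNIV] C1 by simp
  have contF: "continuous_on UNIV F" using Ck_on_SucD(2)[of 0 f UNIV] C1 by (simp add: F_def)
  have contf: "continuous_on UNIV f" using Ck_on_Suc_imp[of 0 f UNIV] C1 by simp
  have F0: "F x = 0" if "x \<notin> K" for x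
  proof -
    have "((\<lambda>x. 0) has_derivative frechet_derivative f (at x)) (at x)"
      by (rule has_derivative_transform_within_open[OF deriv, of "- K"])
         (use K supp that in \<open>auto simp: compact_imp_closed open_Compl\<close>)
    then have "frechet_derivative f (at x) = (\<lambda>v. 0)"
      using has_derivative_unique[OF _ has_derivative_const] by blast
    then show ?thesis by (simp add: F_def)
  qed
  obtain R where R: "\<And>x. x \<in> K \<Longrightarrow> norm x \<le> R" using compact_imp_bounded[OF K] by (auto simp: bounded_iff)
  have "compact (F ` K)" using contF K by (meson compact_continuous_image continuous_on_subset subset_UNIV)
  then obtain B0 where B0: "\<And>x. x \<in> K \<Longrightarrow> norm (F x) \<le> B0"
    using compact_imp_bounded[of "F ` K"] by (auto simp: bounded_iff)
  define B where "B = max B0 0"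
  have B: "norm (F x) \<le> B" for x using B0[of x] F0[of x] by (cases "x \<in> K") (auto simp: B_def)
  have B_nn: "0 \<le> B" by (simp add: B_def)
  define h where "h = (\<lambda>n::nat. 1 / (real n + 1))"
  have h: "0 < h n" "h n \<le> 1" for n by (auto simp: h_def)
  have h0: "h \<longlonglongrightarrow> 0" unfolding h_def using LIMSEQ_inverse_real_of_nat by (simp add: inverse_eq_divide add.commute)
  define q where "q = (\<lambda>n x. (1 / h n) *\<^sub>R (f (x + h n *\<^sub>R e) - f x))"
  define K' where "K' = cball (0::'a) (R + norm e)"
  have line: "((\<lambda>t. f (x + t *\<^sub>R e)) has_vector_derivative F (x + t *\<^sub>R e)) (at t)" for x t
  proof -
    have "((\<lambda>t. x + t *\<^sub>R e) has_derivative (\<lambda>t. t *\<^sub>R e)) (at t)"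
      by (auto intro!: derivative_eq_intros)
    from diff_chain_at[OF this deriv] show ?thesis
      unfolding has_vector_derivative_def comp_def F_def
      by (simp add: linear_scale[OF has_derivative_linear[OF deriv]])
  qed
  have q_bound: "norm (q n x) \<le> indicator K' x * B" for n x
  proof (cases "x \<in> K'")
    case True
    have "norm (f (x + h n *\<^sub>R e) - f (x + 0 *\<^sub>R e)) \<le> B * norm (h n - 0)"
    proof (rule differentiable_bound[of UNIV])
      show "((\<lambda>t. f (x + t *\<^sub>R e)) has_derivative (\<lambda>s. s *\<^sub>R F (x + t *\<^sub>R e))) (at t within UNIV)" for t
        using line by (simp add: has_vector_derivative_def)
      show "onorm (\<lambda>s. s *\<^sub>R F (x + t *\<^sub>R e)) \<le> B" for t
        by (rule onorm_le) (use B in \<open>simp add: mult.commute[of B] mult_left_mono\<close>)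
    qed auto
    then have "norm (f (x + h n *\<^sub>R e) - f x) / h n \<le> B" using h[of n] by (simp add: pos_divide_le_eq)
    then show ?thesis using True h[of n] unfolding q_def norm_scaleR by simp
  next
    case False
    then have x: "R + norm e < norm x" by (simp add: K'_def)
    have "norm (h n *\<^sub>R e) \<le> norm e" using h[of n] by (simp add: mult_left_le_one_le)
    then have "R < norm (x + h n *\<^sub>R e)" using norm_triangle_ineq2[of x "- (h n *\<^sub>R e)"] x by simp
    moreover have "R < norm x" using x norm_ge_zero[of e] by linarith
    ultimately have "f (x + h n *\<^sub>R e) = 0" "f x = 0" using supp R by (meson not_le)+
    then show ?thesis using B_nn by (simp add: q_def)
  qed
  have q_lim: "(\<lambda>n. q n x) \<longlonglongrightarrow> F x" for x
  proof -
    have lim: "((\<lambda>t. norm (f (x + t *\<^sub>R e) - f x - t *\<^sub>R F x) / norm t) \<longlongrightarrow> 0) (at 0)"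
      using line[of x 0] unfolding has_vector_derivative_def has_derivative_at by simp
    have eq: "norm (f (x + t *\<^sub>R e) - f x - t *\<^sub>R F x) / norm t
        = norm ((1 / t) *\<^sub>R (f (x + t *\<^sub>R e) - f x) - F x)" if "t \<noteq> 0" for t
    proof -
      have "(1 / t) *\<^sub>R (f (x + t *\<^sub>R e) - f x) - F x = (1 / t) *\<^sub>R (f (x + t *\<^sub>R e) - f x - t *\<^sub>R F x)"
        using that by (simp add: scaleR_diff_right)
      then show ?thesis by simp
    qed
    have "((\<lambda>t. norm ((1 / t) *\<^sub>R (f (x + t *\<^sub>R e) - f x) - F x)) \<longlongrightarrow> 0) (at 0)"
      by (rule Lim_transform_eventually[OF lim]) (unfold eventually_at_filter, intro always_eventually allI impI, rule eq)
    then have "((\<lambda>t. (1 / t) *\<^sub>R (f (x + t *\<^sub>R e) - f x)) \<longlongrightarrow> F x) (at 0)"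
      by (simp add: tendsto_norm_zero_iff LIM_zero_iff)
    then show ?thesis unfolding q_def
      by (rule filterlim_compose) (use h0 h in \<open>auto simp: filterlim_at intro!: always_eventually less_imp_neq[THEN not_sym]\<close>)
  qed
  have [measurable]: "f \<in> borel_measurable borel" "F \<in> borel_measurable borel"
    by (intro borel_measurable_continuous_onI contf contF)+
  have dom: "integrable lborel (\<lambda>x. indicator K' x * B)"
    by (intro integrable_mult_left integrable_real_indicator)
       (use emeasure_bounded_finite[of K'] in \<open>auto simp: K'_def\<close>)
  have f_int: "integrable lborel f"
  proof -
    have "continuous_on K f" using contf continuous_on_subset by blast
    then have "integrable lborel (\<lambda>x. indicator K x *\<^sub>R f x)"
      using borel_integrable_compact[OF K] by blast
    moreover have "(\<lambda>x. indicator K x *\<^sub>R f x) = f" using supp by (auto simp: indicator_def)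
    ultimately show ?thesis by simp
  qed
  have shift: "integrable lborel (\<lambda>x. f (x + c))" "(\<integral>x. f (x + c) \<partial>lborel) = (\<integral>x. f x \<partial>lborel)" for c
  proof -
    have "integrable (distr lborel borel ((+) c)) f" using f_int by (simp add: lborel_distr_plus)
    then show "integrable lborel (\<lambda>x. f (x + c))"
      by (subst (asm) integrable_distr_eq) (auto simp: add.commute)
    have "(\<integral>x. f x \<partial>lborel) = (\<integral>x. f x \<partial>distr lborel borel ((+) c))" by (simp add: lborel_distr_plus)
    also have "\<dots> = (\<integral>x. f (x + c) \<partial>lborel)" by (subst integral_distr) (auto simp: add.commute)
    finally show "(\<integral>x. f (x + c) \<partial>lborel) = (\<integral>x. f x \<partial>lborel)" ..
  qed
  have q_int: "(\<integral>x. q n x \<partial>lborel) = 0" for n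
    unfolding q_def using shift f_int by simp
  have [measurable]: "q n \<in> borel_measurable borel" for n unfolding q_def by measurable
  have "(\<lambda>n. \<integral>x. q n x \<partial>lborel) \<longlonglongrightarrow> (\<integral>x. F x \<partial>lborel)"
    by (rule integral_dominated_convergence[OF _ _ dom]) (use q_lim q_bound in auto)
  then show "(\<integral>x. frechet_derivative f (at x) e \<partial>lborel) = 0"
    using q_int by (simp add: LIMSEQ_const_iff F_def)
  show "integrable lborel (\<lambda>x. frechet_derivative f (at x) e)"
    unfolding F_def [symmetric]
    by (rule integrable_dominated_convergence[OF _ _ dom, of _ q]) (use q_lim q_bound in auto)
qed


section \<open>Charts, gradients and the Riemannian volume\<close>

locale riemannian_manifold =
  fixes A :: "('m::t2_space, 'n::finite) chart set"
    and g :: "('m, 'n) metric_field"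
    and v :: "'m measure"
  assumes manifold: "compact_connected_riemannian_manifold A g"
    and volume: "riemannian_volume A g v"
begin

lemma compact_UNIV: "compact (UNIV :: 'm set)"
  using manifold by (simp add: compact_connected_riemannian_manifold_def)

lemma in_some_chart: "\<exists>C\<in>A. p \<in> fst C"
  using manifold unfolding compact_connected_riemannian_manifold_def smooth_atlas_def by blast

lemma
  assumes "C \<in> A"
  shows open_chart_domain: "open (fst C)" and open_chart_image: "open (chart_image C)"
    and homeomorphism_chart: "homeomorphism (fst C) (chart_image C) (snd C) (chart_inv C)"
  using assms manifold unfolding compact_connected_riemannian_manifold_def smooth_atlas_def by auto

lemma
  assumes "C \<in> A"
  shows chart_inv_chart [simp]: "p \<in> fst C \<Longrightarrow> chart_inv C (snd C p) = p"
    and chart_chart_inv [simp]: "x \<in> chart_image C \<Longrightarrow> snd C (chart_inv C x) = x"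
    and chart_in_image: "p \<in> fst C \<Longrightarrow> snd C p \<in> chart_image C"
    and chart_inv_in_domain: "x \<in> chart_image C \<Longrightarrow> chart_inv C x \<in> fst C"
    and continuous_on_chart: "continuous_on (fst C) (snd C)"
    and continuous_on_chart_inv: "continuous_on (chart_image C) (chart_inv C)"
  using homeomorphism_chart[OF assms] by (auto simp: homeomorphism_def)

lemma chart_image_subset_eq:
  assumes "C \<in> A" "W \<subseteq> fst C"
  shows "snd C ` W = chart_image C \<inter> chart_inv C -` W"
proof
  show "snd C ` W \<subseteq> chart_image C \<inter> chart_inv C -` W"
    using assms chart_in_image by fastforce
  show "chart_image C \<inter> chart_inv C -` W \<subseteq> snd C ` W"
    using chart_chart_inv[OF assms(1)] by (metis IntE image_eqI subsetI vimageE)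
qed

lemma open_chart_of_open:
  assumes "C \<in> A" "open W" shows "open (snd C ` (fst C \<inter> W))"
proof -
  have "open (fst C \<inter> W)" using open_chart_domain[OF assms(1)] assms(2) by blast
  then show ?thesis
    unfolding chart_image_subset_eq[OF assms(1) Int_lower1]
    by (rule continuous_open_preimage[OF continuous_on_chart_inv[OF assms(1)] open_chart_image[OF assms(1)]])
qed

lemma Ck_on_transition:
  assumes "C \<in> A" "D \<in> A"
  shows "Ck_on k (transition C D) (snd C ` (fst C \<inter> fst D))"
  using assms manifold
  unfolding compact_connected_riemannian_manifold_def smooth_atlas_def smooth_on_def by blast

lemma
  assumes "C \<in> A"
  shows smooth_metric: "smooth_on (g C) (chart_image C)"
    and metric_symmetric: "x \<in> chart_image C \<Longrightarrow> transpose (g C x) = g C x"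
    and metric_positive: "x \<in> chart_image C \<Longrightarrow> w \<noteq> 0 \<Longrightarrow> w \<bullet> (g C x *v w) > 0"
  using assms manifold
  unfolding compact_connected_riemannian_manifold_def riemannian_metric_def by auto

text \<open>The transformation law of the metric at a point of two charts.\<close>

lemma metric_transform:
  assumes "C \<in> A" "D \<in> A" "p \<in> fst C" "p \<in> fst D"
  defines "J \<equiv> matrix (frechet_derivative (transition C D) (at (snd C p)))"
  shows "g C (snd C p) = transpose J ** g D (snd D p) ** J"
proof -
  have "transition C D (snd C p) = snd D p" using assms by (simp add: transition_def)
  moreover have "snd C p \<in> snd C ` (fst C \<inter> fst D)" using assms by auto
  ultimately show ?thesis
    using assms(1,2) manifold
    unfolding compact_connected_riemannian_manifold_def riemannian_metric_def J_def Let_def by metis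
qed

lemma det_metric_pos: "C \<in> A \<Longrightarrow> x \<in> chart_image C \<Longrightarrow> 0 < det (g C x)"
  by (intro posdef_det_pos metric_positive)

lemma invertible_metric: "C \<in> A \<Longrightarrow> x \<in> chart_image C \<Longrightarrow> invertible (g C x)"
  using det_metric_pos by (simp add: invertible_det_nz less_imp_neq[THEN not_sym])

lemma Ck_on_metric:
  assumes "C \<in> A" shows "Ck_on k (\<lambda>x. g C x $ i $ j) (chart_image C)"
proof -
  have "Ck_on k (g C) (chart_image C)" using smooth_metric[OF assms] by (simp add: smooth_on_def)
  then have "Ck_on k (\<lambda>x. g C x $ i) (chart_image C)"
    by (rule Ck_on_bounded_linear[OF bounded_linear_vec_nth open_chart_image[OF assms]])
  then show ?thesis
    by (rule Ck_on_bounded_linear[OF bounded_linear_vec_nth open_chart_image[OF assms]])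
qed

lemma Ck_on_density:
  assumes "C \<in> A" shows "Ck_on k (\<lambda>x. sqrt (det (g C x))) (chart_image C)"
proof (rule Ck_on_cong[OF open_chart_image[OF assms]])
  show "Ck_on k (\<lambda>x. det (g C x) powr (1 / 2)) (chart_image C)"
    by (intro Ck_on_powr Ck_on_det Ck_on_metric open_chart_image det_metric_pos assms)
  show "det (g C x) powr (1 / 2) = sqrt (det (g C x))" if "x \<in> chart_image C" for x
    using det_metric_pos[OF assms that] by (simp add: powr_half_sqrt)
qed

lemma continuous_on_density:
  "C \<in> A \<Longrightarrow> continuous_on (chart_image C) (\<lambda>x. sqrt (det (g C x)))"
  using Ck_on_density[of C 0] by simp

lemma Ck_on_metric_inv:
  "C \<in> A \<Longrightarrow> Ck_on k (\<lambda>x. matrix_inv (g C x) $ i $ j) (chart_image C)"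
  by (intro Ck_on_matrix_inv Ck_on_metric open_chart_image det_metric_pos)

lemma metric_inv_symmetric:
  assumes "C \<in> A" "x \<in> chart_image C"
  shows "matrix_inv (g C x) $ i $ j = matrix_inv (g C x) $ j $ i"
proof -
  let ?G = "g C x" and ?I = "matrix_inv (g C x)"
  note inv = matrix_inv_inverse[OF invertible_metric[OF assms]]
  have "transpose ?I ** ?G = mat 1"
    using inv(1) metric_symmetric[OF assms] matrix_transpose_mul[of ?G ?I] by (simp add: transpose_mat)
  then have "transpose ?I = ?I"
    using inv(1) by (metis matrix_mul_assoc matrix_mul_lid matrix_mul_rid)
  then have "transpose ?I $ j $ i = ?I $ j $ i" by simp
  then show ?thesis by (simp add: transpose_def)
qed

text \<open>Functions of class \<open>C\<^sup>1\<close> on the manifold: their expressions in all charts of the atlas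
  are of class \<open>C\<^sup>1\<close>.\<close>

definition C1 :: "('m \<Rightarrow> 'b::real_normed_vector) \<Rightarrow> bool" where
  "C1 f \<longleftrightarrow> (\<forall>C\<in>A. Ck_on 1 (f \<circ> chart_inv C) (chart_image C))"

lemma C1_D: "C1 f \<Longrightarrow> C \<in> A \<Longrightarrow> Ck_on 1 (f \<circ> chart_inv C) (chart_image C)"
  by (simp add: C1_def)

lemma C1_has_derivative:
  "C1 f \<Longrightarrow> C \<in> A \<Longrightarrow> x \<in> chart_image C \<Longrightarrow>
    (f \<circ> chart_inv C has_derivative frechet_derivative (f \<circ> chart_inv C) (at x)) (at x)"
  using Ck_on_SucD(1)[of 0 "f \<circ> chart_inv C" "chart_image C" x] C1_D[of f C]
  unfolding One_nat_def by blast

lemma smooth_function_C1: "smooth_function A u \<Longrightarrow> C1 u"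
  unfolding smooth_function_def smooth_on_def C1_def by blast

lemma continuous_on_by_charts:
  assumes "\<And>C. C \<in> A \<Longrightarrow> continuous_on (chart_image C) (f \<circ> chart_inv C)"
  shows "continuous_on UNIV f"
proof -
  have "isCont f p" for p
  proof -
    obtain C where C: "C \<in> A" "p \<in> fst C" using in_some_chart by blast
    have "continuous_on (fst C) ((f \<circ> chart_inv C) \<circ> snd C)"
      using continuous_on_compose[OF continuous_on_chart[OF C(1)]] assms[OF C(1)]
      by (metis chart_image_def)
    then have "continuous_on (fst C) f"
      by (rule continuous_on_cong[THEN iffD1, OF refl, rotated]) (simp add: C)
    then show ?thesis using C open_chart_domain by (simp add: continuous_on_eq_continuous_at)
  qed
  then show ?thesis by (simp add: continuous_at_imp_continuous_on)
qed

lemma C1_continuous_on: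
  assumes "C1 f" shows "continuous_on UNIV f"
proof (rule continuous_on_by_charts)
  fix C assume "C \<in> A"
  then have "Ck_on (Suc 0) (f \<circ> chart_inv C) (chart_image C)"
    using C1_D[OF assms] unfolding One_nat_def by blast
  from Ck_on_Suc_imp[OF this] show "continuous_on (chart_image C) (f \<circ> chart_inv C)"
    unfolding Ck_on.simps(1) .
qed

lemma C1_I: "(\<And>C. C \<in> A \<Longrightarrow> Ck_on 1 (\<lambda>x. f (chart_inv C x)) (chart_image C)) \<Longrightarrow> C1 f"
  unfolding C1_def comp_def by blast

lemma C1_chart: "C1 f \<Longrightarrow> C \<in> A \<Longrightarrow> Ck_on 1 (\<lambda>x. f (chart_inv C x)) (chart_image C)"
  unfolding C1_def comp_def by blast

lemma C1_sum: "(\<And>i. i \<in> I \<Longrightarrow> C1 (f i)) \<Longrightarrow> C1 (\<lambda>p. \<Sum>i\<in>I. f i p)"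
  by (rule C1_I, intro Ck_on_sum open_chart_image C1_chart)

lemma C1_scaleR: "C1 f \<Longrightarrow> C1 h \<Longrightarrow> C1 (\<lambda>p. f p *\<^sub>R h p)"
  by (rule C1_I, intro Ck_on_scaleR open_chart_image C1_chart)

lemma C1_mult:
  fixes f :: "'m \<Rightarrow> 'b::real_normed_algebra"
  shows "C1 f \<Longrightarrow> C1 h \<Longrightarrow> C1 (\<lambda>p. f p * h p)"
  by (rule C1_I, intro Ck_on_mult open_chart_image C1_chart)

lemma C1_powr:
  fixes f :: "'m \<Rightarrow> real"
  assumes "C1 f" "\<And>p. 0 < f p" shows "C1 (\<lambda>p. f p powr a)"
proof (rule C1_I)
  fix C assume C: "C \<in> A"
  show "Ck_on 1 (\<lambda>x. f (chart_inv C x) powr a) (chart_image C)"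
    by (rule Ck_on_powr[OF open_chart_image[OF C] C1_chart[OF assms(1) C]]) (rule assms(2))
qed

text \<open>The inner product of gradients \<open>\<Sum>\<^sub>i\<^sub>j g\<^sup>i\<^sup>j \<partial>\<^sub>i f \<partial>\<^sub>j h\<close> in a given chart. It is
  bilinear, without complex conjugation.\<close>

definition chart_grad_inner ::
    "('m, 'n) chart \<Rightarrow> ('m \<Rightarrow> complex) \<Rightarrow> ('m \<Rightarrow> complex) \<Rightarrow> 'm \<Rightarrow> complex" where
  "chart_grad_inner C f h p = (\<Sum>i\<in>UNIV. \<Sum>j\<in>UNIV. (matrix_inv (g C (snd C p)) $ i $ j) *\<^sub>R
     (partial i (f \<circ> chart_inv C) (snd C p) * partial j (h \<circ> chart_inv C) (snd C p)))"

text \<open>The same in some chart around the point; the choice is irrelevant for functions of class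
  \<open>C\<^sup>1\<close>.\<close>

definition grad_inner :: "('m \<Rightarrow> complex) \<Rightarrow> ('m \<Rightarrow> complex) \<Rightarrow> 'm \<Rightarrow> complex" where
  "grad_inner f h p = chart_grad_inner (SOME C. C \<in> A \<and> p \<in> fst C) f h p"

text \<open>Chain rule for partial derivatives under a change of chart with Jacobian \<open>J\<close>.\<close>

lemma partial_transition:
  assumes "C1 f" "C \<in> A" "D \<in> A" "p \<in> fst C" "p \<in> fst D"
  defines "J \<equiv> matrix (frechet_derivative (transition C D) (at (snd C p)))"
  shows "partial i (f \<circ> chart_inv C) (snd C p)
    = (\<Sum>k\<in>UNIV. (J $ k $ i) *\<^sub>R partial k (f \<circ> chart_inv D) (snd D p))"
proof -
  let ?\<tau> = "transition C D" and ?x = "snd C p" and ?y = "snd D p"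
  let ?S = "snd C ` (fst C \<inter> fst D)"
  have x: "?x \<in> ?S" "?\<tau> ?x = ?y" using assms by (auto simp: transition_def)
  have openS: "open ?S" using assms by (simp add: open_chart_of_open open_chart_domain)
  have \<tau>: "(?\<tau> has_derivative frechet_derivative ?\<tau> (at ?x)) (at ?x)"
    using Ck_on_SucD(1)[OF Ck_on_transition[OF assms(2,3)] x(1)] .
  have fD: "(f \<circ> chart_inv D has_derivative frechet_derivative (f \<circ> chart_inv D) (at ?y)) (at ?y)"
    using assms by (intro C1_has_derivative chart_in_image)
  have "((f \<circ> chart_inv D) \<circ> ?\<tau> has_derivative
      (frechet_derivative (f \<circ> chart_inv D) (at ?y) \<circ> frechet_derivative ?\<tau> (at ?x))) (at ?x)"
    using \<tau> fD x(2) by (intro diff_chain_at) auto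
  then have "(f \<circ> chart_inv C has_derivative
      (frechet_derivative (f \<circ> chart_inv D) (at ?y) \<circ> frechet_derivative ?\<tau> (at ?x))) (at ?x)"
    by (rule has_derivative_transform_within_open[OF _ openS x(1)])
       (use assms in \<open>auto simp: transition_def\<close>)
  then have "partial i (f \<circ> chart_inv C) ?x
      = frechet_derivative (f \<circ> chart_inv D) (at ?y) (frechet_derivative ?\<tau> (at ?x) (axis i 1))"
    unfolding partial_def by (simp flip: frechet_derivative_at)
  also have "frechet_derivative ?\<tau> (at ?x) (axis i 1) = (\<Sum>k\<in>UNIV. (J $ k $ i) *\<^sub>R axis k 1)"
    by (simp add: J_def matrix_def basis_expansion flip: scalar_mult_eq_scaleR)
  also have "frechet_derivative (f \<circ> chart_inv D) (at ?y) \<dots>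
      = (\<Sum>k\<in>UNIV. (J $ k $ i) *\<^sub>R partial k (f \<circ> chart_inv D) ?y)"
    using has_derivative_linear[OF fD] by (simp add: linear_sum linear_scale partial_def)
  finally show ?thesis .
qed

text \<open>The inverse metric transforms contravariantly; invertibility of \<open>J\<close> is a consequence.\<close>

lemma matrix_inv_congruence:
  fixes G H J :: "real^'n^'n"
  assumes "invertible G" "invertible H" "G = transpose J ** H ** J"
  shows "J ** matrix_inv G ** transpose J = matrix_inv H"
proof -
  have "(matrix_inv G ** transpose J ** H) ** J = mat 1"
    using matrix_inv_inverse(2)[OF assms(1)] assms(3) by (simp add: matrix_mul_assoc)
  then have "J ** (matrix_inv G ** transpose J ** H) = mat 1"
    using matrix_left_right_inverse by blast
  then have "(J ** matrix_inv G ** transpose J) ** H = mat 1" by (simp add: matrix_mul_assoc)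
  then show ?thesis
    using matrix_inv_inverse(1)[OF assms(2)]
    by (metis matrix_mul_assoc matrix_mul_lid matrix_mul_rid)
qed

lemma chart_grad_inner_independent:
  assumes "C1 f" "C1 h" "C \<in> A" "D \<in> A" "p \<in> fst C" "p \<in> fst D"
  shows "chart_grad_inner C f h p = chart_grad_inner D f h p"
proof -
  define J where "J = matrix (frechet_derivative (transition C D) (at (snd C p)))"
  define X where "X = matrix_inv (g C (snd C p))"
  define F where "F = (\<lambda>k. partial k (f \<circ> chart_inv D) (snd D p))"
  define H where "H = (\<lambda>k. partial k (h \<circ> chart_inv D) (snd D p))"
  have inv: "matrix_inv (g D (snd D p)) = J ** X ** transpose J"
    unfolding X_def J_def using assms
    by (intro matrix_inv_congruence[symmetric] invertible_metric metric_transform chart_in_image)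
  have "chart_grad_inner C f h p = (\<Sum>i\<in>UNIV. \<Sum>j\<in>UNIV. X $ i $ j *\<^sub>R
      ((\<Sum>k\<in>UNIV. J $ k $ i *\<^sub>R F k) * (\<Sum>l\<in>UNIV. J $ l $ j *\<^sub>R H l)))"
    unfolding chart_grad_inner_def X_def J_def F_def H_def using assms
    by (simp add: partial_transition[of f C D] partial_transition[of h C D])
  also have "\<dots> = (\<Sum>i\<in>UNIV. \<Sum>j\<in>UNIV. \<Sum>k\<in>UNIV. \<Sum>l\<in>UNIV.
      (J $ k $ i * X $ i $ j * J $ l $ j) *\<^sub>R (F k * H l))"
  proof -
    have "x *\<^sub>R ((a *\<^sub>R y) * (b *\<^sub>R z)) = (a * x * b) *\<^sub>R (y * z)" for x a b and y z :: complex
      by (simp add: mult_ac)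
    then show ?thesis by (simp only: sum_product scaleR_sum_right)
  qed
  also have "\<dots> = (\<Sum>i\<in>UNIV. \<Sum>k\<in>UNIV. \<Sum>j\<in>UNIV. \<Sum>l\<in>UNIV.
      (J $ k $ i * X $ i $ j * J $ l $ j) *\<^sub>R (F k * H l))"
    by (rule sum.cong[OF refl], rule sum.swap)
  also have "\<dots> = (\<Sum>i\<in>UNIV. \<Sum>k\<in>UNIV. \<Sum>l\<in>UNIV. \<Sum>j\<in>UNIV.
      (J $ k $ i * X $ i $ j * J $ l $ j) *\<^sub>R (F k * H l))"
    by (rule sum.cong[OF refl], rule sum.cong[OF refl], rule sum.swap)
  also have "\<dots> = (\<Sum>k\<in>UNIV. \<Sum>i\<in>UNIV. \<Sum>l\<in>UNIV. \<Sum>j\<in>UNIV.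
      (J $ k $ i * X $ i $ j * J $ l $ j) *\<^sub>R (F k * H l))"
    by (rule sum.swap)
  also have "\<dots> = (\<Sum>k\<in>UNIV. \<Sum>l\<in>UNIV. \<Sum>i\<in>UNIV. \<Sum>j\<in>UNIV.
      (J $ k $ i * X $ i $ j * J $ l $ j) *\<^sub>R (F k * H l))"
    by (rule sum.cong[OF refl], rule sum.swap)
  also have "\<dots> = (\<Sum>k\<in>UNIV. \<Sum>l\<in>UNIV. \<Sum>j\<in>UNIV. \<Sum>i\<in>UNIV.
      (J $ k $ i * X $ i $ j * J $ l $ j) *\<^sub>R (F k * H l))"
    by (rule sum.cong[OF refl], rule sum.cong[OF refl], rule sum.swap)
  also have "\<dots> = chart_grad_inner D f h p"
  proof -
    have "(J ** X ** transpose J) $ k $ l = (\<Sum>j\<in>UNIV. \<Sum>i\<in>UNIV. J $ k $ i * X $ i $ j * J $ l $ j)" for k l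
      by (simp add: matrix_matrix_mult_def transpose_def sum_distrib_right)
    then show ?thesis unfolding chart_grad_inner_def inv F_def H_def by (simp only: scaleR_sum_left)
  qed
  finally show ?thesis .
qed

lemma grad_inner_eq:
  assumes "C1 f" "C1 h" "C \<in> A" "p \<in> fst C"
  shows "grad_inner f h p = chart_grad_inner C f h p"
proof -
  let ?D = "SOME C. C \<in> A \<and> p \<in> fst C"
  have "?D \<in> A \<and> p \<in> fst ?D" by (rule someI[of _ C]) (use assms in simp)
  then show ?thesis
    unfolding grad_inner_def using assms by (intro chart_grad_inner_independent) (elim conjE, assumption)+
qed

lemma grad_inner_commute:
  assumes "C1 f" "C1 h" shows "grad_inner f h p = grad_inner h f p"
proof -
  obtain C where C: "C \<in> A" "p \<in> fst C" using in_some_chart by blast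
  have "chart_grad_inner C f h p = chart_grad_inner C h f p"
    unfolding chart_grad_inner_def
    by (subst sum.swap) (simp add: metric_inv_symmetric[OF C(1) chart_in_image[OF C]] mult.commute)
  then show ?thesis using assms C by (simp add: grad_inner_eq)
qed

lemma grad_inner_sum_left:
  assumes "\<And>k. k \<in> I \<Longrightarrow> C1 (f k)" "C1 h"
  shows "grad_inner (\<lambda>p. \<Sum>k\<in>I. f k p) h p = (\<Sum>k\<in>I. grad_inner (f k) h p)"
proof -
  obtain C where C: "C \<in> A" "p \<in> fst C" using in_some_chart by blast
  have partial: "partial i ((\<lambda>p. \<Sum>k\<in>I. f k p) \<circ> chart_inv C) (snd C p)
      = (\<Sum>k\<in>I. partial i (f k \<circ> chart_inv C) (snd C p))" for i
  proof -
    have "((\<lambda>x. \<Sum>k\<in>I. (f k \<circ> chart_inv C) x) has_derivative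
        (\<lambda>w. \<Sum>k\<in>I. frechet_derivative (f k \<circ> chart_inv C) (at (snd C p)) w)) (at (snd C p))"
      using assms C by (intro has_derivative_sum C1_has_derivative chart_in_image)
    then show ?thesis
      unfolding partial_def comp_def by (simp flip: frechet_derivative_at)
  qed
  have "chart_grad_inner C (\<lambda>p. \<Sum>k\<in>I. f k p) h p = (\<Sum>i\<in>UNIV. \<Sum>j\<in>UNIV. \<Sum>k\<in>I.
      (matrix_inv (g C (snd C p)) $ i $ j) *\<^sub>R
      (partial i (f k \<circ> chart_inv C) (snd C p) * partial j (h \<circ> chart_inv C) (snd C p)))"
    unfolding chart_grad_inner_def partial by (simp add: sum_distrib_right scaleR_sum_right)
  also have "\<dots> = (\<Sum>i\<in>UNIV. \<Sum>k\<in>I. \<Sum>j\<in>UNIV. (matrix_inv (g C (snd C p)) $ i $ j) *\<^sub>R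
      (partial i (f k \<circ> chart_inv C) (snd C p) * partial j (h \<circ> chart_inv C) (snd C p)))"
    by (rule sum.cong[OF refl], rule sum.swap)
  also have "\<dots> = (\<Sum>k\<in>I. chart_grad_inner C (f k) h p)"
    unfolding chart_grad_inner_def by (rule sum.swap)
  finally show ?thesis using assms C by (simp add: grad_inner_eq C1_sum)
qed

text \<open>Off a closed set containing the support of \<open>f\<close>, every chart expression of \<open>f\<close> vanishes
  near the point.\<close>

lemma grad_inner_eq_0_outside:
  assumes "C1 f" "C1 h" "closed K" "p \<notin> K" "\<And>q. q \<notin> K \<Longrightarrow> f q = 0"
  shows "grad_inner f h p = 0"
proof -
  obtain C where C: "C \<in> A" "p \<in> fst C" using in_some_chart by blast
  have "((\<lambda>x. 0) has_derivative (\<lambda>x. 0)) (at (snd C p))" by (rule has_derivative_const)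
  then have "(f \<circ> chart_inv C has_derivative (\<lambda>x. 0)) (at (snd C p))"
    by (rule has_derivative_transform_within_open[of _ _ _ _ "snd C ` (fst C \<inter> - K)"])
       (use assms C in \<open>auto intro!: open_chart_of_open simp: open_Compl\<close>)
  then have "partial i (f \<circ> chart_inv C) (snd C p) = 0" for i
    unfolding partial_def by (simp flip: frechet_derivative_at)
  then show ?thesis using assms C by (simp add: grad_inner_eq chart_grad_inner_def)
qed

lemma sets_volume: "sets v = sets borel"
  using volume by (simp add: riemannian_volume_def)

lemma space_volume: "space v = UNIV"
  using sets_eq_imp_space_eq[OF sets_volume] by simp

lemma emeasure_volume_chart:
  assumes "C \<in> A" "B \<in> sets borel" "B \<subseteq> fst C"
  shows "emeasure v B = (\<integral>\<^sup>+x\<in>snd C ` B. ennreal (sqrt (det (g C x))) \<partial>lborel)"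
  using assms volume by (simp add: riemannian_volume_def)

text \<open>The image of the volume under a coordinate map has the density \<open>sqrt (det g)\<close>, hence integrals
  over the chart become Lebesgue integrals.\<close>

lemma distr_chart_volume:
  assumes C: "C \<in> A"
  shows "distr (restrict_space v (fst C)) borel (snd C)
    = density lborel (\<lambda>x. ennreal (indicator (chart_image C) x * sqrt (det (g C x))))"
proof (rule measure_eqI)
  fix E assume "E \<in> sets (distr (restrict_space v (fst C)) borel (snd C))"
  then have E: "E \<in> sets borel" by simp
  have dom: "fst C \<in> sets v" using open_chart_domain[OF C] by (simp add: sets_volume)
  have meas: "snd C \<in> restrict_space v (fst C) \<rightarrow>\<^sub>M borel"
    using borel_measurable_continuous_on_restrict[OF continuous_on_chart[OF C]]
    by (simp add: measurable_def sets_restrict_space space_restrict_space sets_volume space_volume)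
  have U: "chart_image C \<in> sets borel" using open_chart_image[OF C] by simp
  have dens: "(\<lambda>x. indicator (chart_image C) x * sqrt (det (g C x))) \<in> borel_measurable borel"
    using borel_measurable_continuous_on_indicator[OF U continuous_on_density[OF C]] by simp
  let ?B = "snd C -` E \<inter> fst C"
  have spc: "space (restrict_space v (fst C)) = fst C"
    by (simp add: space_restrict_space space_volume)
  have B: "?B \<in> sets borel"
    using measurable_sets[OF meas E] dom by (simp add: spc sets_restrict_space_iff sets_volume)
  have "emeasure (distr (restrict_space v (fst C)) borel (snd C)) E
      = emeasure (restrict_space v (fst C)) ?B"
    using emeasure_distr[OF meas E] by (simp add: spc)
  also have "\<dots> = emeasure v ?B"
    using dom by (intro emeasure_restrict_space) (auto simp: space_volume)
  also have "\<dots> = (\<integral>\<^sup>+x\<in>snd C ` ?B. ennreal (sqrt (det (g C x))) \<partial>lborel)"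
    using B C by (intro emeasure_volume_chart) auto
  also have "snd C ` ?B = E \<inter> chart_image C"
    using C by (auto simp: chart_image_def)
  also have "(\<integral>\<^sup>+x\<in>E \<inter> chart_image C. ennreal (sqrt (det (g C x))) \<partial>lborel)
      = (\<integral>\<^sup>+x. ennreal (indicator (chart_image C) x * sqrt (det (g C x))) * indicator E x \<partial>lborel)"
    by (intro nn_integral_cong) (auto simp: indicator_def)
  also have "\<dots> = emeasure (density lborel
      (\<lambda>x. ennreal (indicator (chart_image C) x * sqrt (det (g C x))))) E"
    using E dens by (subst emeasure_density) auto
  finally show "emeasure (distr (restrict_space v (fst C)) borel (snd C)) E = \<dots>" .
qed simp

lemma integral_chart:
  fixes H :: "'m \<Rightarrow> complex"
  assumes C: "C \<in> A" and H: "H \<in> borel_measurable borel" and H0: "\<And>p. p \<notin> fst C \<Longrightarrow> H p = 0"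
  defines "L \<equiv> \<lambda>x. indicator (chart_image C) x *\<^sub>R sqrt (det (g C x)) *\<^sub>R H (chart_inv C x)"
  shows "integrable v H \<longleftrightarrow> integrable lborel L"
    and "(\<integral>p. H p \<partial>v) = (\<integral>x. L x \<partial>lborel)"
proof -
  define U where "U = chart_image C"
  define d where "d = (\<lambda>x. indicator U x * sqrt (det (g C x)))"
  define K where "K = (\<lambda>x. indicator U x *\<^sub>R H (chart_inv C x))"
  let ?R = "restrict_space v (fst C)"
  have dom: "fst C \<in> sets v" using open_chart_domain[OF C] by (simp add: sets_volume)
  have U: "U \<in> sets borel" unfolding U_def using open_chart_image[OF C] by simp
  have snd_meas: "snd C \<in> ?R \<rightarrow>\<^sub>M borel"
    using borel_measurable_continuous_on_restrict[OF continuous_on_chart[OF C]]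
    by (simp add: measurable_def sets_restrict_space space_restrict_space sets_volume space_volume)
  have d_meas: "d \<in> borel_measurable borel"
    unfolding d_def U_def
    using borel_measurable_continuous_on_indicator[OF _ continuous_on_density[OF C]]
      open_chart_image[OF C] by simp
  have d_nn: "0 \<le> d x" for x
    using det_metric_pos[OF C, of x] by (auto simp: d_def U_def indicator_def)
  have "chart_inv C \<in> borel_measurable (restrict_space borel U)"
    unfolding U_def by (intro borel_measurable_continuous_on_restrict continuous_on_chart_inv C)
  then have "(\<lambda>x. H (chart_inv C x)) \<in> borel_measurable (restrict_space borel U)"
    using H by (rule measurable_compose)
  then have K_meas: "K \<in> borel_measurable borel"
    unfolding K_def using U by (simp add: borel_measurable_restrict_space_iff)
  have KH: "K (snd C p) = H p" if "p \<in> fst C" for p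
    using that C by (simp add: K_def U_def chart_in_image)
  have spc: "space ?R = fst C" by (simp add: space_restrict_space space_volume)
  have ind: "(\<lambda>p. indicator (fst C) p *\<^sub>R H p) = H" using H0 by (auto simp: indicator_def)
  have Ld: "(\<lambda>x. d x *\<^sub>R K x) = L" by (auto simp: L_def d_def K_def U_def indicator_def)
  have distr: "distr ?R borel (snd C) = density lborel (\<lambda>x. ennreal (d x))"
    using distr_chart_volume[OF C] by (simp add: d_def U_def)
  have "integrable v H \<longleftrightarrow> integrable ?R H"
    using integrable_restrict_space[of "fst C" v H] dom by (simp add: space_volume ind)
  also have "\<dots> \<longleftrightarrow> integrable ?R (\<lambda>p. K (snd C p))"
    by (intro Bochner_Integration.integrable_cong refl) (simp add: spc KH)
  also have "\<dots> \<longleftrightarrow> integrable (distr ?R borel (snd C)) K"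
    by (rule integrable_distr_eq[symmetric, OF snd_meas K_meas])
  also have "\<dots> \<longleftrightarrow> integrable lborel L"
    unfolding distr using d_meas d_nn K_meas by (subst integrable_density) (auto simp: Ld)
  finally show "integrable v H \<longleftrightarrow> integrable lborel L" .
  have "(\<integral>p. H p \<partial>v) = (\<integral>p. H p \<partial>?R)"
    using integral_restrict_space[of "fst C" v H] dom by (simp add: space_volume ind)
  also have "\<dots> = (\<integral>p. K (snd C p) \<partial>?R)"
    by (intro Bochner_Integration.integral_cong refl) (simp add: spc KH)
  also have "\<dots> = (\<integral>x. K x \<partial>distr ?R borel (snd C))"
    by (rule integral_distr[symmetric, OF snd_meas K_meas])
  also have "\<dots> = (\<integral>x. L x \<partial>lborel)"
    unfolding distr using d_meas d_nn K_meas by (subst integral_density) (auto simp: Ld)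
  finally show "(\<integral>p. H p \<partial>v) = (\<integral>x. L x \<partial>lborel)" .
qed

lemma emeasure_compact_in_chart_finite:
  assumes C: "C \<in> A" and K: "compact K" "K \<subseteq> fst C"
  shows "emeasure v K < \<infinity>"
proof -
  let ?K = "snd C ` K"
  have cK: "compact ?K"
    using compact_continuous_image[OF continuous_on_subset[OF continuous_on_chart[OF C] K(2)] K(1)] .
  have "?K \<subseteq> chart_image C" using K by (auto simp: chart_image_def)
  then have cont: "continuous_on ?K (\<lambda>x. sqrt (det (g C x)))"
    using continuous_on_density[OF C] continuous_on_subset by blast
  have nn: "0 \<le> sqrt (det (g C x))" if "x \<in> ?K" for x
    using less_imp_le[OF det_metric_pos[OF C, of x]] \<open>?K \<subseteq> chart_image C\<close> that
    by (auto simp del: image_subset_iff)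
  have "integrable lborel (\<lambda>x. indicator ?K x *\<^sub>R sqrt (det (g C x)))"
    by (rule borel_integrable_compact[OF cK cont])
  then have "(\<integral>\<^sup>+x. ennreal (norm (indicator ?K x *\<^sub>R sqrt (det (g C x)))) \<partial>lborel) < \<infinity>"
    by (simp add: integrable_iff_bounded)
  also have "(\<integral>\<^sup>+x. ennreal (norm (indicator ?K x *\<^sub>R sqrt (det (g C x)))) \<partial>lborel)
      = (\<integral>\<^sup>+x\<in>?K. ennreal (sqrt (det (g C x))) \<partial>lborel)"
    using nn by (intro nn_integral_cong) (auto simp: indicator_def)
  also have "\<dots> = emeasure v K"
    using assms by (intro emeasure_volume_chart[symmetric]) (auto simp: compact_imp_closed)
  finally show ?thesis .
qed

lemma emeasure_open_pos:
  assumes "open W" "W \<noteq> {}"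
  shows "emeasure v W \<noteq> 0"
proof
  assume 0: "emeasure v W = 0"
  obtain p where "p \<in> W" using assms by blast
  obtain C where C: "C \<in> A" "p \<in> fst C" using in_some_chart by blast
  let ?B = "fst C \<inter> W"
  have B: "open ?B" "p \<in> ?B" using C assms \<open>p \<in> W\<close> open_chart_domain[OF C(1)] by (auto intro: open_Int)
  have "emeasure v ?B \<le> emeasure v W" using assms by (intro emeasure_mono) (auto simp: sets_volume)
  then have "(\<integral>\<^sup>+x\<in>snd C ` ?B. ennreal (sqrt (det (g C x))) \<partial>lborel) = 0"
    using 0 B C emeasure_volume_chart[of C ?B] by simp
  moreover have S: "open (snd C ` ?B)" by (intro open_chart_of_open C assms)
  moreover have sub: "snd C ` ?B \<subseteq> chart_image C" by (auto simp: chart_image_def)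
  moreover have "(\<lambda>x. ennreal (sqrt (det (g C x))) * indicator (snd C ` ?B) x) \<in> borel_measurable lborel"
  proof -
    have "(\<lambda>x. indicator (snd C ` ?B) x *\<^sub>R sqrt (det (g C x))) \<in> borel_measurable borel"
      using S sub continuous_on_density[OF C(1)] continuous_on_subset
      by (intro borel_measurable_continuous_on_indicator) auto
    then have "(\<lambda>x. ennreal (indicator (snd C ` ?B) x *\<^sub>R sqrt (det (g C x)))) \<in> borel_measurable borel"
      by measurable
    moreover have "(\<lambda>x. ennreal (indicator (snd C ` ?B) x *\<^sub>R sqrt (det (g C x))))
        = (\<lambda>x. ennreal (sqrt (det (g C x))) * indicator (snd C ` ?B) x)"
      by (auto simp: indicator_def)
    ultimately show ?thesis by simp
  qed
  ultimately have "AE x in lborel. ennreal (sqrt (det (g C x))) * indicator (snd C ` ?B) x = 0"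
    by (subst (asm) nn_integral_0_iff_AE) auto
  then have "AE x in lborel. x \<notin> snd C ` ?B"
    by eventually_elim (use sub det_metric_pos[OF C(1)] in \<open>force simp: indicator_def split: if_splits\<close>)
  then have "emeasure lborel (snd C ` ?B) = 0"
    using S by (subst (asm) AE_iff_measurable[of "snd C ` ?B"]) auto
  then show False using S B(2) open_not_negligible[of "snd C ` ?B"]
    by (auto simp: negligible_iff_null_sets null_sets_def)
qed

end


section \<open>Partitions of unity and Green's formula\<close>

lemma has_real_derivative_pos_part_squared:
  "((\<lambda>s::real. (max 0 s)\<^sup>2) has_real_derivative 2 * max 0 s) (at s)"
proof -
  have bound: "norm ((max 0 (s + h))\<^sup>2 - (max 0 s)\<^sup>2 - 2 * max 0 s * h) \<le> h\<^sup>2" for h :: real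
  proof (cases "0 < s")
    case True
    show ?thesis
    proof (cases "0 \<le> s + h")
      case True
      then show ?thesis using \<open>0 < s\<close> by (simp add: max_def power2_eq_square algebra_simps)
    next
      case False
      have "0 \<le> s * (- s - 2 * h)" using False True by (intro mult_nonneg_nonneg) auto
      moreover have "s * (- s - 2 * h) \<le> h\<^sup>2"
        using zero_le_power2[of "s + h"] by (simp add: power2_eq_square algebra_simps)
      ultimately show ?thesis using False True by (simp add: max_def power2_eq_square algebra_simps)
    qed
  next
    case False
    then have "\<bar>max 0 (s + h)\<bar> \<le> \<bar>h\<bar>" by auto
    then have "(max 0 (s + h))\<^sup>2 \<le> h\<^sup>2" by (rule abs_le_square_iff[THEN iffD1])
    then show ?thesis using False by (simp add: max_def split: if_splits)
  qed
  have "((\<lambda>h. norm ((max 0 (s + h))\<^sup>2 - (max 0 s)\<^sup>2 - 2 * max 0 s * h) / norm h) \<longlongrightarrow> 0) (at 0)"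
  proof (rule tendsto_sandwich[OF _ _ tendsto_const])
    have "norm ((max 0 (s + h))\<^sup>2 - (max 0 s)\<^sup>2 - 2 * max 0 s * h) / norm h \<le> \<bar>h\<bar>" if "h \<noteq> 0" for h
    proof -
      have "h\<^sup>2 = \<bar>h\<bar> * norm h" by (simp add: power2_eq_square)
      moreover have "0 < norm h" using that by simp
      ultimately show ?thesis using bound[of h] by (simp only: pos_divide_le_eq)
    qed
    then show "\<forall>\<^sub>F h in at 0. norm ((max 0 (s + h))\<^sup>2 - (max 0 s)\<^sup>2 - 2 * max 0 s * h) / norm h \<le> \<bar>h\<bar>"
      by (auto simp: eventually_at_filter simp del: real_norm_def)
    show "((\<lambda>h::real. \<bar>h\<bar>) \<longlongrightarrow> 0) (at 0)" by (auto intro!: tendsto_eq_intros)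
  qed auto
  then show ?thesis
    unfolding has_field_derivative_def has_derivative_at by (auto intro: bounded_linear_mult_right)
qed

text \<open>Bump functions of class \<open>C\<^sup>1\<close> suffice for integration by parts; this one is positive exactly
  on the open ball of radius \<open>|r|\<close> around \<open>x0\<close>.\<close>

lemma C1_on_bump:
  fixes x0 :: "'a::euclidean_space"
  shows "Ck_on 1 (\<lambda>x. (max 0 (r\<^sup>2 - (x - x0) \<bullet> (x - x0)))\<^sup>2) S"
proof -
  have "Ck_on (Suc 0) (\<lambda>x. (max 0 (r\<^sup>2 - (x - x0) \<bullet> (x - x0)))\<^sup>2) UNIV"
  proof (rule Ck_on_SucI)
    fix x
    have "((\<lambda>x. r\<^sup>2 - (x - x0) \<bullet> (x - x0)) has_derivative (\<lambda>w. - (2 * ((x - x0) \<bullet> w)))) (at x)"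
      by (auto intro!: derivative_eq_intros simp: inner_commute)
    from has_derivative_compose[OF this
        has_real_derivative_pos_part_squared[unfolded has_field_derivative_def]]
    show "((\<lambda>x. (max 0 (r\<^sup>2 - (x - x0) \<bullet> (x - x0)))\<^sup>2) has_derivative
        (\<lambda>w. 2 * max 0 (r\<^sup>2 - (x - x0) \<bullet> (x - x0)) * - (2 * ((x - x0) \<bullet> w)))) (at x)" .
  qed (auto intro!: continuous_intros)
  then show ?thesis unfolding One_nat_def by (rule Ck_on_subset) simp
qed

context riemannian_manifold
begin

lemma exists_bump:
  "\<exists>C K (b :: 'm \<Rightarrow> real). C \<in> A \<and> compact K \<and> K \<subseteq> fst C \<and> C1 b \<and> (\<forall>q. 0 \<le> b q) \<and> 0 < b p \<and>
     (\<forall>q. q \<notin> K \<longrightarrow> b q = 0)"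
proof -
  obtain C where C: "C \<in> A" "p \<in> fst C" using in_some_chart by blast
  let ?x = "snd C p"
  obtain r where r: "0 < r" "cball ?x r \<subseteq> chart_image C"
    using open_chart_image[OF C(1)] chart_in_image[OF C] by (meson open_contains_cball)
  define \<rho> where "\<rho> = (\<lambda>x. (max 0 (r\<^sup>2 - (x - ?x) \<bullet> (x - ?x)))\<^sup>2)"
  define b where "b = (\<lambda>q. if q \<in> fst C then \<rho> (snd C q) else 0)"
  define K where "K = chart_inv C ` cball ?x r"
  have K: "compact K" "K \<subseteq> fst C"
    unfolding K_def using r chart_inv_in_domain[OF C(1)]
    by (intro compact_continuous_image continuous_on_subset[OF continuous_on_chart_inv[OF C(1)]]
        compact_cball, blast+)
  have b0: "b q = 0" if "q \<notin> K" for q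
  proof (cases "q \<in> fst C")
    case True
    have "snd C q \<notin> cball ?x r"
      using that chart_inv_chart[OF C(1) True] unfolding K_def by (metis image_eqI)
    then have "r < norm (snd C q - ?x)" by (simp add: dist_norm norm_minus_commute)
    then have "r\<^sup>2 \<le> (snd C q - ?x) \<bullet> (snd C q - ?x)"
      using r by (simp add: power2_norm_eq_inner[symmetric] power_mono)
    then show ?thesis using True by (simp add: b_def \<rho>_def)
  qed (simp add: b_def)
  have "C1 b"
  proof (rule C1_I, rule Ck_on_locally)
    fix D y assume D: "D \<in> A" and y: "y \<in> chart_image D"
    let ?q = "chart_inv D y"
    have q: "?q \<in> fst D" "snd D ?q = y" using D y by (auto intro: chart_inv_in_domain)
    \<comment> \<open>In another chart \<open>D\<close>, the function is a composition with the transition map on the overlap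
      and vanishes near points outside the overlap.\<close>
    show "\<exists>T. open T \<and> y \<in> T \<and> Ck_on 1 (\<lambda>x. b (chart_inv D x)) T"
    proof (cases "?q \<in> fst C")
      case True
      let ?T = "snd D ` (fst D \<inter> fst C)"
      have T: "open ?T" by (intro open_chart_of_open D open_chart_domain C)
      have "Ck_on 1 (\<rho> \<circ> transition D C) ?T"
        unfolding \<rho>_def
        by (rule C1_on_compose[OF T open_UNIV Ck_on_transition[OF D C(1)] C1_on_bump]) simp
      then have "Ck_on 1 (\<lambda>x. b (chart_inv D x)) ?T"
        by (rule Ck_on_cong[OF T, rotated]) (use D in \<open>auto simp: b_def transition_def\<close>)
      moreover have "y \<in> ?T" using True q by (metis IntI image_eqI)
      ultimately show ?thesis using T by blast
    next
      case False
      let ?T = "snd D ` (fst D \<inter> - K)"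
      have T: "open ?T"
        using K by (intro open_chart_of_open D) (simp add: compact_imp_closed open_Compl)
      have "Ck_on 1 (\<lambda>x. b (chart_inv D x)) ?T"
        by (rule Ck_on_cong[OF T _ Ck_on_const[of _ 0]]) (use D b0 in auto)
      moreover have "y \<in> ?T" using False K q by (metis ComplI IntI image_eqI subsetD)
      ultimately show ?thesis using T by blast
    qed
  qed
  moreover have "0 < b p" using C r by (simp add: b_def \<rho>_def)
  moreover have "0 \<le> b q" for q by (simp add: b_def \<rho>_def)
  ultimately show ?thesis using C(1) K b0 by blast
qed

text \<open>The functions are indexed by finitely many points of the manifold; \<open>\<psi> k\<close> vanishes outside the
  compact set \<open>K k\<close>, which lies in the domain of the chart \<open>C k\<close>.\<close>

lemma partition_of_unity:
  "\<exists>P C K (\<psi> :: 'm \<Rightarrow> 'm \<Rightarrow> real). finite P \<and>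
     (\<forall>k\<in>P. C k \<in> A \<and> compact (K k) \<and> K k \<subseteq> fst (C k) \<and> C1 (\<psi> k) \<and> (\<forall>q. q \<notin> K k \<longrightarrow> \<psi> k q = 0)) \<and>
     (\<forall>q. (\<Sum>k\<in>P. \<psi> k q) = 1)"
proof -
  have "\<forall>p. \<exists>C K (b :: 'm \<Rightarrow> real). C \<in> A \<and> compact K \<and> K \<subseteq> fst C \<and> C1 b \<and> (\<forall>q. 0 \<le> b q) \<and>
      0 < b p \<and> (\<forall>q. q \<notin> K \<longrightarrow> b q = 0)"
    using exists_bump by blast
  then obtain C K and b :: "'m \<Rightarrow> 'm \<Rightarrow> real" where
    *: "\<And>p. C p \<in> A \<and> compact (K p) \<and> K p \<subseteq> fst (C p) \<and> C1 (b p) \<and> (\<forall>q. 0 \<le> b p q) \<and>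
      0 < b p p \<and> (\<forall>q. q \<notin> K p \<longrightarrow> b p q = 0)"
    by metis
  have "open {q. 0 < b p q}" for p
    using * by (intro open_Collect_less continuous_on_const C1_continuous_on) auto
  moreover have "UNIV \<subseteq> (\<Union>p\<in>UNIV. {q. 0 < b p q})" using * by blast
  ultimately obtain P where P: "finite P" "UNIV \<subseteq> (\<Union>p\<in>P. {q. 0 < b p q})"
    using compactE_image[OF compact_UNIV, of UNIV "\<lambda>p. {q. 0 < b p q}"] by metis
  define S where "S = (\<lambda>q. \<Sum>k\<in>P. b k q)"
  have S_pos: "0 < S q" for q
  proof -
    obtain k where "k \<in> P" "0 < b k q" using P(2) by blast
    then show ?thesis unfolding S_def using P(1) * by (intro sum_pos2) auto
  qed
  show ?thesis
  proof (intro exI conjI ballI allI impI)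
    show "C1 (\<lambda>q. b k q * S q powr - 1)" if "k \<in> P" for k
      by (intro C1_mult C1_powr S_pos) (use * in \<open>auto simp: S_def intro: C1_sum\<close>)
    show "(\<Sum>k\<in>P. b k q * S q powr - 1) = 1" for q
      using S_pos[of q] by (simp add: powr_minus_divide S_def flip: sum_divide_distrib)
    show "b k q * S q powr - 1 = 0" if "q \<notin> K k" for k q using that * by simp
  qed (use P(1) * in auto)
qed

lemma finite_measure_volume: "finite_measure v"
proof -
  obtain P C K and \<psi> :: "'m \<Rightarrow> 'm \<Rightarrow> real" where *: "finite P"
    "\<forall>k\<in>P. C k \<in> A \<and> compact (K k) \<and> K k \<subseteq> fst (C k) \<and> C1 (\<psi> k) \<and> (\<forall>q. q \<notin> K k \<longrightarrow> \<psi> k q = 0)"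
    "\<forall>q. (\<Sum>k\<in>P. \<psi> k q) = 1"
    using partition_of_unity by blast
  have P: "finite P" "C k \<in> A" "compact (K k)" "K k \<subseteq> fst (C k)" "C1 (\<psi> k)"
    "q \<notin> K k \<Longrightarrow> \<psi> k q = 0" if "k \<in> P" for k q
    using * that by auto
  have sum1: "(\<Sum>k\<in>P. \<psi> k q) = 1" for q using *(3) by blast
  have "q \<in> (\<Union>k\<in>P. K k)" for q
  proof (rule ccontr)
    assume "q \<notin> (\<Union>k\<in>P. K k)"
    then have "(\<Sum>k\<in>P. \<psi> k q) = 0" using P(6) by (intro sum.neutral) auto
    then show False using sum1[of q] by simp
  qed
  then have "emeasure v UNIV \<le> emeasure v (\<Union>k\<in>P. K k)"
    using *(1) P by (intro emeasure_mono) (auto simp: sets_volume intro!: sets.finite_UN borel_compact)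
  also have "\<dots> \<le> (\<Sum>k\<in>P. emeasure v (K k))"
    using *(1) P by (intro emeasure_subadditive_finite) (auto simp: sets_volume borel_compact)
  also have "\<dots> < \<infinity>"
    using *(1) emeasure_compact_in_chart_finite[OF P(2-4)] by simp
  finally show ?thesis by (intro finite_measureI) (simp add: space_volume less_top)
qed

text \<open>The components of the field whose divergence is the local expression of the Laplacian, up to
  the density of the volume, are smooth.\<close>

lemma smooth_on_flux:
  assumes "C \<in> A" "smooth_on w (chart_image C)"
  shows "Ck_on k (\<lambda>z. \<Sum>j\<in>UNIV. (sqrt (det (g C z)) * matrix_inv (g C z) $ i $ j) *\<^sub>R partial j w z)
      (chart_image C)"
proof -
  have partial: "Ck_on k (partial i w) (chart_image C)" for i
    using Ck_on_SucD(2)[of k w "chart_image C" "axis i 1"] assms(2)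
    unfolding smooth_on_def partial_def by blast
  show "Ck_on k (\<lambda>z. \<Sum>j\<in>UNIV. (sqrt (det (g C z)) * matrix_inv (g C z) $ i $ j) *\<^sub>R partial j w z)
      (chart_image C)"
    by (intro Ck_on_sum Ck_on_scaleR Ck_on_mult open_chart_image Ck_on_density Ck_on_metric_inv partial
        assms(1))
qed

text \<open>Green's formula for a test function supported in one chart. The two summands are kept under
  one integral, because in coordinates their sum is the divergence of the compactly supported
  field \<open>Y\<close>, divided by the density of the volume.\<close>

lemma green_in_chart:
  assumes C: "C \<in> A" and K: "compact K" "K \<subseteq> fst C"
    and \<eta>: "C1 \<eta>" "\<And>p. p \<notin> K \<Longrightarrow> \<eta> p = 0"
    and lap: "has_laplacian A g u f"
  shows "integrable v (\<lambda>p. \<eta> p * f p + grad_inner \<eta> u p)"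
    and "(\<integral>p. \<eta> p * f p + grad_inner \<eta> u p \<partial>v) = 0"
proof -
  \<comment> \<open>\<open>X\<close> is the field \<open>sqrt (det g) grad u\<close> in coordinates, and \<open>Y\<close> its product with the test
    function, extended by zero to the whole space.\<close>
  define T where "T = (\<lambda>p. \<eta> p * f p + grad_inner \<eta> u p)"
  define U where "U = chart_image C"
  define d where "d = (\<lambda>z. sqrt (det (g C z)))"
  define E where "E = \<eta> \<circ> chart_inv C"
  define W where "W = u \<circ> chart_inv C"
  define X where "X = (\<lambda>i z. \<Sum>j\<in>UNIV. (d z * matrix_inv (g C z) $ i $ j) *\<^sub>R partial j W z)"
  define Y where "Y = (\<lambda>i z. if z \<in> U then E z * X i z else 0)"
  define K' where "K' = snd C ` K"
  have smooth_u: "smooth_function A u" using lap by (simp add: has_laplacian_def)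
  have C1u: "C1 u" by (rule smooth_function_C1[OF smooth_u])
  have U: "open U" unfolding U_def by (rule open_chart_image[OF C])
  have d_pos: "0 < d z" if "z \<in> U" for z using det_metric_pos[OF C] that by (simp add: d_def U_def)
  have K'_compact: "compact K'"
    unfolding K'_def using continuous_on_chart[OF C] K
    by (intro compact_continuous_image) (auto intro: continuous_on_subset)
  have K'U: "K' \<subseteq> U" using K by (auto simp: K'_def U_def chart_image_def)
  have E0: "E z = 0" if "z \<in> U" "z \<notin> K'" for z
  proof -
    have "chart_inv C z \<notin> K" using that chart_chart_inv[OF C] unfolding K'_def U_def by (metis image_eqI)
    then show ?thesis using \<eta>(2) by (simp add: E_def)
  qed
  have Y0: "Y i z = 0" if "z \<notin> K'" for i z using E0 that by (simp add: Y_def)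
  have E1: "Ck_on 1 E U" unfolding E_def U_def by (rule C1_D[OF \<eta>(1) C])
  have X1: "Ck_on 1 (X i) U" for i
    unfolding X_def d_def U_def W_def using smooth_u C
    by (intro smooth_on_flux) (auto simp: smooth_function_def)
  have Y1: "Ck_on 1 (Y i) UNIV" for i
  proof (rule Ck_on_locally)
    fix z :: "real^'n"
    show "\<exists>T. open T \<and> z \<in> T \<and> Ck_on 1 (Y i) T"
    proof (cases "z \<in> U")
      case True
      have "Ck_on 1 (Y i) U"
        by (rule Ck_on_cong[OF U _ Ck_on_mult[OF U E1 X1[of i]]]) (simp add: Y_def)
      then show ?thesis using True U by blast
    next
      case False
      have o: "open (- K')" using K'_compact by (simp add: compact_imp_closed open_Compl)
      have "Ck_on 1 (Y i) (- K')"
        by (rule Ck_on_cong[OF o _ Ck_on_const[of _ 0]]) (simp add: Y0)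
      then show ?thesis using False K'U o by blast
    qed
  qed
  have int_Y: "integrable lborel (partial i (Y i))" "(\<integral>z. partial i (Y i) z \<partial>lborel) = 0" for i
    using integral_directional_derivative_eq_0[OF Y1 K'_compact Y0] unfolding partial_def by auto
  have partial_Y_cont: "continuous_on UNIV (partial i (Y i))" for i
    using Ck_on_SucD(2)[of 0 "Y i" UNIV "axis i 1"] Y1[of i] unfolding partial_def One_nat_def by simp
  have partial_Y: "partial i (Y i) z = E z * partial i (X i) z + partial i E z * X i z" if "z \<in> U" for i z
  proof -
    have "(E has_derivative frechet_derivative E (at z)) (at z)"
      "(X i has_derivative frechet_derivative (X i) (at z)) (at z)"
      using Ck_on_SucD(1)[of 0] E1 X1[of i] that unfolding One_nat_def by blast+
    then have "((\<lambda>z. E z * X i z) has_derivative (\<lambda>w. E z * frechet_derivative (X i) (at z) w +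
        frechet_derivative E (at z) w * X i z)) (at z)"
      by (rule has_derivative_mult)
    then have "(Y i has_derivative (\<lambda>w. E z * frechet_derivative (X i) (at z) w +
        frechet_derivative E (at z) w * X i z)) (at z)"
      by (rule has_derivative_transform_within_open[OF _ U that]) (simp add: Y_def)
    then show ?thesis unfolding partial_def by (simp flip: frechet_derivative_at)
  qed
  have partial_Y_out: "partial i (Y i) z = 0" if "z \<notin> U" for i z
  proof -
    have "((\<lambda>z. 0) has_derivative (\<lambda>w. 0)) (at z)" by (rule has_derivative_const)
    then have "(Y i has_derivative (\<lambda>w. 0)) (at z)"
      by (rule has_derivative_transform_within_open[of _ _ _ _ "- K'"])
         (use K'_compact K'U that Y0 in \<open>auto simp: compact_imp_closed open_Compl\<close>)
    then show ?thesis unfolding partial_def by (simp flip: frechet_derivative_at)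
  qed
  have divergence: "(\<Sum>i\<in>UNIV. partial i (Y i) z)
      = indicator U z *\<^sub>R d z *\<^sub>R T (chart_inv C z)" for z
  proof (cases "z \<in> U")
    case True
    let ?p = "chart_inv C z"
    have p: "?p \<in> fst C" "snd C ?p = z" using True C by (auto simp: U_def intro: chart_inv_in_domain)
    have "local_laplacian (g C) W z = f ?p"
      using lap C p unfolding has_laplacian_def W_def by metis
    then have lapl: "(\<Sum>i\<in>UNIV. partial i (X i) z) = d z *\<^sub>R f ?p"
    proof -
      have "(\<Sum>i\<in>UNIV. partial i (X i) z) = d z *\<^sub>R local_laplacian (g C) W z"
        using d_pos[OF True] unfolding local_laplacian_def X_def d_def by simp
      then show ?thesis using \<open>local_laplacian (g C) W z = f ?p\<close> by simp
    qed
    have grad: "(\<Sum>i\<in>UNIV. partial i E z * X i z) = d z *\<^sub>R grad_inner \<eta> u ?p"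
      unfolding grad_inner_eq[OF \<eta>(1) C1u C p(1)] chart_grad_inner_def p(2) X_def E_def W_def
      by (simp add: scaleR_sum_right sum_distrib_left)
    have "(\<Sum>i\<in>UNIV. partial i (Y i) z)
        = E z * (\<Sum>i\<in>UNIV. partial i (X i) z) + (\<Sum>i\<in>UNIV. partial i E z * X i z)"
      by (simp add: partial_Y[OF True] sum.distrib sum_distrib_left)
    then show ?thesis
      unfolding lapl grad using True by (simp add: T_def E_def scaleR_add_right)
  qed (simp add: partial_Y_out)
  have T0: "T p = 0" if "p \<notin> K" for p
    using \<eta> that grad_inner_eq_0_outside[OF \<eta>(1) C1u _ that] K by (simp add: T_def compact_imp_closed)
  \<comment> \<open>Continuity of \<open>T\<close> provides the measurability needed for integration in the chart.\<close>
  have "continuous_on UNIV T"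
  proof -
    have "isCont T p" for p
    proof (cases "p \<in> fst C")
      case True
      have "continuous_on (fst C) (\<lambda>q. (1 / d (snd C q)) *\<^sub>R (\<Sum>i\<in>UNIV. partial i (Y i) (snd C q)))"
      proof (intro continuous_intros)
        have "snd C ` fst C = U" by (simp add: U_def chart_image_def)
        then show "continuous_on (fst C) (\<lambda>q. d (snd C q))"
          using continuous_on_compose2[OF continuous_on_density[OF C] continuous_on_chart[OF C]]
          unfolding d_def U_def by simp
        show "\<forall>q\<in>fst C. d (snd C q) \<noteq> 0"
          using d_pos chart_in_image[OF C] by (fastforce simp: U_def)
        show "continuous_on (fst C) (\<lambda>q. partial i (Y i) (snd C q))" for i
          using continuous_on_compose2[OF partial_Y_cont continuous_on_chart[OF C]] by simp
      qed
      moreover have "(1 / d (snd C q)) *\<^sub>R (\<Sum>i\<in>UNIV. partial i (Y i) (snd C q)) = T q" if "q \<in> fst C" for q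
        using that d_pos[of "snd C q"] C unfolding divergence by (simp add: U_def chart_in_image)
      ultimately have "continuous_on (fst C) T" by (simp cong: continuous_on_cong)
      then show ?thesis using True open_chart_domain[OF C] by (simp add: continuous_on_eq_continuous_at)
    next
      case False
      have "continuous_on (- K) T" by (rule continuous_on_eq[OF continuous_on_const[of _ 0]]) (simp add: T0)
      then have "\<forall>x\<in>- K. isCont T x"
        using K by (simp add: compact_imp_closed open_Compl continuous_on_eq_continuous_at)
      then show ?thesis using False K by blast
    qed
    then show ?thesis by (simp add: continuous_at_imp_continuous_on)
  qed
  then have T_meas: "T \<in> borel_measurable borel" by (rule borel_measurable_continuous_onI)
  have T_out: "T p = 0" if "p \<notin> fst C" for p using T0 K that by blast
  have L: "(\<lambda>x. indicator (chart_image C) x *\<^sub>R sqrt (det (g C x)) *\<^sub>R T (chart_inv C x))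
      = (\<lambda>z. \<Sum>i\<in>UNIV. partial i (Y i) z)"
    using divergence by (simp add: U_def d_def)
  show "integrable v (\<lambda>p. \<eta> p * f p + grad_inner \<eta> u p)"
    using integral_chart(1)[OF C T_meas T_out] int_Y unfolding L by (simp add: T_def)
  show "(\<integral>p. \<eta> p * f p + grad_inner \<eta> u p \<partial>v) = 0"
    using integral_chart(2)[OF C T_meas T_out] int_Y unfolding L by (simp add: T_def)
qed

lemma green:
  assumes \<eta>: "C1 \<eta>" and lap: "has_laplacian A g u f"
  shows "integrable v (\<lambda>p. \<eta> p * f p + grad_inner \<eta> u p)"
    and "(\<integral>p. \<eta> p * f p + grad_inner \<eta> u p \<partial>v) = 0"
proof -
  obtain P C K and \<psi> :: "'m \<Rightarrow> 'm \<Rightarrow> real" where *: "finite P"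
    "\<forall>k\<in>P. C k \<in> A \<and> compact (K k) \<and> K k \<subseteq> fst (C k) \<and> C1 (\<psi> k) \<and> (\<forall>q. q \<notin> K k \<longrightarrow> \<psi> k q = 0)"
    "\<forall>q. (\<Sum>k\<in>P. \<psi> k q) = 1"
    using partition_of_unity by blast
  have P: "finite P" "C k \<in> A" "compact (K k)" "K k \<subseteq> fst (C k)" "C1 (\<psi> k)"
    "q \<notin> K k \<Longrightarrow> \<psi> k q = 0" if "k \<in> P" for k q
    using * that by auto
  have sum1: "(\<Sum>k\<in>P. \<psi> k q) = 1" for q using *(3) by blast
  define \<theta> where "\<theta> = (\<lambda>k p. \<psi> k p *\<^sub>R \<eta> p)"
  have C1\<theta>: "C1 (\<theta> k)" if "k \<in> P" for k unfolding \<theta>_def by (intro C1_scaleR P(5) that \<eta>)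
  have C1u: "C1 u" using lap by (intro smooth_function_C1) (simp add: has_laplacian_def)
  have local: "integrable v (\<lambda>p. \<theta> k p * f p + grad_inner (\<theta> k) u p)"
    "(\<integral>p. \<theta> k p * f p + grad_inner (\<theta> k) u p \<partial>v) = 0" if "k \<in> P" for k
    using green_in_chart[OF P(2-4)[OF that] C1\<theta>[OF that] _ lap] P(6)[OF that] by (auto simp: \<theta>_def)
  have \<eta>_sum: "\<eta> p = (\<Sum>k\<in>P. \<theta> k p)" for p
    by (simp add: \<theta>_def sum1 flip: scaleR_sum_left)
  have "\<eta> p * f p + grad_inner \<eta> u p = (\<Sum>k\<in>P. \<theta> k p * f p + grad_inner (\<theta> k) u p)" for p
  proof -
    have "grad_inner \<eta> u p = grad_inner (\<lambda>p. \<Sum>k\<in>P. \<theta> k p) u p" using \<eta>_sum by presburger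
    also have "\<dots> = (\<Sum>k\<in>P. grad_inner (\<theta> k) u p)" by (rule grad_inner_sum_left[OF C1\<theta> C1u])
    finally show ?thesis by (simp add: \<eta>_sum[of p] sum.distrib sum_distrib_right)
  qed
  then show "integrable v (\<lambda>p. \<eta> p * f p + grad_inner \<eta> u p)"
    and "(\<integral>p. \<eta> p * f p + grad_inner \<eta> u p \<partial>v) = 0"
    using local by simp_all
qed

lemma integral_laplacian_symmetric:
  assumes "has_laplacian A g u f" "has_laplacian A g w h"
  shows "(\<integral>p. w p * f p - u p * h p \<partial>v) = 0"
proof -
  have C1: "C1 u" "C1 w" using assms by (auto intro: smooth_function_C1 simp: has_laplacian_def)
  have "(\<integral>p. (w p * f p + grad_inner w u p) - (u p * h p + grad_inner u w p) \<partial>v) = 0"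
    using green[OF C1(2) assms(1)] green[OF C1(1) assms(2)] by simp
  then show ?thesis using grad_inner_commute[OF C1] by simp
qed

end


section \<open>Eigenfunctions of the Laplacian\<close>

lemma partial_eqI: "(f has_derivative f') (at x) \<Longrightarrow> partial i f x = f' (axis i 1)"
  unfolding partial_def by (simp flip: frechet_derivative_at)

lemma Ck_on_has_derivative:
  "Ck_on 1 f S \<Longrightarrow> x \<in> S \<Longrightarrow> (f has_derivative frechet_derivative f (at x)) (at x)"
  using Ck_on_SucD(1)[of 0 f S x] by simp

context riemannian_manifold
begin

lemma local_laplacian_bounded_linear:
  fixes L :: "complex \<Rightarrow> complex"
  assumes L: "bounded_linear L" and C: "C \<in> A" and w: "smooth_on w (chart_image C)"
    and x: "x \<in> chart_image C"
  shows "local_laplacian (g C) (\<lambda>z. L (w z)) x = L (local_laplacian (g C) w x)"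
proof -
  define a where "a = (\<lambda>z i j. sqrt (det (g C z)) * matrix_inv (g C z) $ i $ j)"
  define X where "X = (\<lambda>i z. \<Sum>j\<in>UNIV. a z i j *\<^sub>R partial j w z)"
  interpret L: bounded_linear L by (rule L)
  have w1: "Ck_on 1 w (chart_image C)" using w unfolding smooth_on_def by blast
  have X1: "Ck_on 1 (X i) (chart_image C)" for i
    unfolding X_def a_def by (rule smooth_on_flux[OF C w])
  have "partial j (\<lambda>z. L (w z)) z = L (partial j w z)" if "z \<in> chart_image C" for j z
    using partial_eqI[OF L.has_derivative[OF Ck_on_has_derivative[OF w1 that]]] by (simp add: partial_def)
  then have flux: "(\<Sum>j\<in>UNIV. a z i j *\<^sub>R partial j (\<lambda>z. L (w z)) z) = L (X i z)"
    if "z \<in> chart_image C" for i z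
    using that by (simp add: X_def L.sum L.scaleR)
  have "partial i (\<lambda>z. \<Sum>j\<in>UNIV. a z i j *\<^sub>R partial j (\<lambda>z. L (w z)) z) x = L (partial i (X i) x)" for i
  proof -
    have "((\<lambda>z. L (X i z)) has_derivative (\<lambda>h. L (frechet_derivative (X i) (at x) h))) (at x)"
      by (rule L.has_derivative[OF Ck_on_has_derivative[OF X1 x]])
    then have "((\<lambda>z. \<Sum>j\<in>UNIV. a z i j *\<^sub>R partial j (\<lambda>z. L (w z)) z) has_derivative
        (\<lambda>h. L (frechet_derivative (X i) (at x) h))) (at x)"
      by (rule has_derivative_transform_within_open[OF _ open_chart_image[OF C] x]) (simp add: flux)
    from partial_eqI[OF this] show ?thesis by (simp add: partial_def)
  qed
  moreover have "local_laplacian (g C) w x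
      = (1 / sqrt (det (g C x))) *\<^sub>R (\<Sum>i\<in>UNIV. partial i (\<lambda>z. \<Sum>j\<in>UNIV. a z i j *\<^sub>R partial j w z) x)" for w
    by (simp add: local_laplacian_def a_def)
  ultimately show ?thesis by (simp add: X_def L.sum L.scaleR)
qed

lemma local_laplacian_add:
  assumes C: "C \<in> A" and w: "smooth_on w (chart_image C)" "smooth_on w' (chart_image C)"
    and x: "x \<in> chart_image C"
  shows "local_laplacian (g C) (\<lambda>z. w z + w' z) x
    = local_laplacian (g C) w x + local_laplacian (g C) w' x"
proof -
  define a where "a = (\<lambda>z i j. sqrt (det (g C z)) * matrix_inv (g C z) $ i $ j)"
  define X where "X = (\<lambda>w i z. \<Sum>j\<in>UNIV. a z i j *\<^sub>R (partial j w z :: complex))"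
  have w1: "Ck_on 1 w (chart_image C)" "Ck_on 1 w' (chart_image C)"
    using w unfolding smooth_on_def by blast+
  have X1: "Ck_on 1 (X w i) (chart_image C)" "Ck_on 1 (X w' i) (chart_image C)" for i
    unfolding X_def a_def by (rule smooth_on_flux[OF C w(1)], rule smooth_on_flux[OF C w(2)])
  have "partial j (\<lambda>z. w z + w' z) z = partial j w z + partial j w' z" if "z \<in> chart_image C" for j z
    using partial_eqI[OF has_derivative_add[OF Ck_on_has_derivative[OF w1(1) that]
          Ck_on_has_derivative[OF w1(2) that]]] by (simp add: partial_def)
  then have flux: "X (\<lambda>z. w z + w' z) i z = X w i z + X w' i z"
    if "z \<in> chart_image C" for i z
    using that by (simp add: X_def scaleR_add_right sum.distrib)
  have "partial i (X (\<lambda>z. w z + w' z) i) x = partial i (X w i) x + partial i (X w' i) x" for i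
  proof -
    have "((\<lambda>z. X w i z + X w' i z) has_derivative
        (\<lambda>h. frechet_derivative (X w i) (at x) h + frechet_derivative (X w' i) (at x) h)) (at x)"
      by (rule has_derivative_add[OF Ck_on_has_derivative[OF X1(1) x] Ck_on_has_derivative[OF X1(2) x]])
    then have "(X (\<lambda>z. w z + w' z) i has_derivative
        (\<lambda>h. frechet_derivative (X w i) (at x) h + frechet_derivative (X w' i) (at x) h)) (at x)"
      by (rule has_derivative_transform_within_open[OF _ open_chart_image[OF C] x]) (simp add: flux)
    from partial_eqI[OF this] show ?thesis by (simp add: partial_def)
  qed
  moreover have "local_laplacian (g C) w x = (1 / sqrt (det (g C x))) *\<^sub>R (\<Sum>i\<in>UNIV. partial i (X w i) x)" for w
    by (simp add: local_laplacian_def X_def a_def)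
  ultimately show ?thesis by (simp add: sum.distrib scaleR_add_right)
qed

lemma has_laplacian_bounded_linear:
  fixes L :: "complex \<Rightarrow> complex"
  assumes L: "bounded_linear L" and u: "has_laplacian A g u f"
  shows "has_laplacian A g (\<lambda>p. L (u p)) (\<lambda>p. L (f p))"
  unfolding has_laplacian_def
proof (intro conjI ballI)
  have smooth: "smooth_on (u \<circ> chart_inv C) (chart_image C)" if "C \<in> A" for C
    using u that by (simp add: has_laplacian_def smooth_function_def)
  have comp: "(\<lambda>p. L (u p)) \<circ> chart_inv C = (\<lambda>z. L ((u \<circ> chart_inv C) z))" for C
    by (simp add: comp_def)
  show "smooth_function A (\<lambda>p. L (u p))"
    unfolding smooth_function_def smooth_on_def comp
  proof (intro ballI allI)
    fix C k assume C: "C \<in> A"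
    show "Ck_on k (\<lambda>z. L ((u \<circ> chart_inv C) z)) (chart_image C)"
      using smooth[OF C] unfolding smooth_on_def
      by (intro Ck_on_bounded_linear[OF L open_chart_image[OF C]]) (rule spec)
  qed
  fix C p assume "C \<in> A" "p \<in> fst C"
  then show "local_laplacian (g C) ((\<lambda>p. L (u p)) \<circ> chart_inv C) (snd C p) = L (f p)"
    unfolding comp using u smooth
    by (subst local_laplacian_bounded_linear[OF L]) (auto simp: chart_in_image has_laplacian_def)
qed

lemma has_laplacian_add:
  assumes u: "has_laplacian A g u f" and w: "has_laplacian A g w h"
  shows "has_laplacian A g (\<lambda>p. u p + w p) (\<lambda>p. f p + h p)"
  unfolding has_laplacian_def
proof (intro conjI ballI)
  have smooth: "smooth_on (u \<circ> chart_inv C) (chart_image C)" "smooth_on (w \<circ> chart_inv C) (chart_image C)"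
    if "C \<in> A" for C
    using u w that by (simp_all add: has_laplacian_def smooth_function_def)
  have comp: "(\<lambda>p. u p + w p) \<circ> chart_inv C
      = (\<lambda>z. (u \<circ> chart_inv C) z + (w \<circ> chart_inv C) z)" for C
    by (simp add: comp_def)
  show "smooth_function A (\<lambda>p. u p + w p)"
    unfolding smooth_function_def smooth_on_def comp
  proof (intro ballI allI)
    fix C k assume C: "C \<in> A"
    show "Ck_on k (\<lambda>z. (u \<circ> chart_inv C) z + (w \<circ> chart_inv C) z) (chart_image C)"
      using smooth[OF C] unfolding smooth_on_def
      by (intro Ck_on_add[OF open_chart_image[OF C]]) (rule spec, assumption)+
  qed
  fix C p assume "C \<in> A" "p \<in> fst C"
  then show "local_laplacian (g C) ((\<lambda>p. u p + w p) \<circ> chart_inv C) (snd C p) = f p + h p"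
    unfolding comp using u w smooth
    by (subst local_laplacian_add) (auto simp: chart_in_image has_laplacian_def)
qed

lemma has_laplacian_const: "has_laplacian A g (\<lambda>p. c) (\<lambda>p. 0)"
proof -
  have "smooth_function A (\<lambda>p. c)"
    unfolding smooth_function_def smooth_on_def comp_def by (intro ballI allI Ck_on_const)
  moreover have "local_laplacian (g C) ((\<lambda>p. c) \<circ> chart_inv C) x = 0" for C x
    by (simp add: local_laplacian_def partial_def comp_def)
  ultimately show ?thesis by (simp add: has_laplacian_def)
qed

lemma has_laplacian_lincomb:
  assumes "finite I" "\<And>j. j \<in> I \<Longrightarrow> has_laplacian A g (u j) (\<lambda>p. - (\<mu> * u j p))"
  shows "has_laplacian A g (\<lambda>p. \<Sum>j\<in>I. c j * u j p) (\<lambda>p. - (\<mu> * (\<Sum>j\<in>I. c j * u j p)))"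
  using assms
proof (induction I rule: finite_induct)
  case empty
  then show ?case using has_laplacian_const[of 0] by simp
next
  case (insert i I)
  have "has_laplacian A g (\<lambda>p. c i * u i p) (\<lambda>p. c i * - (\<mu> * u i p))"
    by (intro has_laplacian_bounded_linear[OF bounded_linear_mult_right] insert.prems) simp
  moreover have "has_laplacian A g (\<lambda>p. \<Sum>j\<in>I. c j * u j p) (\<lambda>p. - (\<mu> * (\<Sum>j\<in>I. c j * u j p)))"
    by (intro insert.IH insert.prems) simp
  ultimately have "has_laplacian A g (\<lambda>p. c i * u i p + (\<Sum>j\<in>I. c j * u j p))
      (\<lambda>p. c i * - (\<mu> * u i p) + - (\<mu> * (\<Sum>j\<in>I. c j * u j p)))"
    by (rule has_laplacian_add)
  then show ?case using insert.hyps by (simp add: algebra_simps)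
qed

lemma has_laplacian_continuous: "has_laplacian A g u f \<Longrightarrow> continuous_on UNIV u"
  by (intro C1_continuous_on smooth_function_C1) (simp add: has_laplacian_def)

lemma continuous_measurable: "continuous_on UNIV u \<Longrightarrow> u \<in> borel_measurable v"
  using borel_measurable_continuous_onI by (simp add: measurable_def sets_volume space_volume)

lemma finite_measure_completion: "finite_measure (completion v)"
  using finite_measure.emeasure_finite[OF finite_measure_volume]
  by (intro finite_measureI) (simp add: emeasure_completion)

lemma measure_completion_pos: "0 < measure (completion v) UNIV"
proof -
  have "emeasure (completion v) UNIV \<noteq> 0"
    using emeasure_open_pos[of UNIV] by (simp add: emeasure_completion sets_volume)
  then show ?thesis
    using finite_measure.emeasure_eq_measure[OF finite_measure_completion, of UNIV]
    by (simp add: zero_less_measure_iff)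
qed

lemma continuous_L2:
  fixes u :: "'m \<Rightarrow> complex"
  assumes "continuous_on UNIV u" shows "L2 (completion v) u"
proof -
  have "compact (range u)" by (rule compact_continuous_image[OF assms compact_UNIV])
  then obtain B where B: "\<And>p. cmod (u p) \<le> B" using compact_imp_bounded[of "range u"] by (auto simp: bounded_iff)
  have meas: "u \<in> borel_measurable (completion v)"
    using continuous_measurable[OF assms] by (rule measurable_completion)
  have "(cmod (u p))\<^sup>2 \<le> B\<^sup>2" for p using B by (intro power_mono) auto
  then have "integrable (completion v) (\<lambda>p. (cmod (u p))\<^sup>2)"
    using meas by (intro finite_measure.integrable_const_bound[OF finite_measure_completion, of _ "B\<^sup>2"]) auto
  then show ?thesis using meas by (simp add: L2_def)
qed

lemma continuous_AE_eq:
  fixes u :: "'m \<Rightarrow> complex"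
  assumes "continuous_on UNIV u" "AE p in completion v. u p = c"
  shows "u p = c"
proof (rule ccontr)
  assume "u p \<noteq> c"
  have o: "open {p. u p \<noteq> c}" using assms(1) by (intro open_Collect_neq continuous_on_const)
  then have "emeasure (completion v) {p. u p \<noteq> c} = 0"
    using assms(2) by (subst (asm) AE_iff_measurable[of "{p. u p \<noteq> c}"]) (auto simp: space_volume sets_volume)
  then have "emeasure v {p. u p \<noteq> c} = 0"
    using o by (simp add: emeasure_completion sets_volume)
  then show False using emeasure_open_pos[OF o] \<open>u p \<noteq> c\<close> by auto
qed

text \<open>The eigenvalue of \<open>u\<close> may be complex a priori; that of \<open>w\<close> is real, so that the conjugate
  of \<open>w\<close> has the same eigenvalue.\<close>

lemma eigenfunctions_orthogonal:
  assumes u: "has_laplacian A g u (\<lambda>p. - (\<mu> * u p))" and w: "has_laplacian A g w (\<lambda>p. - (of_real \<nu> * w p))"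
    and "\<mu> \<noteq> of_real \<nu>"
  shows "L2_inner (completion v) u w = 0"
proof -
  have "has_laplacian A g (\<lambda>p. cnj (w p)) (\<lambda>p. cnj (- (of_real \<nu> * w p)))"
    by (rule has_laplacian_bounded_linear[OF bounded_linear_cnj w])
  from integral_laplacian_symmetric[OF u this]
  have "(\<integral>p. (of_real \<nu> - \<mu>) * (u p * cnj (w p)) \<partial>v) = 0" by (simp add: algebra_simps)
  then have "(\<integral>p. u p * cnj (w p) \<partial>v) = 0" using assms(3) by simp
  moreover have "(\<lambda>p. u p * cnj (w p)) \<in> borel_measurable v"
    using u w by (intro continuous_measurable continuous_intros has_laplacian_continuous)
  ultimately show ?thesis by (simp add: L2_inner_def integral_completion)
qed

text \<open>Orthogonality to constants, which are eigenfunctions for the eigenvalue zero.\<close>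

lemma eigenfunction_integral_0:
  assumes u: "has_laplacian A g u (\<lambda>p. - (\<mu> * u p))" and "\<mu> \<noteq> 0"
  shows "(\<integral>p. u p \<partial>completion v) = 0"
  using eigenfunctions_orthogonal[OF u, of "\<lambda>p. 1" 0] has_laplacian_const[of 1] assms(2)
  by (simp add: L2_inner_def)

text \<open>An eigenfunction is orthogonal to the basis elements of other frequencies. If its eigenvalue
  is none of the \<open>(lam j)\<^sup>2\<close>, then after subtraction of the mean it is orthogonal to the whole
  basis, hence constant; this includes the eigenvalue zero. Otherwise its mean is zero, and it is
  the sum of its components on the finitely many basis elements of its frequency.\<close>

lemma nonconstant_eigenfunction_in_span:
  assumes basis: "spectral_basis A g (completion v) lam \<phi>"
    and u: "eigenfunction A g \<mu> u" "\<not> u constant_on UNIV"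
  shows "\<exists>I l c. finite I \<and> (\<forall>j\<in>I. lam j = l) \<and> (AE p in completion v. u p = (\<Sum>j\<in>I. c j * \<phi> j p))"
proof -
  let ?M = "completion v"
  have hb: "hilbert_basis_L2_0 ?M \<phi>" and lam: "\<And>j. 0 < lam j"
    and \<phi>: "\<And>j. has_laplacian A g (\<phi> j) (\<lambda>p. - (of_real ((lam j)\<^sup>2) * \<phi> j p))"
    and lim: "filterlim lam at_top sequentially"
    using basis unfolding spectral_basis_def eigenfunction_def by blast+
  have lap: "has_laplacian A g u (\<lambda>p. - (\<mu> * u p))" using u by (simp add: eigenfunction_def)
  have cont: "continuous_on UNIV u" by (rule has_laplacian_continuous[OF lap])
  have L2u: "L2 ?M u" by (rule continuous_L2[OF cont])
  have L2_one: "L2 ?M (\<lambda>p. c)" for c by (intro continuous_L2 continuous_on_const)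
  have int: "integrable ?M f" if "L2 ?M f" for f
    using L2_integrable_mult_cnj[OF that L2_one[of 1]] by simp
  have orth: "L2_inner ?M u (\<phi> j) = 0" if "\<mu> \<noteq> of_real ((lam j)\<^sup>2)" for j
    by (rule eigenfunctions_orthogonal[OF lap \<phi> that])
  show ?thesis
  proof (cases "\<exists>j. \<mu> = of_real ((lam j)\<^sup>2)")
    case False
    define m where "m = (\<integral>p. u p \<partial>?M) / of_real (measure ?M UNIV)"
    have "L2_0 ?M (\<lambda>p. u p - m)"
      unfolding L2_0_def using L2u L2_one int measure_completion_pos
      by (auto intro: L2_diff simp: m_def space_volume scaleR_conv_of_real)
    moreover have "L2_inner ?M (\<lambda>p. u p - m) (\<phi> j) = 0" for j
    proof -
      have "(\<integral>p. \<phi> j p \<partial>?M) = 0" using hb by (simp add: hilbert_basis_L2_0_def L2_0_def)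
      then have "L2_inner ?M (\<lambda>p. m) (\<phi> j) = 0"
        by (simp add: L2_inner_def Bochner_Integration.integral_cnj)
      then show ?thesis
        using orth False L2u L2_one hilbert_basis_L2[OF hb] by (simp add: L2_inner_diff_left)
    qed
    ultimately have "AE p in ?M. u p - m = 0" by (rule orthogonal_to_basis_AE_0[OF hb])
    then have "u p = m" for p using cont by (intro continuous_AE_eq) auto
    then show ?thesis using u(2) by (auto simp: constant_on_def)
  next
    case True
    then obtain j0 where j0: "\<mu> = of_real ((lam j0)\<^sup>2)" by blast
    define I where "I = {k. lam k = lam j0}"
    define c where "c = (\<lambda>k. L2_inner ?M u (\<phi> k))"
    \<comment> \<open>multiplicities are finite since \<open>lam\<close> tends to infinity\<close>
    have "finite I"
    proof -
      have "\<forall>\<^sub>F k in sequentially. lam j0 < lam k" using lim by (simp add: filterlim_at_top_dense)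
      then obtain N where "\<And>k. N \<le> k \<Longrightarrow> lam j0 < lam k" by (auto simp: eventually_sequentially)
      then have "I \<subseteq> {..<N}" unfolding I_def by (force simp: not_le[symmetric])
      then show ?thesis using finite_subset by blast
    qed
    have "(\<integral>p. u p \<partial>?M) = 0"
      using lam[of j0] by (intro eigenfunction_integral_0[OF lap]) (simp add: j0)
    then have u0: "L2_0 ?M u" using L2u by (simp add: L2_0_def)
    have S0: "L2_0 ?M (\<lambda>p. \<Sum>j\<in>I. c j * \<phi> j p)"
      by (rule L2_0_basis_sum[OF finite_measure_completion hb \<open>finite I\<close>])
    have "L2_0 ?M (\<lambda>p. u p - (\<Sum>j\<in>I. c j * \<phi> j p))"
      using u0 S0 int[of u] int[of "\<lambda>p. \<Sum>j\<in>I. c j * \<phi> j p"] by (simp add: L2_0_def L2_diff)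
    moreover have "L2_inner ?M (\<lambda>p. u p - (\<Sum>j\<in>I. c j * \<phi> j p)) (\<phi> k) = 0" for k
    proof -
      have "L2_inner ?M (\<lambda>p. u p - (\<Sum>j\<in>I. c j * \<phi> j p)) (\<phi> k) = c k - (if k \<in> I then c k else 0)"
        using S0 L2u hilbert_basis_L2[OF hb]
        by (simp add: L2_inner_diff_left L2_0_def L2_inner_basis_sum[OF hb \<open>finite I\<close>] c_def)
      moreover have "c k = 0" if "k \<notin> I"
      proof -
        have "(lam k)\<^sup>2 \<noteq> (lam j0)\<^sup>2" using that lam[of k] lam[of j0] by (simp add: I_def power2_eq_iff)
        then have "\<mu> \<noteq> of_real ((lam k)\<^sup>2)" unfolding j0 of_real_eq_iff by simp
        then show ?thesis unfolding c_def by (rule orth)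
      qed
      ultimately show ?thesis by simp
    qed
    ultimately have "AE p in ?M. u p - (\<Sum>j\<in>I. c j * \<phi> j p) = 0"
      by (rule orthogonal_to_basis_AE_0[OF hb])
    then have "AE p in ?M. u p = (\<Sum>j\<in>I. c j * \<phi> j p)" by simp
    then show ?thesis using \<open>finite I\<close> I_def by blast
  qed
qed

lemma basis_sum_nonconstant_eigenfunction:
  assumes basis: "spectral_basis A g (completion v) lam \<phi>"
    and I: "finite I" "\<And>j. j \<in> I \<Longrightarrow> lam j = l"
    and pos: "0 < L2_normsq (completion v) (\<lambda>p. \<Sum>j\<in>I. c j * \<phi> j p)"
  shows "eigenfunction A g (of_real (l\<^sup>2)) (\<lambda>p. \<Sum>j\<in>I. c j * \<phi> j p)"
    and "\<not> (\<lambda>p. \<Sum>j\<in>I. c j * \<phi> j p) constant_on UNIV"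
proof -
  let ?f = "\<lambda>p. \<Sum>j\<in>I. c j * \<phi> j p"
  have hb: "hilbert_basis_L2_0 (completion v) \<phi>"
    and \<phi>: "\<And>j. has_laplacian A g (\<phi> j) (\<lambda>p. - (of_real ((lam j)\<^sup>2) * \<phi> j p))"
    using basis unfolding spectral_basis_def eigenfunction_def by blast+
  have nz: "\<exists>p. ?f p \<noteq> 0"
  proof (rule ccontr)
    assume "\<not> ?thesis"
    then have "?f = (\<lambda>p. 0)" by auto
    then show False using pos by (simp add: L2_normsq_def)
  qed
  have "has_laplacian A g (\<phi> j) (\<lambda>p. - (of_real (l\<^sup>2) * \<phi> j p))" if "j \<in> I" for j
    using \<phi>[of j] I(2)[OF that] by simp
  from has_laplacian_lincomb[OF I(1) this] nz
  show "eigenfunction A g (of_real (l\<^sup>2)) ?f" by (simp add: eigenfunction_def)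
  show "\<not> ?f constant_on UNIV"
  proof
    assume "?f constant_on UNIV"
    then obtain k where k: "?f = (\<lambda>p. k)" by (auto simp: constant_on_def)
    have "(\<integral>p. ?f p \<partial>completion v) = 0"
      using L2_0_basis_sum[OF finite_measure_completion hb I(1), of c] by (simp add: L2_0_def)
    then have "k = 0"
      unfolding k using measure_completion_pos by (simp add: space_volume)
    then show False using nz k by (metis (no_types, lifting))
  qed
qed

lemma set_integral_AE_cong:
  assumes "L2 M f" "L2 M h" "\<omega> \<in> sets M" "AE p in M. f p = h p"
  shows "(LINT p:\<omega>|M. (cmod (f p))\<^sup>2) = (LINT p:\<omega>|M. (cmod (h p))\<^sup>2)"
proof -
  have [measurable]: "f \<in> borel_measurable M" "h \<in> borel_measurable M" using assms by (auto simp: L2_def)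
  show ?thesis unfolding set_lebesgue_integral_def
    using assms(3,4) by (intro integral_cong_AE) auto
qed

end

theorem theorem4:
  fixes A :: "('m::t2_space, 'n::finite) chart set"
    and g :: "('m, 'n) metric_field"
    and v :: "'m measure"
    and lam :: "nat \<Rightarrow> real"
    and \<phi> :: "nat \<Rightarrow> 'm \<Rightarrow> complex"
    and \<omega> :: "'m set"
  assumes manifold: "compact_connected_riemannian_manifold A g"
    and volume: "riemannian_volume A g v"
    and basis: "spectral_basis A g (completion v) lam \<phi>"
    and gap: "\<exists>\<gamma>>0. \<forall>j k. lam j \<noteq> lam k \<longrightarrow> \<bar>lam j - lam k\<bar> \<ge> \<gamma>"
    and omega: "\<omega> \<in> sets (completion v)"
  shows "((\<lambda>T. observability_constant (completion v) lam \<phi> T \<omega> / T)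
           \<longlongrightarrow> (1 / 2) * g1 A g (completion v) \<omega>) at_top"
proof -
  interpret riemannian_manifold A g v by unfold_locales (fact manifold volume)+
  let ?M = "completion v"
  define Q where "Q = {(LINT x:\<omega>|?M. (cmod (u x))\<^sup>2) / L2_normsq ?M u | u.
      (\<exists>\<mu>. eigenfunction A g \<mu> u) \<and> \<not> u constant_on UNIV}"
  have g1: "g1 A g ?M \<omega> = Inf Q" by (simp add: g1_def Q_def L2_normsq_def)
  have hb: "hilbert_basis_L2_0 ?M \<phi>" and lam: "\<And>j. 0 < lam j" and mono: "mono lam"
    using basis unfolding spectral_basis_def by blast+
  obtain \<gamma> where \<gamma>: "0 < \<gamma>" "\<And>j k. lam j \<noteq> lam k \<Longrightarrow> \<gamma> \<le> \<bar>lam j - lam k\<bar>" using gap by blast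
  have num_nonneg: "0 \<le> (LINT x:\<omega>|?M. (cmod (u x))\<^sup>2)" for u
    unfolding set_integral_eq_L2_normsq_indicator by (rule L2_normsq_nonneg)
  have Q_nonneg: "0 \<le> q" if "q \<in> Q" for q
    using that by (auto simp: Q_def intro!: divide_nonneg_nonneg num_nonneg L2_normsq_nonneg)
  then have bdd: "bdd_below Q" by (rule bdd_belowI)
  have Q_mem: "(LINT x:\<omega>|?M. (cmod (\<Sum>j\<in>I. c j * \<phi> j x))\<^sup>2) / L2_normsq ?M (\<lambda>x. \<Sum>j\<in>I. c j * \<phi> j x) \<in> Q"
    if "finite I" "\<And>j. j \<in> I \<Longrightarrow> lam j = l" "0 < L2_normsq ?M (\<lambda>x. \<Sum>j\<in>I. c j * \<phi> j x)" for I l c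
  proof -
    have "eigenfunction A g (of_real (l\<^sup>2)) (\<lambda>x. \<Sum>j\<in>I. c j * \<phi> j x)"
      "\<not> (\<lambda>x. \<Sum>j\<in>I. c j * \<phi> j x) constant_on UNIV"
      by (rule basis_sum_nonconstant_eigenfunction[OF basis that(1) _ that(3)], rule that(2), assumption)+
    then show ?thesis
      unfolding Q_def by (intro CollectI exI[of _ "\<lambda>x. \<Sum>j\<in>I. c j * \<phi> j x"]) auto
  qed
  have "Q \<noteq> {}"
    using Q_mem[of "{0}" "lam 0" "\<lambda>j. 1"] L2_normsq_basis_sum[OF hb, of "{0}" "\<lambda>j. 1"] by auto
  have "((\<lambda>T. observability_constant ?M lam \<phi> T \<omega> / T) \<longlongrightarrow> Inf Q / 2) at_top"
    \<comment> \<open>The frequencies \<open>\<plusminus> lam j\<close> are separated by the smaller of \<open>\<gamma>\<close> and \<open>2 * lam 0\<close>, the latter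
      being the least distance between a positive and a negative one.\<close>
  proof (rule observability_constant_asymptotics[OF finite_measure_completion hb lam])
    show "min \<gamma> (2 * lam 0) \<le> 2 * lam j" for j using monoD[OF mono, of 0 j] by simp
    show "0 < min \<gamma> (2 * lam 0)" using \<gamma> lam by simp
    show "min \<gamma> (2 * lam 0) \<le> \<bar>lam j - lam k\<bar>" if "lam j \<noteq> lam k" for j k
      using \<gamma>(2)[OF that] by simp
    show "\<omega> \<in> sets ?M" by (rule omega)
    show "0 \<le> Inf Q" using \<open>Q \<noteq> {}\<close> Q_nonneg by (rule cInf_greatest)
    show "Inf Q * L2_normsq ?M (\<lambda>x. \<Sum>j\<in>I. c j * \<phi> j x) \<le> (LINT x:\<omega>|?M. (cmod (\<Sum>j\<in>I. c j * \<phi> j x))\<^sup>2)"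
      if "finite I" "\<And>j. j \<in> I \<Longrightarrow> lam j = l" for I l c
    proof (cases "L2_normsq ?M (\<lambda>x. \<Sum>j\<in>I. c j * \<phi> j x) = 0")
      case False
      then have pos: "0 < L2_normsq ?M (\<lambda>x. \<Sum>j\<in>I. c j * \<phi> j x)"
        using L2_normsq_nonneg[of ?M "\<lambda>x. \<Sum>j\<in>I. c j * \<phi> j x"] by linarith
      show ?thesis using cInf_lower[OF Q_mem[OF that pos] bdd] pos by (simp add: pos_le_divide_eq)
    qed (simp add: num_nonneg)
    fix e :: real assume "0 < e"
    then have "Inf Q < Inf Q + e" by simp
    then obtain q where "q \<in> Q" "q < Inf Q + e" using cInf_lessD[OF \<open>Q \<noteq> {}\<close>] by blast
    then obtain u \<mu> where u: "eigenfunction A g \<mu> u" "\<not> u constant_on UNIV"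
      and quot: "(LINT x:\<omega>|?M. (cmod (u x))\<^sup>2) / L2_normsq ?M u < Inf Q + e"
      unfolding Q_def by blast
    obtain I l c where I: "finite I" "\<forall>j\<in>I. lam j = l"
      and eq: "AE p in ?M. u p = (\<Sum>j\<in>I. c j * \<phi> j p)"
      using nonconstant_eigenfunction_in_span[OF basis u] by blast
    let ?f = "\<lambda>p. \<Sum>j\<in>I. c j * \<phi> j p"
    have cont: "continuous_on UNIV u" using u by (auto simp: eigenfunction_def intro: has_laplacian_continuous)
    have L2u: "L2 ?M u" by (rule continuous_L2[OF cont])
    have L2f: "L2 ?M ?f" by (intro L2_lincomb I hilbert_basis_L2[OF hb])
    have num: "(LINT x:\<omega>|?M. (cmod (u x))\<^sup>2) = (LINT x:\<omega>|?M. (cmod (?f x))\<^sup>2)"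
      by (rule set_integral_AE_cong[OF L2u L2f omega eq])
    have den: "L2_normsq ?M u = L2_normsq ?M ?f"
      unfolding L2_normsq_def using eq L2u L2f by (intro integral_cong_AE) (auto simp: L2_def)
    have "L2_normsq ?M u \<noteq> 0"
    proof
      assume "L2_normsq ?M u = 0"
      then have "AE p in ?M. u p = 0" by (simp add: L2_normsq_eq_0_iff[OF L2u])
      then have "u p = 0" for p by (rule continuous_AE_eq[OF cont])
      then show False using u(2) unfolding constant_on_def by blast
    qed
    then have "0 < L2_normsq ?M ?f" using L2_normsq_nonneg[of ?M u] den by simp
    moreover have "(LINT x:\<omega>|?M. (cmod (?f x))\<^sup>2) \<le> (Inf Q + e) * L2_normsq ?M ?f"
      using quot calculation unfolding num den by (simp add: pos_divide_less_eq less_imp_le)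
    ultimately show "\<exists>I l c. finite I \<and> (\<forall>j\<in>I. lam j = l) \<and>
        0 < L2_normsq ?M (\<lambda>x. \<Sum>j\<in>I. c j * \<phi> j x) \<and>
        (LINT x:\<omega>|?M. (cmod (\<Sum>j\<in>I. c j * \<phi> j x))\<^sup>2)
          \<le> (Inf Q + e) * L2_normsq ?M (\<lambda>x. \<Sum>j\<in>I. c j * \<phi> j x)"
      using I by (intro exI[of _ I] exI[of _ l] exI[of _ c] conjI)
  qed
  then show ?thesis by (simp add: g1)
qed

end
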